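(* Let $N\ge2$, $\Omega=\mathbb{R}^{N-1}\times(0,\infty)$, fix $\theta>0$, and use the notation of the context. (1) Let $(\phi,\psi)\in L^\infty(\Omega)\times L^\infty(\partial\Omega)$ and fix $\epsilon>0$. For every $T>0$, $\sup_{(x,t)\in\Omega\times(0,T)}|u_{\epsilon,\delta,k}(x,t)-w_{\epsilon,\theta}(x,t)|=O(k^{-1})$ as $k\to\infty$ with $\delta=k\theta$. (2) Let $(\phi,\psi)\in L^p(\Omega)\times L^p(\partial\Omega)$ with $p\in[1,\infty)$ and fix $\epsilon>0$. For every $R>0$, $\sup_{(x,t)\in Q(R)}|w_{\epsilon,\theta}(x,t)-z^D_\epsilon(x,t)|=O(f_p(\theta^{-1}))$ as $\theta\to0^+$. (3) Let $(\phi,\psi)\in L^\infty(\Omega)\times L^\infty(\partial\Omega)$ and fix $\epsilon>0$. For every $L>0$, $T>0$, $\sup_{(x,t)\in\Omega_L^c\times(0,T)}|w_{\epsilon,\theta}(x,t)-w^D_\epsilon(x,t)|=O(\theta^{-1})$ as $\theta\to\infty$. (4) Let $(\phi,\psi)\in L^\infty(\Omega)\times L^\infty(\partial\Omega)$. For every $L>0$, $T>0$, $\sup_{(x,t)\in\Omega_L\times(T,\infty)}|w_{\epsilon,\theta}(x,t)-V_\theta(x,t)|=O(\epsilon^{1/2})$ as $\epsilon\to0^+$. (5) Let $(\phi,\psi)\in BC(\Omega)\times L^\infty(\partial\Omega)$. For every compact $K\subset\Omega$ and $T>0$, $\lim_{\epsilon\to\infty}\sup_{(x,t)\in K\times(0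,T)}|w_{\epsilon,\theta}(x,t)-\phi(x)|=0$.
   Context: $x=(x',x_N)$, $\partial\Omega\cong\mathbb{R}^{N-1}$ with surface measure $d\sigma$, $\Delta'$ the Laplacian in $x'$. $\Gamma_d(x,t)=(4\pi t)^{-d/2}e^{-|x|^2/(4t)}$, $\partial_\xi\Gamma_1$ the spatial derivative of $\Gamma_1$, $y^*=(y',-y_N)$, $G_0(x,y,s)=\Gamma_N(x-y,s)-\Gamma_N(x-y^*,s)$, $P(x)=c_Nx_N|x|^{-N}$, $c_N=\pi^{-N/2}\Gamma(N/2)$. $\Omega_L=\{x\in\overline\Omega:0\le x_N\le L\}$, $\Omega^c_L=\{x\in\overline\Omega:x_N>L\}$, $Q(R)=\{(x,t)\in\overline\Omega\times(0,\infty):x_N+t>R\}$. With $p_N=(N-1)/2$, $f_p(r)=r^{-1}$ if $p<p_N$, $r^{-1}\log r$ if $p=p_N$, $r^{-\frac{N-1}{2p}}$ if $p>p_N$ ($r>1$). For $\epsilon,\delta,k>0$: $H(x,y,t)=-2\int_0^t\Gamma_{N-1}(x'-y',\frac{t-\tau}\epsilon+\frac k\delta\tau)\partial_\xi\Gamma_1(x_N+y_N+\frac\tau\delta,\frac{t-\tau}\epsilon)d\tau$, $G=G_0(x,y,t/\epsilon)+\delta^{-1}H$, $u_{\epsilon,\delta,k}(x,t)=\int_\Omega G(x,y,t)\phi(y)dy+\frac\delta\epsilon\int_{\partial\Omega}G(x,y,t)\psi(y)d\sigma(y)$ (solution of $\epsilon\partial_tu=\Delta u$ in $\Omega$, $\delta\partial_tu-k\Delta'u-\partial_{x_N}u=0$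 on $\partial\Omega$, initial data $(\phi,\psi)$). $\Psi(y,t)=\int_{\partial\Omega}\Gamma_{N-1}(y'-z',t/\theta)\psi(z)d\sigma(z)$ for $(y,t)\in\partial\Omega\times(0,\infty)$. $\tilde H(x,y,t)=-2\int_0^t\Gamma_{N-1}(x'-y',\frac{t-\tau}\epsilon+\frac\tau\theta)\partial_\xi\Gamma_1(x_N,\frac{t-\tau}\epsilon)d\tau$ and $w_{\epsilon,\theta}(x,t)=\int_\Omega G_0(x,y,t/\epsilon)\phi(y)dy+\frac1\epsilon\int_{\partial\Omega}\tilde H(x,y,t)\psi(y)d\sigma(y)$ (solution of $\epsilon\partial_tu=\Delta u$ in $\Omega$, $u=\Psi$ on $\partial\Omega\times(0,\infty)$, $u(0)=\phi$). $z^D_\epsilon(x,t)=\int_\Omega G_0(x,y,t/\epsilon)\phi(y)dy$. $w^D_\epsilon(x,t)=z^D_\epsilon(x,t)-\frac2\epsilon\int_0^t\int_{\partial\Omega}\Gamma_{N-1}(x'-y',\frac{t-\tau}\epsilon)\partial_\xi\Gamma_1(x_N,\frac{t-\tau}\epsilon)\psi(y)d\sigma(y)d\tau$ (Dirichlet problem with boundary value $\psi$). $V_\theta(x,t)=\int_{\partial\Omega}P(x'-y',x_N)\Psi(y,t)d\sigma(y)$ for $x\in\Omega$, $t>0$. *)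

theory Defs
  imports "HOL-Analysis.Analysis"
begin

text \<open>Points of the closed half space are pairs (x', x_N) with x' in real^'n,
  so N - 1 = CARD('n) and N = CARD('n) + 1 >= 2. The boundary is identified
  with real^'n via y' |-> (y', 0); its surface measure is Lebesgue measure.\<close>

type_synonym 'n pt = "(real^'n) \<times> real"

definition Nd :: "'n::finite itself \<Rightarrow> nat" where
  "Nd _ = CARD('n) + 1"

definition half_space :: "('n::finite) pt set" where
  "half_space = {x. snd x > 0}"

definition half_space_cl :: "('n::finite) pt set" where
  "half_space_cl = {x. snd x \<ge> 0}"

definition hk :: "'a::euclidean_space \<Rightarrow> real \<Rightarrow> real" where
  "hk x t = (4 * pi * t) powr (- real DIM('a) / 2) * exp (- (norm x)\<^sup>2 / (4 * t))"

definition dhk1 :: "real \<Rightarrow> real \<Rightarrow> real" where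
  "dhk1 \<xi> t = deriv (\<lambda>\<eta>::real. hk \<eta> t) \<xi>"

definition refl_pt :: "('n::finite) pt \<Rightarrow> 'n pt" where
  "refl_pt y = (fst y, - snd y)"

definition G0 :: "('n::finite) pt \<Rightarrow> 'n pt \<Rightarrow> real \<Rightarrow> real" where
  "G0 x y s = hk (x - y) s - hk (x - refl_pt y) s"

definition Hker :: "real \<Rightarrow> real \<Rightarrow> real \<Rightarrow> ('n::finite) pt \<Rightarrow> 'n pt \<Rightarrow> real \<Rightarrow> real" where
  "Hker \<epsilon> \<delta> k x y t = - 2 * (\<integral>\<tau>\<in>{0..t}.
      hk (fst x - fst y) ((t - \<tau>) / \<epsilon> + k / \<delta> * \<tau>) *
      dhk1 (snd x + snd y + \<tau> / \<delta>) ((t - \<tau>) / \<epsilon>) \<partial>lborel)"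

definition Gker :: "real \<Rightarrow> real \<Rightarrow> real \<Rightarrow> ('n::finite) pt \<Rightarrow> 'n pt \<Rightarrow> real \<Rightarrow> real" where
  "Gker \<epsilon> \<delta> k x y t = G0 x y (t / \<epsilon>) + Hker \<epsilon> \<delta> k x y t / \<delta>"

definition u_sol :: "real \<Rightarrow> real \<Rightarrow> real \<Rightarrow> (('n::finite) pt \<Rightarrow> real) \<Rightarrow> (real^'n \<Rightarrow> real)
    \<Rightarrow> 'n pt \<Rightarrow> real \<Rightarrow> real" where
  "u_sol \<epsilon> \<delta> k \<phi> \<psi> x t =
     (\<integral>y\<in>half_space. Gker \<epsilon> \<delta> k x y t * \<phi> y \<partial>lborel)
     + \<delta> / \<epsilon> * (\<integral>y'. Gker \<epsilon> \<delta> k x (y', 0) t * \<psi> y' \<partial>lborel)"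

definition Psi :: "real \<Rightarrow> (real^'n::finite \<Rightarrow> real) \<Rightarrow> real^'n \<Rightarrow> real \<Rightarrow> real" where
  "Psi \<theta> \<psi> y' t = (\<integral>z'. hk (y' - z') (t / \<theta>) * \<psi> z' \<partial>lborel)"

definition Htil :: "real \<Rightarrow> real \<Rightarrow> ('n::finite) pt \<Rightarrow> 'n pt \<Rightarrow> real \<Rightarrow> real" where
  "Htil \<epsilon> \<theta> x y t = - 2 * (\<integral>\<tau>\<in>{0..t}.
      hk (fst x - fst y) ((t - \<tau>) / \<epsilon> + \<tau> / \<theta>) * dhk1 (snd x) ((t - \<tau>) / \<epsilon>) \<partial>lborel)"

definition w_sol :: "real \<Rightarrow> real \<Rightarrow> (('n::finite) pt \<Rightarrow> real) \<Rightarrow> (real^'n \<Rightarrow> real)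
    \<Rightarrow> 'n pt \<Rightarrow> real \<Rightarrow> real" where
  "w_sol \<epsilon> \<theta> \<phi> \<psi> x t =
     (\<integral>y\<in>half_space. G0 x y (t / \<epsilon>) * \<phi> y \<partial>lborel)
     + 1 / \<epsilon> * (\<integral>y'. Htil \<epsilon> \<theta> x (y', 0) t * \<psi> y' \<partial>lborel)"

definition zD :: "real \<Rightarrow> (('n::finite) pt \<Rightarrow> real) \<Rightarrow> 'n pt \<Rightarrow> real \<Rightarrow> real" where
  "zD \<epsilon> \<phi> x t = (\<integral>y\<in>half_space. G0 x y (t / \<epsilon>) * \<phi> y \<partial>lborel)"

definition wD :: "real \<Rightarrow> (('n::finite) pt \<Rightarrow> real) \<Rightarrow> (real^'n \<Rightarrow> real) \<Rightarrow> 'n pt \<Rightarrow> real \<Rightarrow> real" where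
  "wD \<epsilon> \<phi> \<psi> x t = zD \<epsilon> \<phi> x t - 2 / \<epsilon> * (\<integral>\<tau>\<in>{0..t}.
      (\<integral>y'. hk (fst x - y') ((t - \<tau>) / \<epsilon>) * dhk1 (snd x) ((t - \<tau>) / \<epsilon>) * \<psi> y' \<partial>lborel)
      \<partial>lborel)"

definition cN :: "nat \<Rightarrow> real" where
  "cN N = pi powr (- real N / 2) * Gamma (real N / 2)"

definition Pker :: "('n::finite) pt \<Rightarrow> real" where
  "Pker x = cN (Nd TYPE('n)) * snd x * norm x powr (- real (Nd TYPE('n)))"

definition V_sol :: "real \<Rightarrow> (real^'n::finite \<Rightarrow> real) \<Rightarrow> 'n pt \<Rightarrow> real \<Rightarrow> real" where
  "V_sol \<theta> \<psi> x t = (\<integral>y'. Pker (fst x - y', snd x) * Psi \<theta> \<psi> y' t \<partial>lborel)"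

definition fp :: "nat \<Rightarrow> real \<Rightarrow> real \<Rightarrow> real" where
  "fp N p r = (if p < (real N - 1) / 2 then 1 / r
               else if p = (real N - 1) / 2 then ln r / r
               else r powr (- (real N - 1) / (2 * p)))"

definition Linf_half :: "(('n::finite) pt \<Rightarrow> real) \<Rightarrow> bool" where
  "Linf_half \<phi> \<longleftrightarrow> set_borel_measurable lborel half_space \<phi> \<and>
     (\<exists>C. AE y in lborel. y \<in> half_space \<longrightarrow> \<bar>\<phi> y\<bar> \<le> C)"

definition Linf_bd :: "(real^'n::finite \<Rightarrow> real) \<Rightarrow> bool" where
  "Linf_bd \<psi> \<longleftrightarrow> \<psi> \<in> borel_measurable lborel \<and> (\<exists>C. AE y in lborel. \<bar>\<psi> y\<bar> \<le> C)"

definition Lp_half :: "real \<Rightarrow> (('n::finite) pt \<Rightarrow> real) \<Rightarrow> bool" where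
  "Lp_half p \<phi> \<longleftrightarrow> set_borel_measurable lborel half_space \<phi> \<and>
     set_integrable lborel half_space (\<lambda>y. \<bar>\<phi> y\<bar> powr p)"

definition Lp_bd :: "real \<Rightarrow> (real^'n::finite \<Rightarrow> real) \<Rightarrow> bool" where
  "Lp_bd p \<psi> \<longleftrightarrow> \<psi> \<in> borel_measurable lborel \<and> integrable lborel (\<lambda>y. \<bar>\<psi> y\<bar> powr p)"

definition BC_half :: "(('n::finite) pt \<Rightarrow> real) \<Rightarrow> bool" where
  "BC_half \<phi> \<longleftrightarrow> continuous_on half_space \<phi> \<and> bounded (\<phi> ` half_space)"

end

theory Submission
  imports Defs "HOL-Probability.Distributions"
begin

text \<open>With \<open>\<xi> = x\<^sub>N\<close>, \<open>S = t / \<epsilon>\<close> and \<open>s = (t - \<tau>) / \<epsilon>\<close>, Fubini turns every boundary potential into an integral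
  over \<open>s\<close> of the density \<open>hit \<xi> s = - 2 \<partial>\<^sub>\<xi> \<Gamma>\<^sub>1(\<xi>, s)\<close> of the hitting time of the boundary against the
  heat semigroup applied to \<open>\<psi>\<close> at some time \<open>\<rho>(s)\<close>; the Poisson kernel is the same superposition over
  \<open>0 \<le> s < \<infinity>\<close>. Each of the five limits thus compares two densities or two times \<open>\<rho>(s)\<close>. The times are
  compared through \<open>\<parallel>\<Gamma>(\<cdot>, r\<^sub>2) - \<Gamma>(\<cdot>, r\<^sub>1)\<parallel> \<le> 2 d (r\<^sub>2 - r\<^sub>1) / r\<^sub>2\<close> in \<open>L\<^sup>1\<close>, the densities through
  \<open>hit \<xi> s \<le> C \<xi>^(-2b) s^(b-1)\<close> for \<open>b \<ge> 0\<close>, their Lipschitz bound \<open>s^(-3/2)\<close> in \<open>\<xi>\<close> and the scaling of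
  their mass on \<open>{0..S}\<close>.\<close>

subsection \<open>The Gaussian kernel\<close>

text \<open>Since \<open>\<psi>\<close> has no regularity, times can be compared only relative to
  their size. In part 4 they differ by \<open>\<epsilon> * s / \<theta>\<close> and are at least
  \<open>s\<close>, so the error is uniform over all \<open>t > T\<close>; the rate
  \<open>sqrt \<epsilon>\<close> comes from the tail \<open>s powr (- 3 / 2)\<close> of
  \<open>hit\<close> beyond \<open>S\<close> and from the Dirichlet kernel. In part 3 a singularity
  \<open>1 / s\<close> remains, which \<open>hit\<close> absorbs at heights above \<open>L\<close>.
  In part 2 the heat flow of \<open>L^p\<close> data decays like \<open>r powr (- a)\<close>,
  \<open>a = (N - 1) / (2 * p)\<close>, along the affine time
  \<open>\<rho>(s) = s + l * (S - s)\<close>, \<open>l = \<epsilon> / \<theta>\<close>; the three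
  cases of \<open>fp\<close> are \<open>a > 1\<close>, \<open>a = 1\<close> and
  \<open>a < 1\<close>, according to which end of \<open>{S / 2..S}\<close> dominates. The obstacle
  there is the corner where height and time both vanish, which \<open>Q(R)\<close> avoids.
  Conventions: \<open>0 powr c = 0\<close> makes \<open>hk\<close> and \<open>hit\<close> vanish at
  time 0, so the endpoints of time integrals are harmless. At height 0 the formulas give 0 for
  \<open>w_sol - zD\<close> and for \<open>V_sol\<close>, not the boundary traces, so parts 2 and 4
  treat boundary points as a separate case.\<close>

lemma hk_nonneg [simp]: "0 \<le> hk x t"
  by (simp add: hk_def)

lemma hk_minus_commute: "hk (x - y) t = hk (y - x) t"
  by (simp add: hk_def norm_minus_commute)

lemma borel_measurable_hk [measurable]:
  fixes f :: "'a \<Rightarrow> 'b::euclidean_space"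
  assumes [measurable]: "f \<in> borel_measurable M" "g \<in> borel_measurable M"
  shows "(\<lambda>x. hk (f x) (g x)) \<in> borel_measurable M"
  unfolding hk_def by measurable

text \<open>In each coordinate the kernel is the centred Gaussian of variance \<open>2 * t\<close>;
  the mass of \<open>hk\<close> in any dimension is thereby reduced to that of
  \<open>normal_density\<close>.\<close>

lemma hk_eq_prod_normal_density:
  fixes y :: "'a::euclidean_space"
  assumes "t > 0"
  shows "hk y t = (\<Prod>b\<in>Basis. normal_density 0 (sqrt (2 * t)) (y \<bullet> b))"
proof -
  have "(\<Prod>b\<in>Basis. normal_density 0 (sqrt (2 * t)) (y \<bullet> b))
      = (\<Prod>b\<in>Basis. (4 * pi * t) powr (- 1 / 2) * exp (- (y \<bullet> b)\<^sup>2 / (4 * t)))"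
  proof (rule prod.cong[OF refl])
    fix b :: 'a
    have "1 / sqrt (2 * pi * (sqrt (2 * t))\<^sup>2) = (4 * pi * t) powr (- 1 / 2)"
      using assms powr_minus_divide[of "4 * pi * t" "1 / 2"] by (simp add: powr_half_sqrt)
    then show "normal_density 0 (sqrt (2 * t)) (y \<bullet> b)
        = (4 * pi * t) powr (- 1 / 2) * exp (- (y \<bullet> b)\<^sup>2 / (4 * t))"
      using assms by (simp add: normal_density_def)
  qed
  also have "\<dots> = ((4 * pi * t) powr (- 1 / 2)) ^ DIM('a) * exp (\<Sum>b\<in>Basis. - (y \<bullet> b)\<^sup>2 / (4 * t))"
    by (simp add: prod.distrib exp_sum)
  also have "((4 * pi * t) powr (- 1 / 2)) ^ DIM('a) = (4 * pi * t) powr (- real DIM('a) / 2)"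
    using assms by (simp add: powr_powr flip: powr_realpow)
  also have "(\<Sum>b\<in>Basis. - (y \<bullet> b)\<^sup>2 / (4 * t)) = - (norm y)\<^sup>2 / (4 * t)"
    unfolding power2_norm_eq_inner euclidean_inner[of y y]
    by (simp add: sum_negf power2_eq_square flip: sum_divide_distrib)
  finally show ?thesis
    by (simp add: hk_def)
qed

lemma nn_integral_hk:
  assumes "t > 0"
  shows "(\<integral>\<^sup>+y. ennreal (hk (y::'a::euclidean_space) t) \<partial>lborel) = 1"
proof -
  interpret N: prob_space "density lborel (normal_density 0 (sqrt (2 * t)))"
    using assms by (intro prob_space_normal_density) simp
  have "(\<integral>\<^sup>+x. ennreal (normal_density 0 (sqrt (2 * t)) x) \<partial>lborel) = 1"
    using N.emeasure_space_1 by (simp add: emeasure_density)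
  moreover have "(\<integral>\<^sup>+y. ennreal (hk (y::'a) t) \<partial>lborel)
      = (\<integral>\<^sup>+y. (\<Prod>b\<in>Basis. ennreal (normal_density 0 (sqrt (2 * t)) ((y::'a) \<bullet> b))) \<partial>lborel)"
    using assms by (simp add: hk_eq_prod_normal_density prod_ennreal)
  ultimately show ?thesis
    using nn_integral_lborel_prod[of "\<lambda>(_::'a) x. ennreal (normal_density 0 (sqrt (2 * t)) x)"]
    by simp
qed

lemma nn_integral_hk_diff:
  fixes x :: "'a::euclidean_space"
  assumes "t > 0"
  shows "(\<integral>\<^sup>+y. ennreal (hk (x - y) t) \<partial>lborel) = 1"
proof -
  have "(\<integral>\<^sup>+y. ennreal (hk (x - y) t) \<partial>lborel) = (\<integral>\<^sup>+y. ennreal (hk (- x + y) t) \<partial>lborel)"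
    by (subst hk_minus_commute) simp
  also have "\<dots> = (\<integral>\<^sup>+y. ennreal (hk y t) \<partial>distr lborel borel ((+) (- x)))"
    by (subst nn_integral_distr) auto
  also have "\<dots> = 1"
    by (simp add: lborel_distr_plus nn_integral_hk[OF assms])
  finally show ?thesis .
qed

lemma
  fixes x :: "'a::euclidean_space"
  assumes "t > 0"
  shows integrable_hk_diff: "integrable lborel (\<lambda>y. hk (x - y) t)"
    and integral_hk_diff: "(\<integral>y. hk (x - y) t \<partial>lborel) = 1"
proof -
  show "integrable lborel (\<lambda>y. hk (x - y) t)"
    using nn_integral_hk_diff[OF assms, of x] by (intro integrableI_nonneg) auto
  show "(\<integral>y. hk (x - y) t \<partial>lborel) = 1"
    using nn_integral_hk_diff[OF assms, of x] by (simp add: integral_eq_nn_integral)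
qed

text \<open>Completing the square in \<open>z\<close>: the product of two Gaussians is a Gaussian in
  \<open>z\<close>, centred at the weighted mean of \<open>x\<close> and \<open>y\<close>, times a
  factor free of \<open>z\<close>. The semigroup law then needs only that \<open>hk\<close> has mass
  one.\<close>

lemma hk_semigroup_pointwise:
  fixes x y z :: "'a::euclidean_space"
  assumes "s > 0" "r > 0"
  shows "hk (x - z) s * hk (z - y) r
    = hk (x - y) (s + r) * hk ((r / (s + r)) *\<^sub>R x + (s / (s + r)) *\<^sub>R y - z) (s * r / (s + r))"
proof -
  define X where "X = x - z"
  define Y where "Y = y - z"
  have e: "(r / (s + r)) *\<^sub>R x + (s / (s + r)) *\<^sub>R y - z = (1 / (s + r)) *\<^sub>R (r *\<^sub>R X + s *\<^sub>R Y)"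
  proof -
    have "z = (r / (s + r)) *\<^sub>R z + (s / (s + r)) *\<^sub>R z"
      using assms by (simp flip: scaleR_left_distrib add_divide_distrib add: add.commute)
    then show ?thesis
      unfolding X_def Y_def by (simp add: algebra_simps)
  qed
  have n: "(norm X)\<^sup>2 / (4 * s) + (norm Y)\<^sup>2 / (4 * r)
     = (norm (X - Y))\<^sup>2 / (4 * (s + r)) + (norm (r *\<^sub>R X + s *\<^sub>R Y))\<^sup>2 / ((s + r)\<^sup>2 * (4 * (s * r / (s + r))))"
  proof -
    have 1: "(s + r)\<^sup>2 * (4 * (s * r / (s + r))) = 4 * s * r * (s + r)"
      using assms by (simp add: power2_eq_square)
    \<comment> \<open>In terms of \<open>a = X \<bullet> X\<close>,
      \<open>c = Y \<bullet> Y\<close>, \<open>b = X \<bullet> Y\<close> the completed square is a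
      purely rational identity, linear in \<open>a\<close>, \<open>b\<close>,
      \<open>c\<close>.\<close>
    have "a / (4 * s) + c / (4 * r)
      = (a - 2 * b + c) / (4 * (s + r)) + (r * r * a + 2 * r * s * b + s * s * c) / (4 * s * r * (s + r))" for a b c
      using assms by (simp add: divide_simps) (simp add: algebra_simps)
    from this[of "X \<bullet> X" "Y \<bullet> Y" "X \<bullet> Y"] show ?thesis
      unfolding 1 power2_norm_eq_inner by (simp add: inner_simps inner_commute[of Y X] algebra_simps)
  qed
  have p: "(4 * pi * s) powr c * (4 * pi * r) powr c = (4 * pi * (s + r)) powr c * (4 * pi * (s * r / (s + r))) powr c" for c
    using assms by (simp flip: powr_mult) (simp add: field_simps)
  have Y: "hk (z - y) r = hk Y r" "x - y = X - Y"
    by (simp_all add: Y_def X_def hk_minus_commute)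
  have "(norm ((1 / (s + r)) *\<^sub>R (r *\<^sub>R X + s *\<^sub>R Y)))\<^sup>2 / (4 * (s * r / (s + r))) = (norm (r *\<^sub>R X + s *\<^sub>R Y))\<^sup>2 / ((s + r)\<^sup>2 * (4 * (s * r / (s + r))))"
    by (simp add: power_divide)
  with n have n': "exp (- (norm X)\<^sup>2 / (4 * s)) * exp (- (norm Y)\<^sup>2 / (4 * r)) =
     exp (- (norm (X - Y))\<^sup>2 / (4 * (s + r))) * exp (- (norm ((1 / (s + r)) *\<^sub>R (r *\<^sub>R X + s *\<^sub>R Y)))\<^sup>2 / (4 * (s * r / (s + r))))"
    unfolding exp_add[symmetric] by (simp only: minus_divide_left[symmetric] minus_add_distrib[symmetric])
  have comb: "(a * b) * (c * d) = (a' * b') * (c' * d')" if "a * c = a' * c'" "b * d = b' * d'"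
    for a b c d a' b' c' d' :: real
    using that by algebra
  show ?thesis
    unfolding Y e X_def[symmetric] unfolding hk_def by (rule comb[OF p n'])
qed

lemma hk_semigroup:
  fixes x y :: "'a::euclidean_space"
  assumes "s > 0" "r > 0"
  shows "(\<integral>z. hk (x - z) s * hk (z - y) r \<partial>lborel) = hk (x - y) (s + r)"
  unfolding hk_semigroup_pointwise[OF assms]
  using assms by (simp add: integral_hk_diff)

lemma hk_le: "t > 0 \<Longrightarrow> hk (x::'a::euclidean_space) t \<le> (4 * pi * t) powr (- real DIM('a) / 2)"
  by (simp add: hk_def mult_left_le)

lemma hk_pt: "hk (x::('n::finite) pt) t = hk (fst x) t * hk (snd x) t" if "t \<ge> 0"
proof -
  have "(norm x)\<^sup>2 = (norm (fst x))\<^sup>2 + (norm (snd x))\<^sup>2"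
    by (simp add: norm_prod_def)
  then have "exp (- (norm x)\<^sup>2 / (4 * t)) = exp (- (norm (fst x))\<^sup>2 / (4 * t)) * exp (- (norm (snd x))\<^sup>2 / (4 * t))"
    by (simp flip: exp_add add: diff_divide_distrib)
  moreover have "- real DIM('n pt) / 2 = - real DIM(real^'n) / 2 + - real DIM(real) / 2"
    by simp
  ultimately show ?thesis
    unfolding hk_def by (simp only: powr_add) simp
qed

text \<open>Since \<open>hk (\<cdot>) r2\<close> dominates \<open>(r1/r2)^(d/2) hk (\<cdot>) r1\<close>, the two probability densities differ
  only in the missing mass \<open>1 - (r1/r2)^(d/2)\<close>, which Bernoulli's inequality bounds.\<close>
lemma
  fixes x :: "'a::euclidean_space"
  assumes r: "0 < r1" "r1 \<le> r2"
  shows integrable_hk_time_diff: "integrable lborel (\<lambda>y. \<bar>hk (x - y) r2 - hk (x - y) r1\<bar>)"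
    and integral_hk_time_diff: "(\<integral>y. \<bar>hk (x - y) r2 - hk (x - y) r1\<bar> \<partial>lborel) \<le> 2 * DIM('a) * ((r2 - r1) / r2)"
proof -
  define l where "l = (r1 / r2) powr (real DIM('a) / 2)"
  have i: "integrable lborel (\<lambda>y. hk (x - y) r1)" "integrable lborel (\<lambda>y. hk (x - y) r2)"
    using r by (auto intro: integrable_hk_diff)
  then show "integrable lborel (\<lambda>y. \<bar>hk (x - y) r2 - hk (x - y) r1\<bar>)"
    by auto
  have l1: "l \<le> 1" and l0: "l \<ge> 0"
    using r by (auto simp: l_def intro!: powr_le1)
  have dom: "l * hk z r1 \<le> hk z r2" for z :: 'a
  proof -
    have "l * (4 * pi * r1) powr (- real DIM('a) / 2) = (4 * pi * r2) powr (- real DIM('a) / 2)"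
      using r unfolding l_def
      by (simp add: powr_minus powr_mult powr_divide divide_simps)
    moreover have "exp (- (norm z)\<^sup>2 / (4 * r1)) \<le> exp (- (norm z)\<^sup>2 / (4 * r2))"
      using r by (simp add: frac_le)
    ultimately show ?thesis
      unfolding hk_def by (simp add: mult_left_mono flip: mult.assoc)
  qed
  have "(\<integral>y. \<bar>hk (x - y) r2 - hk (x - y) r1\<bar> \<partial>lborel)
      \<le> (\<integral>y. (hk (x - y) r2 - l * hk (x - y) r1) + (1 - l) * hk (x - y) r1 \<partial>lborel)"
  proof (rule integral_mono)
    fix y
    have "(1 - l) * hk (x - y) r1 \<ge> 0"
      using l1 by simp
    then show "\<bar>hk (x - y) r2 - hk (x - y) r1\<bar>
        \<le> (hk (x - y) r2 - l * hk (x - y) r1) + (1 - l) * hk (x - y) r1"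
      using dom[of "x - y"] unfolding left_diff_distrib abs_le_iff by linarith
  qed (use i in auto)
  \<comment> \<open>The dominated difference and the excess each have mass
    \<open>1 - l\<close>.\<close>
  also have "\<dots> = 2 * (1 - l)"
    using i r by (simp add: integral_hk_diff)
  also have "1 - l \<le> DIM('a) * ((r2 - r1) / r2)"
  proof -
    define q where "q = (r2 - r1) / r2"
    have q: "0 \<le> q" "q < 1" "r1 / r2 = 1 - q"
      using r by (auto simp: q_def divide_simps)
    \<comment> \<open>The exponent \<open>d / 2\<close> of \<open>l\<close> is raised to the integer
      \<open>d\<close>, so that Bernoulli's inequality for natural powers applies; this only
      enlarges the constant.\<close>
    have "1 - DIM('a) * q \<le> (1 - q) ^ DIM('a)"
      using Bernoulli_inequality[of "- q" "DIM('a)"] q by simp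
    also have "\<dots> = (1 - q) powr DIM('a)"
      using q by (simp add: powr_realpow)
    also have "\<dots> \<le> l"
      unfolding l_def q(3) using q by (intro powr_mono') auto
    finally show ?thesis
      by (simp add: q_def)
  qed
  finally show "(\<integral>y. \<bar>hk (x - y) r2 - hk (x - y) r1\<bar> \<partial>lborel) \<le> 2 * DIM('a) * ((r2 - r1) / r2)"
    by (simp add: field_simps)
qed

text \<open>Half of the Gaussian exponent is spent on the small factor; the other half is a Gaussian
  at the doubled time, which still has mass one.\<close>

lemma hk_tail_le:
  fixes z :: "'a::euclidean_space"
  assumes "t > 0" "0 \<le> r" "r \<le> norm z"
  shows "hk z t \<le> 2 powr (real DIM('a) / 2) * exp (- r\<^sup>2 / (8 * t)) * hk z (2 * t)"
proof -
  have "2 powr a * (4 * pi * (2 * t)) powr (- a) = (4 * pi * t) powr (- a)" for a :: real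
    using assms by (simp add: powr_minus powr_mult divide_simps flip: powr_mult[of 2 4, simplified])
  then have 1: "2 powr (real DIM('a) / 2) * (4 * pi * (2 * t)) powr (- real DIM('a) / 2) = (4 * pi * t) powr (- real DIM('a) / 2)"
    by (metis minus_divide_left)
  have "exp (- (norm z)\<^sup>2 / (4 * t)) \<le> exp (- r\<^sup>2 / (8 * t)) * exp (- (norm z)\<^sup>2 / (4 * (2 * t)))"
  proof -
    have "r\<^sup>2 \<le> (norm z)\<^sup>2"
      using assms by (simp add: power_mono)
    then show ?thesis
      using assms by (simp flip: exp_add add: field_simps)
  qed
  then have "hk z t \<le> (4 * pi * t) powr (- real DIM('a) / 2) * (exp (- r\<^sup>2 / (8 * t)) * exp (- (norm z)\<^sup>2 / (4 * (2 * t))))"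
    unfolding hk_def by (intro mult_left_mono) auto
  then show ?thesis
    unfolding hk_def 1[symmetric] by (simp only: mult_ac)
qed

subsection \<open>Set integrals on the half line\<close>

text \<open>Antiderivatives and substitutions yield gauge integrals on sets; nonnegativity turns
  these into Lebesgue integrals.\<close>

lemma
  fixes f :: "'a::euclidean_space \<Rightarrow> real"
  assumes [measurable]: "f \<in> borel_measurable borel" "A \<in> sets borel"
    and nn: "\<And>x. x \<in> A \<Longrightarrow> 0 \<le> f x" and I: "(f has_integral I) A"
  shows set_integrable_of_has_integral: "set_integrable lborel A f"
    and set_integral_of_has_integral: "(LINT x:A|lborel. f x) = I"
proof -
  have "0 \<le> I"
    using has_integral_nonneg[OF I] nn by blast
  moreover have "(\<integral>\<^sup>+x. ennreal (indicator A x * f x) \<partial>lborel) = ennreal I"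
    using nn_integral_has_integral_lebesgue[OF nn I] by simp
  moreover have "0 \<le> indicator A x * f x" for x
    using nn by (auto simp: indicator_def)
  ultimately show "set_integrable lborel A f" "(LINT x:A|lborel. f x) = I"
    unfolding set_integrable_def set_lebesgue_integral_def
    by (auto intro!: integrableI_nonneg simp: integral_eq_nn_integral)
qed

lemma
  fixes f g :: "'a \<Rightarrow> real"
  assumes [measurable]: "f \<in> borel_measurable M" "A \<in> sets M"
    and g: "set_integrable M A g" and le: "\<And>x. x \<in> A \<Longrightarrow> \<bar>f x\<bar> \<le> g x"
  shows set_integrable_dominated: "set_integrable M A f"
    and abs_set_integral_le: "\<bar>LINT x:A|M. f x\<bar> \<le> (LINT x:A|M. g x)"
proof -
  show f: "set_integrable M A f"
    using le unfolding set_integrable_def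
    by (intro Bochner_Integration.integrable_bound[OF g[unfolded set_integrable_def]])
       (force simp: indicator_def)+
  have "\<bar>LINT x:A|M. f x\<bar> \<le> (LINT x:A|M. \<bar>f x\<bar>)"
    using set_integral_norm_bound[OF f] by simp
  also have "\<dots> \<le> (LINT x:A|M. g x)"
    using f g le by (intro set_integral_mono set_integrable_abs) auto
  finally show "\<bar>LINT x:A|M. f x\<bar> \<le> (LINT x:A|M. g x)" .
qed

lemma
  fixes c S :: real
  assumes "c > -1" "S \<ge> 0"
  shows set_integrable_powr_from_0: "set_integrable lborel {0..S} (\<lambda>s. s powr c)"
    and set_integral_powr_from_0: "(LINT s:{0..S}|lborel. s powr c) = S powr (c + 1) / (c + 1)"
proof -
  have "((\<lambda>s. s powr c) has_integral S powr (c + 1) / (c + 1)) {0..S}"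
    using assms by (intro has_integral_powr_from_0)
  then show "set_integrable lborel {0..S} (\<lambda>s. s powr c)"
      "(LINT s:{0..S}|lborel. s powr c) = S powr (c + 1) / (c + 1)"
    by (auto intro: set_integrable_of_has_integral set_integral_of_has_integral)
qed

lemma
  fixes c S :: real
  assumes "c < -1" "S > 0"
  shows set_integrable_powr_to_inf: "set_integrable lborel {S..} (\<lambda>s. s powr c)"
    and set_integral_powr_to_inf: "(LINT s:{S..}|lborel. s powr c) = - (S powr (c + 1)) / (c + 1)"
proof -
  have "((\<lambda>s. s powr c) has_integral - (S powr (c + 1)) / (c + 1)) {S..}"
    using assms by (intro has_integral_powr_to_inf)
  then show "set_integrable lborel {S..} (\<lambda>s. s powr c)"
      "(LINT s:{S..}|lborel. s powr c) = - (S powr (c + 1)) / (c + 1)"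
    by (auto intro: set_integrable_of_has_integral set_integral_of_has_integral)
qed

text \<open>The substitution \<open>s = A / r\<close> leads to Euler's integral for
  \<open>Gamma \<alpha>\<close>. The case \<open>\<alpha> = 1 / 2\<close> yields the mass of
  \<open>hit\<close>, and \<open>\<alpha> = N / 2\<close> the Poisson kernel with its
  constant.\<close>

lemma
  fixes \<alpha> A :: real
  assumes \<alpha>: "\<alpha> > 0" and A: "A > 0"
  shows set_integrable_inverse_gamma: "set_integrable lborel {0..} (\<lambda>s. s powr (- \<alpha> - 1) * exp (- A / s))"
    and set_integral_inverse_gamma:
      "(LINT s:{0..}|lborel. s powr (- \<alpha> - 1) * exp (- A / s)) = Gamma \<alpha> * A powr (- \<alpha>)"
proof -
  define f where "f s = s powr (- \<alpha> - 1) * exp (- A / s)" for s :: real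
  have [measurable]: "f \<in> borel_measurable borel"
    unfolding f_def by measurable
  have G: "((\<lambda>t. t powr (\<alpha> - 1) / exp t) has_integral Gamma \<alpha>) {0<..}"
    by (rule has_integral_spike_set_eq[THEN iffD1, OF _ _ Gamma_integral_real[OF \<alpha>]])
      (auto intro: negligible_subset[of "{0}"])
  have "((\<lambda>r. \<bar>- A / r\<^sup>2\<bar> * f (A / r)) has_integral A powr (- \<alpha>) * Gamma \<alpha>) {0<..}"
  proof (rule has_integral_eq[OF _ has_integral_mult_right[OF G]])
    fix r :: real assume "r \<in> {0<..}"
    then have r: "r > 0" by simp
    have "\<bar>- A / r\<^sup>2\<bar> * f (A / r) = A / r powr 2 * (A powr (- \<alpha> - 1) / r powr (- \<alpha> - 1) * exp (- r))"
      using r A by (simp add: f_def powr_divide)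
    also have "A / r powr 2 * (A powr (- \<alpha> - 1) / r powr (- \<alpha> - 1) * exp (- r))
      = (A * A powr (- \<alpha> - 1)) / (r powr 2 * r powr (- \<alpha> - 1)) * exp (- r)"
      by simp
    also have "r powr 2 * r powr (- \<alpha> - 1) = r powr (1 - \<alpha>)"
      by (simp flip: powr_add)
    also have "(A * A powr (- \<alpha> - 1)) = A powr (- \<alpha>)"
      using A powr_mult_base[of A "- \<alpha> - 1"] by simp
    also have "A powr (- \<alpha>) / r powr (1 - \<alpha>) * exp (- r) = A powr (- \<alpha>) * (r powr (\<alpha> - 1) / exp r)"
      using powr_minus_divide[of r "1 - \<alpha>"] by (simp add: exp_minus divide_inverse)
    finally show "A powr - \<alpha> * (r powr (\<alpha> - 1) / exp r) = \<bar>- A / r\<^sup>2\<bar> * f (A / r)"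
      by simp
  qed
  \<comment> \<open>The change of variables is stated for absolutely integrable functions; the
    integrand is nonnegative, so gauge integrability suffices.\<close>
  moreover have "(\<lambda>r. \<bar>- A / r\<^sup>2\<bar> * f (A / r)) absolutely_integrable_on {0<..}"
    using calculation by (intro nonnegative_absolutely_integrable_1) (auto simp: f_def)
  ultimately have 1: "f absolutely_integrable_on ((\<lambda>r. A / r) ` {0<..})
      \<and> integral ((\<lambda>r. A / r) ` {0<..}) f = A powr (- \<alpha>) * Gamma \<alpha>"
    using A by (subst has_absolute_integral_change_of_variables_1'[symmetric, where g' = "\<lambda>r. - A / r\<^sup>2"])
      (auto intro!: derivative_eq_intros inj_onI simp: power2_eq_square)
  have "(\<lambda>r. A / r) ` {0<..} = {0<..}"
  proof (intro equalityI subsetI)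
    fix s :: real assume "s \<in> {0<..}"
    then show "s \<in> (\<lambda>r. A / r) ` {0<..}"
      using A by (intro image_eqI[of _ _ "A / s"]) auto
  qed (use A in auto)
  with 1 have "(f has_integral A powr (- \<alpha>) * Gamma \<alpha>) {0<..}"
    using set_lebesgue_integral_eq_integral(1)[of "{0<..}" f] by (simp only: has_integral_iff)
  then have F: "(f has_integral Gamma \<alpha> * A powr (- \<alpha>)) {0..}"
    by (subst has_integral_spike_set_eq[where S = "{0..}" and T = "{0<..}"])
      (auto intro: negligible_subset[of "{0}"] simp: mult.commute)
  have "set_integrable lborel {0..} f"
    by (rule set_integrable_of_has_integral[OF _ _ _ F]) (auto simp: f_def)
  moreover have "(LINT s:{0..}|lborel. f s) = Gamma \<alpha> * A powr (- \<alpha>)"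
    by (rule set_integral_of_has_integral[OF _ _ _ F]) (auto simp: f_def)
  ultimately show "set_integrable lborel {0..} (\<lambda>s. s powr (- \<alpha> - 1) * exp (- A / s))"
      "(LINT s:{0..}|lborel. s powr (- \<alpha> - 1) * exp (- A / s)) = Gamma \<alpha> * A powr (- \<alpha>)"
    unfolding f_def by auto
qed

subsection \<open>The hitting-time density\<close>

text \<open>The density in \<open>s\<close> of the time at which the diffusion generated by the Laplacian, started at
  height \<open>\<xi>\<close>, hits the boundary.\<close>
definition hit :: "real \<Rightarrow> real \<Rightarrow> real" where
  "hit \<xi> s = \<xi> / s * hk \<xi> s"

lemma borel_measurable_hit [measurable]:
  assumes [measurable]: "f \<in> borel_measurable M" "g \<in> borel_measurable M"
  shows "(\<lambda>x. hit (f x) (g x)) \<in> borel_measurable M"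
  unfolding hit_def by measurable

lemma hit_at_0 [simp]: "hit \<xi> 0 = 0"
  by (simp add: hit_def)

lemma hit_0 [simp]: "hit 0 s = 0"
  by (simp add: hit_def)

lemma hit_nonneg: "0 \<le> \<xi> \<Longrightarrow> 0 \<le> s \<Longrightarrow> 0 \<le> hit \<xi> s"
  by (simp add: hit_def)

text \<open>At \<open>s = 0\<close> the kernel is identically 0 and both sides vanish, so the
  identity may be used on closed time intervals.\<close>

lemma dhk1_eq_hit: "dhk1 \<xi> s = - hit \<xi> s / 2"
proof (cases "s = 0")
  case False
  have "((\<lambda>\<eta>. hk \<eta> s) has_field_derivative - hit \<xi> s / 2) (at \<xi>)"
    unfolding hk_def hit_def using False
    by (auto intro!: derivative_eq_intros simp: power2_eq_square divide_simps)
  then show ?thesis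
    unfolding dhk1_def by (rule DERIV_imp_deriv)
qed (simp add: dhk1_def hk_def hit_def)

lemma powr_minus_half_4_pi:
  assumes "s > 0"
  shows "(4 * pi * s) powr (- 1 / 2) = s powr (- 1 / 2) / sqrt (4 * pi)"
  using assms powr_minus_divide[of "4 * pi * s" "1 / 2"] powr_minus_divide[of s "1 / 2"]
  by (simp add: powr_half_sqrt real_sqrt_mult)

text \<open>The exponent is arranged to match the inverse gamma integrand with
  \<open>\<alpha> = 1 / 2\<close> and \<open>A = \<xi>\<^sup>2 / 4\<close>.\<close>

lemma hit_eq:
  assumes "s \<ge> 0"
  shows "hit \<xi> s = \<xi> / sqrt (4 * pi) * (s powr (- 3 / 2) * exp (- (\<xi>\<^sup>2 / 4) / s))"
proof (cases "s = 0")
  case False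
  then have s: "s > 0" using assms by simp
  have "s powr (- 1 / 2) / s = s powr (- 3 / 2)"
    using s powr_diff[of s "- 1 / 2" 1] by simp
  then show ?thesis
    unfolding hit_def hk_def using s powr_minus_half_4_pi[OF s] by (simp add: field_simps)
qed (simp add: hit_def hk_def)

lemma two_le_sqrt_4_pi: "2 \<le> sqrt (4 * pi)"
  using pi_gt3 by (simp add: real_sqrt_mult)

lemma hit_le:
  assumes "0 \<le> \<xi>" "0 \<le> s"
  shows "hit \<xi> s \<le> \<xi> / 2 * s powr (- 3 / 2)"
proof -
  have "\<xi> / sqrt (4 * pi) * (s powr (- 3 / 2) * exp (- (\<xi>\<^sup>2 / 4) / s)) \<le> \<xi> / 2 * (s powr (- 3 / 2) * 1)"
    using assms two_le_sqrt_4_pi by (intro mult_mono frac_le) auto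
  then show ?thesis
    using hit_eq[OF assms(2)] by simp
qed

text \<open>This is \<open>ln u \<le> u - 1\<close> at \<open>u = x / c\<close>, the point
  \<open>x = c\<close> being where \<open>x powr c * exp (- x)\<close> is largest; the further
  factor \<open>exp (- c)\<close> of the sharp constant is dropped.\<close>

lemma powr_mult_exp_minus_le:
  fixes c x :: real
  assumes "c > 0" "x > 0"
  shows "exp (- x) \<le> c powr c * x powr (- c)"
proof -
  have "c * ln (x / c) \<le> c * (x / c - 1)"
    using assms by (intro mult_left_mono ln_le_minus_one) auto
  then have "- x \<le> c * ln c - c * ln x"
    using assms by (simp add: ln_div algebra_simps)
  then have "exp (- x) \<le> exp (c * ln c - c * ln x)"
    by simp
  then show ?thesis
    using assms by (simp add: powr_def exp_diff exp_minus field_simps)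
qed

text \<open>The exponential is traded for the power \<open>c = b + 1 / 2\<close> of
  \<open>s / \<xi>\<^sup>2\<close>: the extra \<open>1 / 2\<close> cancels the factor
  \<open>\<xi>\<close> and lifts \<open>s powr (- 3 / 2)\<close> to \<open>s powr (b - 1)\<close>.
  Away from height 0 any order of vanishing at \<open>s = 0\<close> is thus available:
  \<open>b = 2\<close> serves part 3, \<open>b = 1\<close> part 5, and \<open>b = a\<close> and
  \<open>b = 0\<close> part 2.\<close>

lemma hit_le_powr:
  assumes "b \<ge> 0" "\<xi> > 0" "s > 0"
  shows "hit \<xi> s \<le> (b + 1 / 2) powr (b + 1 / 2) * (\<xi>\<^sup>2 / 4) powr (- b) * s powr (b - 1)"
proof -
  define c where "c = b + 1 / 2"
  have "\<xi> / sqrt (4 * pi) * (s powr (- 3 / 2) * exp (- (\<xi>\<^sup>2 / 4) / s))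
      \<le> \<xi> / 2 * (s powr (- 3 / 2) * (c powr c * (\<xi>\<^sup>2 / 4 / s) powr (- c)))"
    using assms two_le_sqrt_4_pi powr_mult_exp_minus_le[of c "\<xi>\<^sup>2 / 4 / s"]
    by (intro mult_mono frac_le) (auto simp: c_def)
  also have "(\<xi>\<^sup>2 / 4 / s) powr (- c) = (\<xi>\<^sup>2 / 4) powr (- b) * (\<xi>\<^sup>2 / 4) powr (- (1 / 2)) * s powr c"
  proof -
    have "(\<xi>\<^sup>2 / 4 / s) powr (- c) = (\<xi>\<^sup>2 / 4) powr (- c) / s powr (- c)"
      by (rule powr_divide)
    moreover have "(\<xi>\<^sup>2 / 4) powr (- c) = (\<xi>\<^sup>2 / 4) powr (- b) * (\<xi>\<^sup>2 / 4) powr (- (1 / 2))"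
      using powr_add[of "\<xi>\<^sup>2 / 4" "- b" "- (1 / 2)"] by (simp add: c_def)
    ultimately show ?thesis
      by (simp add: powr_minus_divide)
  qed
  also have "(\<xi>\<^sup>2 / 4) powr (- (1 / 2)) = 2 / \<xi>"
    using assms powr_minus_divide[of "\<xi>\<^sup>2 / 4" "1 / 2"] by (simp add: powr_half_sqrt real_sqrt_divide)
  also have "\<xi> / 2 * (s powr (- 3 / 2) * (c powr c * ((\<xi>\<^sup>2 / 4) powr (- b) * (2 / \<xi>) * s powr c)))
     = c powr c * (\<xi>\<^sup>2 / 4) powr (- b) * (s powr (- 3 / 2) * s powr c)"
    using assms by simp
  also have "s powr (- 3 / 2) * s powr c = s powr (b - 1)"
    by (simp add: c_def flip: powr_add)
  finally show ?thesis
    using hit_eq[of s \<xi>] assms by (simp add: c_def)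
qed

lemma hit_le_inverse:
  assumes "0 \<le> \<xi>" "0 < s"
  shows "hit \<xi> s \<le> 1 / s"
proof (cases "\<xi> = 0")
  case False
  have "(1 / 2 :: real) powr (1 / 2) \<le> 1"
    by (intro powr_le1) auto
  then have "(1 / 2 :: real) powr (1 / 2) * (1 / s) \<le> 1 * (1 / s)"
    using assms by (intro mult_right_mono) auto
  then show ?thesis
    using hit_le_powr[of 0 \<xi> s] assms False by (simp add: powr_minus_divide)
qed (use assms in simp)

text \<open>With \<open>u = z\<^sup>2 / (4 * s)\<close> the derivative is a multiple of
  \<open>(1 - 2 * u) * exp (- u)\<close>, bounded uniformly in the height. A shift proportional to
  \<open>s\<close> therefore costs only the integrable weight
  \<open>s powr (- 1 / 2)\<close>.\<close>

lemma hit_lipschitz: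
  assumes "s > 0"
  shows "\<bar>hit \<xi> s - hit \<eta> s\<bar> \<le> s powr (- 3 / 2) * \<bar>\<xi> - \<eta>\<bar>"
proof -
  define C where "C = s powr (- 3 / 2) / sqrt (4 * pi)"
  define f' where "f' z = C * ((1 - 2 * (z\<^sup>2 / (4 * s))) * exp (- (z\<^sup>2 / (4 * s))))" for z
  have h: "(\<lambda>z. hit z s) = (\<lambda>z. C * (z * exp (- (z\<^sup>2 / (4 * s)))))"
    using assms by (auto simp: hit_eq C_def)
  have d: "((\<lambda>z. hit z s) has_field_derivative f' z) (at z within UNIV)" for z
    unfolding h f'_def using assms
    by (auto intro!: derivative_eq_intros simp: power2_eq_square divide_simps) (auto simp: algebra_simps)
  have b: "\<bar>f' z\<bar> \<le> s powr (- 3 / 2)" for z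
  proof -
    define u where "u = z\<^sup>2 / (4 * s)"
    have u: "u \<ge> 0" using assms by (simp add: u_def)
    \<comment> \<open>Both signs follow from \<open>1 + u \<le> exp u\<close> and
      \<open>u \<ge> 0\<close>.\<close>
    have "\<bar>1 - 2 * u\<bar> \<le> 2 * exp u"
      using exp_ge_add_one_self[of u] u by (subst abs_le_iff) linarith
    then have "\<bar>1 - 2 * u\<bar> * exp (- u) \<le> 2 * exp u * exp (- u)"
      by (intro mult_right_mono) auto
    then have "\<bar>1 - 2 * u\<bar> * exp (- u) \<le> 2"
      by (simp add: mult.assoc exp_minus_inverse)
    moreover have "C \<le> s powr (- 3 / 2) / 2"
      unfolding C_def using two_le_sqrt_4_pi by (intro divide_left_mono) auto
    moreover have "C \<ge> 0"
      by (simp add: C_def)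
    ultimately have "C * (\<bar>1 - 2 * u\<bar> * exp (- u)) \<le> s powr (- 3 / 2) / 2 * 2"
      by (intro mult_mono) auto
    then show ?thesis
      using \<open>C \<ge> 0\<close> by (simp add: f'_def abs_mult u_def)
  qed
  show ?thesis
    using field_differentiable_bound[OF convex_UNIV d, of "s powr (- 3 / 2)" \<xi> \<eta>] b by simp
qed

lemma
  assumes "\<xi> > 0"
  shows set_integrable_hit: "set_integrable lborel {0..} (hit \<xi>)"
    and set_integral_hit: "(LINT s:{0..}|lborel. hit \<xi> s) = 1"
proof -
  have 1: "hit \<xi> s = \<xi> / sqrt (4 * pi) * (s powr (- (1 / 2) - 1) * exp (- (\<xi>\<^sup>2 / 4) / s))" if "s \<in> {0..}" for s
    using hit_eq[of s \<xi>] that by simp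
  note G = set_integrable_inverse_gamma[of "1 / 2" "\<xi>\<^sup>2 / 4"] set_integral_inverse_gamma[of "1 / 2" "\<xi>\<^sup>2 / 4"]
  show "set_integrable lborel {0..} (hit \<xi>)"
    using G(1) assms by (intro iffD2[OF set_integrable_cong[OF refl refl 1]] set_integrable_mult_right) auto
  have "(LINT s:{0..}|lborel. hit \<xi> s)
      = (LINT s:{0..}|lborel. \<xi> / sqrt (4 * pi) * (s powr (- (1 / 2) - 1) * exp (- (\<xi>\<^sup>2 / 4) / s)))"
    by (rule set_lebesgue_integral_cong) (use 1 in auto)
  also have "\<dots> = \<xi> / sqrt (4 * pi) * (Gamma (1 / 2) * (\<xi>\<^sup>2 / 4) powr (- (1 / 2)))"
    by (subst set_integral_mult_right, subst G(2)) (use assms in auto)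
  also have "\<dots> = 1"
    using assms powr_minus_divide[of "\<xi>\<^sup>2 / 4" "1 / 2"]
    by (simp add: Gamma_one_half_real powr_half_sqrt real_sqrt_divide real_sqrt_mult)
  finally show "(LINT s:{0..}|lborel. hit \<xi> s) = 1" .
qed

lemma set_integrable_hit_subset:
  assumes "\<xi> \<ge> 0" "A \<subseteq> {0..}" "A \<in> sets borel"
  shows "set_integrable lborel A (hit \<xi>)"
proof (cases "\<xi> = 0")
  case False
  then show ?thesis
    using assms by (intro set_integrable_subset[OF set_integrable_hit]) auto
qed (simp add: set_integrable_def)

lemma set_integral_mono_set:
  fixes f :: "'a \<Rightarrow> real"
  assumes "set_integrable M B f" "A \<in> sets M" "A \<subseteq> B" "\<And>x. x \<in> B \<Longrightarrow> 0 \<le> f x"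
  shows "(LINT x:A|M. f x) \<le> (LINT x:B|M. f x)"
  using assms set_integrable_subset[OF assms(1-3)]
  unfolding set_lebesgue_integral_def set_integrable_def
  by (intro integral_mono) (auto simp: indicator_def)

lemma set_integral_hit_le_1:
  assumes "\<xi> \<ge> 0" "A \<subseteq> {0..}" "A \<in> sets borel"
  shows "(LINT s:A|lborel. hit \<xi> s) \<le> 1"
proof (cases "\<xi> = 0")
  case False
  then have "(LINT s:A|lborel. hit \<xi> s) \<le> (LINT s:{0..}|lborel. hit \<xi> s)"
    using assms hit_nonneg by (intro set_integral_mono_set set_integrable_hit) auto
  then show ?thesis
    using assms False by (simp add: set_integral_hit)
qed (simp add: set_lebesgue_integral_def)

text \<open>Subordination: the two exponents add up to \<open>norm (z, \<xi>)\<close> squared and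
  the powers of \<open>s\<close> to an inverse gamma integrand with \<open>\<alpha> = N / 2\<close>,
  so \<open>Gamma (N / 2)\<close> in \<open>cN\<close> is the value of that integral; the powers of
  4 cancel.\<close>

lemma set_integral_hit_Poisson:
  fixes z :: "real^'n::finite"
  assumes "\<xi> > 0"
  shows "(LINT s:{0..}|lborel. hit \<xi> s * hk z s) = Pker (z, \<xi>)"
proof -
  define d where "d = real CARD('n)"
  have n: "(norm (z, \<xi>))\<^sup>2 = (norm z)\<^sup>2 + \<xi>\<^sup>2"
    by (simp add: norm_prod_def)
  have "hit \<xi> s * hk z s = \<xi> * (4 * pi) powr (- (d + 1) / 2)
      * (s powr (- ((d + 1) / 2) - 1) * exp (- ((norm (z, \<xi>))\<^sup>2 / 4) / s))" if "s \<in> {0..}" for s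
  proof (cases "s = 0")
    case False
    then have s: "s > 0" using that by simp
    have "sqrt (4 * pi) = (4 * pi) powr (1 / 2)"
      by (simp add: powr_half_sqrt)
    then have "1 / sqrt (4 * pi) = (4 * pi) powr (- (1 / 2))"
      by (simp only: powr_minus_divide)
    then have 1: "hit \<xi> s = \<xi> * ((4 * pi) powr (- (1 / 2)) * (s powr (- 3 / 2) * exp (- (\<xi>\<^sup>2 / 4) / s)))"
      using s hit_eq[of s \<xi>] by (metis less_imp_le mult.assoc mult.right_neutral times_divide_eq_right)
    have 2: "hk z s = (4 * pi) powr (- (d / 2)) * s powr (- (d / 2)) * exp (- (norm z)\<^sup>2 / (4 * s))"
      using s by (simp add: hk_def d_def powr_mult)
    have "hit \<xi> s * hk z s = \<xi> * ((4 * pi) powr (- (1 / 2)) * (4 * pi) powr (- (d / 2)))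
      * ((s powr (- 3 / 2) * s powr (- (d / 2))) * (exp (- (\<xi>\<^sup>2 / 4) / s) * exp (- (norm z)\<^sup>2 / (4 * s))))"
      unfolding 1 2 by (simp only: mult_ac)
    also have "exp (- (\<xi>\<^sup>2 / 4) / s) * exp (- (norm z)\<^sup>2 / (4 * s)) = exp (- ((norm (z, \<xi>))\<^sup>2 / 4) / s)"
      unfolding n exp_add[symmetric] by (simp add: diff_divide_distrib add_divide_distrib)
    also have "(4 * pi) powr (- (1 / 2)) * (4 * pi) powr (- (d / 2)) = (4 * pi) powr (- (d + 1) / 2)"
      unfolding powr_add[symmetric] by (rule arg_cong[where f = "(powr) (4 * pi)"]) (simp add: field_simps)
    also have "s powr (- 3 / 2) * s powr (- (d / 2)) = s powr (- ((d + 1) / 2) - 1)"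
      unfolding powr_add[symmetric] by (rule arg_cong[where f = "(powr) s"]) (simp add: field_simps)
    finally show ?thesis .
  qed simp
  then have "(LINT s:{0..}|lborel. hit \<xi> s * hk z s) = (LINT s:{0..}|lborel. \<xi> * (4 * pi) powr (- (d + 1) / 2)
      * (s powr (- ((d + 1) / 2) - 1) * exp (- ((norm (z, \<xi>))\<^sup>2 / 4) / s)))"
    by (intro set_lebesgue_integral_cong) auto
  also have "\<dots> = \<xi> * (4 * pi) powr (- (d + 1) / 2) * (Gamma ((d + 1) / 2) * ((norm (z, \<xi>))\<^sup>2 / 4) powr (- ((d + 1) / 2)))"
    by (subst set_integral_mult_right, subst set_integral_inverse_gamma) (use assms in \<open>auto simp: d_def prod_eq_iff\<close>)
  also have "((norm (z, \<xi>))\<^sup>2 / 4) powr (- ((d + 1) / 2)) = norm (z, \<xi>) powr (- (d + 1)) * 4 powr ((d + 1) / 2)"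
  proof -
    have "norm (z, \<xi>) > 0"
      using assms by (auto simp: prod_eq_iff)
    then have "(norm (z, \<xi>))\<^sup>2 powr (- ((d + 1) / 2)) = norm (z, \<xi>) powr (- (d + 1))"
      using powr_powr[of "norm (z, \<xi>)" 2 "- ((d + 1) / 2)"] by (simp add: add_divide_distrib)
    then show ?thesis
      using powr_divide[of "(norm (z, \<xi>))\<^sup>2" 4 "- ((d + 1) / 2)"] powr_minus_divide[of 4 "(d + 1) / 2"]
      by simp
  qed
  also have "\<xi> * (4 * pi) powr (- (d + 1) / 2) * (Gamma ((d + 1) / 2) * (norm (z, \<xi>) powr (- (d + 1)) * 4 powr ((d + 1) / 2)))
    = (pi powr (- (d + 1) / 2) * Gamma ((d + 1) / 2)) * \<xi> * norm (z, \<xi>) powr (- (d + 1))"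
  proof -
    have "(4 * pi) powr (- (d + 1) / 2) * 4 powr ((d + 1) / 2) = pi powr (- (d + 1) / 2)"
    proof -
      have "4 powr (- (d + 1) / 2) * 4 powr ((d + 1) / 2) = (1 :: real)"
        by (subst powr_add[symmetric]) (simp flip: add_divide_distrib)
      then show ?thesis
        unfolding powr_mult by algebra
    qed
    from this[symmetric] show ?thesis
      by (simp only: mult_ac)
  qed
  finally show ?thesis
    by (simp add: Pker_def cN_def Nd_def d_def add.commute)
qed

text \<open>Parabolic scaling \<open>s = \<xi>\<^sup>2 * r\<close> reduces every height to height
  1.\<close>

lemma set_integral_hit_scale:
  assumes "\<xi> > 0"
  shows "(LINT s:{0..S}|lborel. hit \<xi> s) = (LINT s:{0..S / \<xi>\<^sup>2}|lborel. hit 1 s)"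
proof -
  have e: "\<xi>\<^sup>2 * hit \<xi> (\<xi>\<^sup>2 * r) = hit 1 r" if "r \<ge> 0" for r
  proof -
    have "(\<xi>\<^sup>2) powr (- 3 / 2) = 1 / \<xi> powr 3"
      using assms powr_minus_divide[of \<xi> 3] powr_powr[of \<xi> 2 "- 3 / 2"] by simp
    then have "(\<xi>\<^sup>2 * r) powr (- 3 / 2) = r powr (- 3 / 2) / \<xi> ^ 3"
      using assms that by (simp add: powr_mult)
    then have "\<xi>\<^sup>2 * hit \<xi> (\<xi>\<^sup>2 * r) = \<xi>\<^sup>2 * (\<xi> / sqrt (4 * pi) * (r powr (- 3 / 2) / \<xi> ^ 3 * exp (- (1 / 4) / r)))"
      using that assms by (simp add: hit_eq)
    also have "\<dots> = hit 1 r"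
      using that assms by (simp add: hit_eq power2_eq_square power3_eq_cube)
    finally show ?thesis .
  qed
  have "(LINT s:{0..S}|lborel. hit \<xi> s) = \<bar>\<xi>\<^sup>2\<bar> *\<^sub>R (LINT r|lborel. indicator {0..S} (0 + \<xi>\<^sup>2 * r) *\<^sub>R hit \<xi> (0 + \<xi>\<^sup>2 * r))"
    unfolding set_lebesgue_integral_def using assms by (intro lborel_integral_real_affine) simp
  also have "\<dots> = (LINT r|lborel. \<xi>\<^sup>2 * (indicator {0..S} (\<xi>\<^sup>2 * r) * hit \<xi> (\<xi>\<^sup>2 * r)))"
    by simp
  also have "\<dots> = (LINT s:{0..S / \<xi>\<^sup>2}|lborel. hit 1 s)"
    unfolding set_lebesgue_integral_def
  proof (intro Bochner_Integration.integral_cong refl)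
    fix r :: real
    show "\<xi>\<^sup>2 * (indicator {0..S} (\<xi>\<^sup>2 * r) * hit \<xi> (\<xi>\<^sup>2 * r)) = indicator {0..S / \<xi>\<^sup>2} r *\<^sub>R hit 1 r"
    proof (cases "r \<ge> 0")
      case True
      then show ?thesis
        using assms e[OF True] by (auto simp: indicator_def field_simps)
    next
      case False
      then show ?thesis
        using assms by (simp add: indicator_def zero_le_mult_iff)
    qed
  qed
  finally show ?thesis .
qed

text \<open>After scaling, both masses belong to \<open>hit 1\<close> and differ by its mass between
  \<open>R1\<close> and \<open>R2\<close>. The bound \<open>s powr (- 3 / 2) / 2\<close> integrates
  to \<open>(\<xi> + a) / sqrt S - \<xi> / sqrt S\<close>, so the estimate does not degenerate as
  \<open>\<xi>\<close> tends to 0.\<close>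

lemma set_integral_hit_lipschitz:
  assumes "\<xi> > 0" "a \<ge> 0" "S > 0"
  shows "\<bar>(LINT s:{0..S}|lborel. hit (\<xi> + a) s) - (LINT s:{0..S}|lborel. hit \<xi> s)\<bar> \<le> a / sqrt S"
proof -
  define R1 where "R1 = S / (\<xi> + a)\<^sup>2"
  define R2 where "R2 = S / \<xi>\<^sup>2"
  have R: "0 < R1" "R1 \<le> R2"
    using assms by (auto simp: R1_def R2_def intro!: divide_left_mono power_mono mult_pos_pos)
  have "(LINT s:{0..R2}|lborel. hit 1 s) = (LINT s:{0..R1}|lborel. hit 1 s) + (LINT s:{R1<..R2}|lborel. hit 1 s)"
  proof -
    have "{0..R2} = {0..R1} \<union> {R1<..R2}"
      using R by auto
    moreover have "{0..R1} \<inter> {R1<..R2} = {}"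
      by auto
    ultimately show ?thesis
      using R by (auto intro!: set_integral_Un set_integrable_hit_subset)
  qed
  moreover have "\<bar>LINT s:{R1<..R2}|lborel. hit 1 s\<bar> \<le> (LINT s:{R1<..R2}|lborel. 1 / 2 * s powr (- 3 / 2))"
  proof (rule abs_set_integral_le)
    have "set_integrable lborel {R1..} (\<lambda>s. s powr (- 3 / 2))"
      using R by (intro set_integrable_powr_to_inf) auto
    then show "set_integrable lborel {R1<..R2} (\<lambda>s. 1 / 2 * s powr (- 3 / 2))"
      by (intro set_integrable_mult_right set_integrable_subset[of lborel "{R1..}" _ "{R1<..R2}"]) auto
    show "\<bar>hit 1 s\<bar> \<le> 1 / 2 * s powr (- 3 / 2)" if "s \<in> {R1<..R2}" for s
      using R that hit_le[of 1 s] hit_nonneg[of 1 s] by simp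
  qed auto
  moreover have "(LINT s:{R1<..R2}|lborel. 1 / 2 * s powr (- 3 / 2)) = R1 powr (- 1 / 2) - R2 powr (- 1 / 2)"
  proof -
    have "((\<lambda>s. 1 / 2 * s powr (- 3 / 2)) has_integral (- (R2 powr (- 1 / 2)) - - (R1 powr (- 1 / 2)))) {R1..R2}"
      using R by (intro fundamental_theorem_of_calculus)
        (auto intro!: derivative_eq_intros simp flip: has_real_derivative_iff_has_vector_derivative)
    then have "((\<lambda>s. 1 / 2 * s powr (- 3 / 2)) has_integral (R1 powr (- 1 / 2) - R2 powr (- 1 / 2))) {R1<..R2}"
      by (subst has_integral_spike_set_eq[of _ "{R1..R2}"]) (auto intro: negligible_subset[of "{R1}"])
    then show ?thesis
      by (intro set_integral_of_has_integral) auto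
  qed
  moreover have "R1 powr (- 1 / 2) - R2 powr (- 1 / 2) = a / sqrt S"
  proof -
    have "R1 powr (- 1 / 2) = 1 / sqrt R1" "R2 powr (- 1 / 2) = 1 / sqrt R2"
      using R powr_minus_divide[of R1 "1 / 2"] powr_minus_divide[of R2 "1 / 2"] by (simp_all add: powr_half_sqrt)
    then show ?thesis
      using assms by (simp add: R1_def R2_def real_sqrt_divide diff_divide_distrib[symmetric])
  qed
  ultimately show ?thesis
    using assms set_integral_hit_scale[of "\<xi> + a" S] set_integral_hit_scale[of \<xi> S]
    by (simp add: R1_def R2_def)
qed

text \<open>Fubini's theorem with its integrability hypothesis in the form the kernels deliver: an
  integrable bound on the inner absolute integrals.\<close>

lemma
  fixes f :: "'a::euclidean_space \<Rightarrow> 'b::euclidean_space \<Rightarrow> real"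
  assumes [measurable]: "(\<lambda>(x, y). f x y) \<in> borel_measurable (lborel \<Otimes>\<^sub>M lborel)"
    and i: "\<And>x. integrable lborel (f x)"
    and g: "integrable lborel g" "\<And>x. (\<integral>y. \<bar>f x y\<bar> \<partial>lborel) \<le> g x"
  shows lborel_integrable_fst: "integrable lborel (\<lambda>x. \<integral>y. f x y \<partial>lborel)"
    and lborel_integral_swap: "(\<integral>y. (\<integral>x. f x y \<partial>lborel) \<partial>lborel) = (\<integral>x. (\<integral>y. f x y \<partial>lborel) \<partial>lborel)"
proof -
  have P: "integrable (lborel \<Otimes>\<^sub>M lborel) (\<lambda>(x, y). f x y)"
  proof (rule lborel_pair.Fubini_integrable)
    show "integrable lborel (\<lambda>x. \<integral>y. norm (case (x, y) of (x, y) \<Rightarrow> f x y) \<partial>lborel)"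
    proof (rule Bochner_Integration.integrable_bound[OF g(1)])
      show "AE x in lborel. norm (\<integral>y. norm (case (x, y) of (x, y) \<Rightarrow> f x y) \<partial>lborel) \<le> norm (g x)"
      proof (rule AE_I2)
        fix x
        have "0 \<le> (\<integral>y. \<bar>f x y\<bar> \<partial>lborel)"
          by simp
        then show "norm (\<integral>y. norm (case (x, y) of (x, y) \<Rightarrow> f x y) \<partial>lborel) \<le> norm (g x)"
          using g(2)[of x] by simp
      qed
    qed simp
  qed (use i in auto)
  show "integrable lborel (\<lambda>x. \<integral>y. f x y \<partial>lborel)"
    using lborel_pair.integrable_fst[OF P] .
  show "(\<integral>y. (\<integral>x. f x y \<partial>lborel) \<partial>lborel) = (\<integral>x. (\<integral>y. f x y \<partial>lborel) \<partial>lborel)"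
    using lborel_pair.Fubini_integral[OF P] .
qed

subsection \<open>The heat semigroup and the boundary potentials\<close>

text \<open>The solution of the heat equation with datum \<open>\<psi>\<close>, except that at
  \<open>r = 0\<close> the value is 0 and not \<open>\<psi>\<close>.\<close>

definition heat :: "('a::euclidean_space \<Rightarrow> real) \<Rightarrow> 'a \<Rightarrow> real \<Rightarrow> real" where
  "heat \<psi> x r = (\<integral>y. hk (x - y) r * \<psi> y \<partial>lborel)"

lemma borel_measurable_heat [measurable]:
  assumes [measurable]: "\<psi> \<in> borel_measurable borel" "f \<in> borel_measurable M" "g \<in> borel_measurable M"
  shows "(\<lambda>x. heat \<psi> (f x) (g x)) \<in> borel_measurable M"
  unfolding heat_def by measurable

lemma hk_at_0 [simp]: "hk x 0 = 0"
  by (simp add: hk_def)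

lemma
  fixes \<psi> :: "'a::euclidean_space \<Rightarrow> real"
  assumes [measurable]: "\<psi> \<in> borel_measurable borel" and M: "AE y in lborel. \<bar>\<psi> y\<bar> \<le> M" "0 \<le> M"
    and r: "0 \<le> r"
  shows integrable_hk_mult: "integrable lborel (\<lambda>y. hk (x - y) r * \<psi> y)"
    and integral_hk_mult_abs_le: "(\<integral>y. hk (x - y) r * \<bar>\<psi> y\<bar> \<partial>lborel) \<le> M"
proof -
  show i: "integrable lborel (\<lambda>y. hk (x - y) r * \<psi> y)"
  proof (cases "r = 0")
    case False
    then have "integrable lborel (\<lambda>y. M * hk (x - y) r)"
      using r by (intro integrable_mult_right integrable_hk_diff) auto
    then show ?thesis
    proof (rule Bochner_Integration.integrable_bound)
      show "AE y in lborel. norm (hk (x - y) r * \<psi> y) \<le> norm (M * hk (x - y) r)"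
        using M(1) by eventually_elim (use M(2) in \<open>simp add: abs_mult mult.commute[of M] mult_left_mono\<close>)
    qed simp
  qed simp
  show "(\<integral>y. hk (x - y) r * \<bar>\<psi> y\<bar> \<partial>lborel) \<le> M"
  proof (cases "r = 0")
    case False
    then have "(\<integral>y. hk (x - y) r * \<bar>\<psi> y\<bar> \<partial>lborel) \<le> (\<integral>y. hk (x - y) r * M \<partial>lborel)"
    proof (intro integral_mono_AE)
      show "AE y in lborel. hk (x - y) r * \<bar>\<psi> y\<bar> \<le> hk (x - y) r * M"
        using M(1) by eventually_elim (simp add: mult_left_mono)
    qed (use r integrable_abs[OF i] in \<open>auto simp: abs_mult integrable_hk_diff\<close>)
    then show ?thesis
      using r False by (simp add: integral_hk_diff)
  qed (use M in simp)
qed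

lemma abs_heat_le:
  fixes \<psi> :: "'a::euclidean_space \<Rightarrow> real"
  assumes "\<psi> \<in> borel_measurable borel" "AE y in lborel. \<bar>\<psi> y\<bar> \<le> M" "0 \<le> M" "0 \<le> r"
  shows "\<bar>heat \<psi> x r\<bar> \<le> M"
proof -
  have "\<bar>heat \<psi> x r\<bar> \<le> (\<integral>y. \<bar>hk (x - y) r * \<psi> y\<bar> \<partial>lborel)"
    unfolding heat_def by (rule integral_abs_bound)
  then show ?thesis
    using integral_hk_mult_abs_le[OF assms, of x] by (simp add: abs_mult)
qed

text \<open>Comes from the \<open>L^1\<close> estimate of the kernel, so only the bound on
  \<open>\<psi>\<close> enters. \<open>R\<close> may be any positive lower bound of the later time,
  which lets each application choose a denominator that cancels, such as \<open>s\<close> or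
  \<open>t / \<theta>\<close>.\<close>

lemma abs_heat_diff_le:
  fixes \<psi> :: "'a::euclidean_space \<Rightarrow> real" and M r1 r2 R :: real
  assumes \<psi>: "\<psi> \<in> borel_measurable borel" "AE y in lborel. \<bar>\<psi> y\<bar> \<le> M" "0 \<le> M"
    and r: "0 < r1" "0 < r2" "R \<le> max r1 r2" "0 < R"
  shows "\<bar>heat \<psi> x r1 - heat \<psi> x r2\<bar> \<le> 2 * DIM('a) * M * (\<bar>r1 - r2\<bar> / R)"
proof -
  have *: "\<bar>heat \<psi> x r2 - heat \<psi> x r1\<bar> \<le> 2 * DIM('a) * M * ((r2 - r1) / r2)"
    if r: "0 < r1" "r1 \<le> r2" for r1 r2
  proof -
    have i: "integrable lborel (\<lambda>y. hk (x - y) r * \<psi> y)" if "r > 0" for r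
      using integrable_hk_mult[OF \<psi>] that by auto
    have "\<bar>heat \<psi> x r2 - heat \<psi> x r1\<bar> = \<bar>\<integral>y. (hk (x - y) r2 - hk (x - y) r1) * \<psi> y \<partial>lborel\<bar>"
      unfolding heat_def using r
      by (subst Bochner_Integration.integral_diff[symmetric]) (auto intro!: i simp: left_diff_distrib)
    also have "\<dots> \<le> (\<integral>y. \<bar>(hk (x - y) r2 - hk (x - y) r1) * \<psi> y\<bar> \<partial>lborel)"
      by (rule integral_abs_bound)
    also have "\<dots> \<le> (\<integral>y. \<bar>hk (x - y) r2 - hk (x - y) r1\<bar> * M \<partial>lborel)"
    proof (intro integral_mono_AE)
      show "AE y in lborel. \<bar>(hk (x - y) r2 - hk (x - y) r1) * \<psi> y\<bar> \<le> \<bar>hk (x - y) r2 - hk (x - y) r1\<bar> * M"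
        using \<psi>(2) by eventually_elim (simp add: abs_mult mult_left_mono)
    qed (use r i integrable_hk_time_diff[of r1 r2 x] in \<open>auto simp: left_diff_distrib\<close>)
    also have "\<dots> = (\<integral>y. \<bar>hk (x - y) r2 - hk (x - y) r1\<bar> \<partial>lborel) * M"
      by simp
    also have "\<dots> \<le> 2 * DIM('a) * ((r2 - r1) / r2) * M"
      using r \<psi>(3) integral_hk_time_diff[of r1 r2 x] by (intro mult_right_mono) auto
    finally show ?thesis
      by (simp add: mult_ac)
  qed
  have **: "2 * DIM('a) * M * ((b - a) / b) \<le> 2 * DIM('a) * M * (\<bar>r1 - r2\<bar> / R)"
    if "0 < a" "a \<le> b" "b - a = \<bar>r1 - r2\<bar>" "R \<le> b" for a b
    using that r \<psi>(3) by (intro mult_left_mono frac_le) auto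
  show ?thesis
  proof (cases "r1 \<le> r2")
    case True
    then show ?thesis
      using *[of r1 r2] **[of r1 r2] r by (simp add: abs_minus_commute)
  next
    case False
    then show ?thesis
      using *[of r2 r1] **[of r2 r1] r by simp
  qed
qed

lemma heat_semigroup:
  fixes \<psi> :: "'a::euclidean_space \<Rightarrow> real"
  assumes \<psi> [measurable]: "\<psi> \<in> borel_measurable borel" and M: "AE y in lborel. \<bar>\<psi> y\<bar> \<le> M" "0 \<le> M"
    and r: "0 < s" "0 < r"
  shows "heat (\<lambda>y. heat \<psi> y r) x s = heat \<psi> x (s + r)"
proof -
  define f where "f z y = hk (x - z) s * (hk (z - y) r * \<psi> y)" for z y
  have "(\<integral>y. (\<integral>z. f z y \<partial>lborel) \<partial>lborel) = (\<integral>z. (\<integral>y. f z y \<partial>lborel) \<partial>lborel)"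
  proof (rule lborel_integral_swap)
    show "(\<lambda>(z, y). f z y) \<in> borel_measurable (lborel \<Otimes>\<^sub>M lborel)"
      unfolding f_def by measurable
    show "integrable lborel (f z)" for z
      unfolding f_def using r by (intro integrable_mult_right integrable_hk_mult[OF \<psi> M]) auto
    show "integrable lborel (\<lambda>z. hk (x - z) s * M)"
      using r by (intro integrable_mult_left integrable_hk_diff) auto
    show "(\<integral>y. \<bar>f z y\<bar> \<partial>lborel) \<le> hk (x - z) s * M" for z
      using integral_hk_mult_abs_le[OF \<psi> M, of r z] r
      by (simp add: f_def abs_mult mult_left_mono)
  qed
  moreover have "(\<integral>y. f z y \<partial>lborel) = hk (x - z) s * heat \<psi> z r" for z
    by (simp add: f_def heat_def)
  moreover have "(\<integral>z. f z y \<partial>lborel) = hk (x - y) (s + r) * \<psi> y" for y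
    using hk_semigroup[OF r, of x y] by (simp add: f_def flip: mult.assoc)
  ultimately show ?thesis
    by (simp add: heat_def)
qed

text \<open>Integrability and the bound \<open>B\<close> are assumed for the potentials instead of
  for \<open>\<psi>\<close>, so that bounded and \<open>L^p\<close> data are both covered.\<close>

lemma
  fixes \<psi> :: "'a::euclidean_space \<Rightarrow> real"
  assumes [measurable]: "\<psi> \<in> borel_measurable borel" "A \<in> sets borel" "\<rho> \<in> borel_measurable borel"
    and \<kappa>: "\<kappa> \<in> borel_measurable borel" "set_integrable lborel A \<kappa>"
    and i: "\<And>s. s \<in> A \<Longrightarrow> integrable lborel (\<lambda>y. hk (x - y) (\<rho> s) * \<psi> y)"
    and B: "\<And>s. s \<in> A \<Longrightarrow> (\<integral>y. hk (x - y) (\<rho> s) * \<bar>\<psi> y\<bar> \<partial>lborel) \<le> B"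
  shows set_integrable_mult_heat: "set_integrable lborel A (\<lambda>s. \<kappa> s * heat \<psi> x (\<rho> s))"
    and integral_set_integral_hk_mult:
      "(\<integral>y. (LINT s:A|lborel. hk (x - y) (\<rho> s) * \<kappa> s) * \<psi> y \<partial>lborel)
        = (LINT s:A|lborel. \<kappa> s * heat \<psi> x (\<rho> s))"
proof -
  note \<kappa>(1) [measurable]
  define f where "f s y = (indicator A s * \<kappa> s) * (hk (x - y) (\<rho> s) * \<psi> y)" for s y
  have m: "(\<lambda>(s, y). f s y) \<in> borel_measurable (lborel \<Otimes>\<^sub>M lborel)"
    unfolding f_def by measurable
  have fi: "integrable lborel (f s)" for s
    unfolding f_def using i[of s] by (cases "s \<in> A") auto
  have gi: "integrable lborel (\<lambda>s. \<bar>indicator A s * \<kappa> s\<bar> * B)"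
    using \<kappa>(2) by (auto simp: set_integrable_def)
  have b: "(\<integral>y. \<bar>f s y\<bar> \<partial>lborel) \<le> \<bar>indicator A s * \<kappa> s\<bar> * B" for s
  proof (cases "s \<in> A")
    case True
    then show ?thesis
      using B[OF True] by (simp add: f_def abs_mult mult_left_mono)
  qed (simp add: f_def)
  have *: "(\<integral>y. f s y \<partial>lborel) = indicator A s *\<^sub>R (\<kappa> s * heat \<psi> x (\<rho> s))" for s
    by (simp add: f_def heat_def)
  show "set_integrable lborel A (\<lambda>s. \<kappa> s * heat \<psi> x (\<rho> s))"
    using lborel_integrable_fst[OF m fi gi b] by (simp add: set_integrable_def *)
  have "(\<integral>y. (LINT s:A|lborel. hk (x - y) (\<rho> s) * \<kappa> s) * \<psi> y \<partial>lborel) = (\<integral>y. (\<integral>s. f s y \<partial>lborel) \<partial>lborel)"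
    unfolding set_lebesgue_integral_def integral_mult_left_zero[symmetric] f_def
    by (intro Bochner_Integration.integral_cong refl) (simp add: mult_ac)
  also have "\<dots> = (\<integral>s. (\<integral>y. f s y \<partial>lborel) \<partial>lborel)"
    by (rule lborel_integral_swap[OF m fi gi b])
  finally show "(\<integral>y. (LINT s:A|lborel. hk (x - y) (\<rho> s) * \<kappa> s) * \<psi> y \<partial>lborel)
        = (LINT s:A|lborel. \<kappa> s * heat \<psi> x (\<rho> s))"
    by (simp add: set_lebesgue_integral_def *)
qed

text \<open>The substitution \<open>\<tau> = t - \<epsilon> * s\<close>. The integrand has two
  arguments so that every \<open>(t - \<tau>) / \<epsilon>\<close> becomes literally
  \<open>s\<close> while the remaining \<open>\<tau>\<close> become
  \<open>t - \<epsilon> * s\<close>.\<close>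

lemma set_integral_reverse_time:
  fixes f :: "real \<Rightarrow> real \<Rightarrow> real"
  assumes "\<epsilon> > 0"
  shows "(LINT \<tau>:{0..t}|lborel. f \<tau> ((t - \<tau>) / \<epsilon>)) = \<epsilon> * (LINT s:{0..t / \<epsilon>}|lborel. f (t - \<epsilon> * s) s)"
proof -
  have *: "indicator {0..t} (t + - \<epsilon> * s) *\<^sub>R f (t + - \<epsilon> * s) ((t - (t + - \<epsilon> * s)) / \<epsilon>)
      = indicator {0..t / \<epsilon>} s *\<^sub>R f (t - \<epsilon> * s) s" for s
    using assms by (auto simp: indicator_def field_simps zero_le_mult_iff)
  have "(LINT \<tau>:{0..t}|lborel. f \<tau> ((t - \<tau>) / \<epsilon>)) = \<bar>- \<epsilon>\<bar> *\<^sub>R (LINT s|lborel.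
      indicator {0..t} (t + - \<epsilon> * s) *\<^sub>R f (t + - \<epsilon> * s) ((t - (t + - \<epsilon> * s)) / \<epsilon>))"
    unfolding set_lebesgue_integral_def using assms by (intro lborel_integral_real_affine) simp
  then show ?thesis
    using assms by (simp only: * set_lebesgue_integral_def) simp
qed

section \<open>The boundary kernels and potentials in the variable \<open>s\<close>\<close>

lemma Hker_eq:
  assumes "\<epsilon> > 0"
  shows "Hker \<epsilon> \<delta> k x y t = \<epsilon> * (LINT s:{0..t / \<epsilon>}|lborel.
    hk (fst x - fst y) (s + k / \<delta> * (t - \<epsilon> * s)) * hit (snd x + snd y + (t - \<epsilon> * s) / \<delta>) s)"
proof -
  have "Hker \<epsilon> \<delta> k x y t = - 2 * (\<epsilon> * (LINT s:{0..t / \<epsilon>}|lborel.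
    (- 1 / 2) * (hk (fst x - fst y) (s + k / \<delta> * (t - \<epsilon> * s)) * hit (snd x + snd y + (t - \<epsilon> * s) / \<delta>) s)))"
    unfolding Hker_def dhk1_eq_hit
    by (subst set_integral_reverse_time[OF assms, where f =
        "\<lambda>\<tau> s. hk (fst x - fst y) (s + k / \<delta> * \<tau>) * (- hit (snd x + snd y + \<tau> / \<delta>) s / 2)"]) simp
  then show ?thesis
    unfolding set_integral_mult_right by simp
qed

lemma Htil_eq:
  assumes "\<epsilon> > 0"
  shows "Htil \<epsilon> \<theta> x y t = \<epsilon> * (LINT s:{0..t / \<epsilon>}|lborel.
    hk (fst x - fst y) (s + (t - \<epsilon> * s) / \<theta>) * hit (snd x) s)"
proof -
  have "Htil \<epsilon> \<theta> x y t = - 2 * (\<epsilon> * (LINT s:{0..t / \<epsilon>}|lborel.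
    (- 1 / 2) * (hk (fst x - fst y) (s + (t - \<epsilon> * s) / \<theta>) * hit (snd x) s)))"
    unfolding Htil_def dhk1_eq_hit
    by (subst set_integral_reverse_time[OF assms, where f =
        "\<lambda>\<tau> s. hk (fst x - fst y) (s + \<tau> / \<theta>) * (- hit (snd x) s / 2)"]) simp
  then show ?thesis
    unfolding set_integral_mult_right by simp
qed

text \<open>The time \<open>\<rho>(s)\<close> interpolates between \<open>t / \<theta>\<close> at
  \<open>s = 0\<close> and \<open>t / \<epsilon>\<close> at the other end. It never reaches 0, where
  \<open>heat\<close> has its default value.\<close>

lemma pos_time_change:
  fixes \<epsilon> \<theta> s t :: real
  assumes "\<epsilon> > 0" "\<theta> > 0" "t > 0" "s \<in> {0..t / \<epsilon>}"
  shows "0 \<le> t - \<epsilon> * s" "0 < s + (t - \<epsilon> * s) / \<theta>"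
proof -
  show 1: "0 \<le> t - \<epsilon> * s"
    using assms by (simp add: field_simps)
  then have "0 \<le> (t - \<epsilon> * s) / \<theta>" "t - \<epsilon> * s = 0 \<Longrightarrow> s > 0"
    using assms by (auto simp: less_le)
  then show "0 < s + (t - \<epsilon> * s) / \<theta>"
    using 1 assms by (cases "t - \<epsilon> * s = 0") (auto intro: add_nonneg_pos)
qed

lemma w_sol_minus_zD:
  fixes \<psi> :: "real^'n::finite \<Rightarrow> real"
  assumes "\<epsilon> > 0" "snd x \<ge> 0" and \<psi>: "\<psi> \<in> borel_measurable borel"
    and i: "\<And>s. s \<in> {0..t / \<epsilon>} \<Longrightarrow> integrable lborel (\<lambda>y. hk (fst x - y) (s + (t - \<epsilon> * s) / \<theta>) * \<psi> y)"
    and B: "\<And>s. s \<in> {0..t / \<epsilon>} \<Longrightarrow> (\<integral>y. hk (fst x - y) (s + (t - \<epsilon> * s) / \<theta>) * \<bar>\<psi> y\<bar> \<partial>lborel) \<le> B"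
  shows "w_sol \<epsilon> \<theta> \<phi> \<psi> x t - zD \<epsilon> \<phi> x t
    = (LINT s:{0..t / \<epsilon>}|lborel. hit (snd x) s * heat \<psi> (fst x) (s + (t - \<epsilon> * s) / \<theta>))"
proof -
  have "1 / \<epsilon> * (\<integral>y'. Htil \<epsilon> \<theta> x (y', 0) t * \<psi> y' \<partial>lborel)
      = (\<integral>y'. (LINT s:{0..t / \<epsilon>}|lborel. hk (fst x - y') (s + (t - \<epsilon> * s) / \<theta>) * hit (snd x) s) * \<psi> y' \<partial>lborel)"
    unfolding integral_mult_right_zero[symmetric] using assms(1)
    by (intro Bochner_Integration.integral_cong refl) (simp add: Htil_eq)
  also have "\<dots> = (LINT s:{0..t / \<epsilon>}|lborel. hit (snd x) s * heat \<psi> (fst x) (s + (t - \<epsilon> * s) / \<theta>))"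
    using assms by (intro integral_set_integral_hk_mult[OF \<psi> _ _ _ _ i B]) (auto intro!: set_integrable_hit_subset)
  finally show ?thesis
    by (simp add: w_sol_def zD_def)
qed

text \<open>In \<open>wD\<close> the space integral is already the inner one, so this is a rewriting
  under the integral without Fubini and holds for any \<open>\<psi>\<close>.\<close>

lemma wD_minus_zD:
  assumes "\<epsilon> > 0"
  shows "wD \<epsilon> \<phi> \<psi> x t - zD \<epsilon> \<phi> x t = (LINT s:{0..t / \<epsilon>}|lborel. hit (snd x) s * heat \<psi> (fst x) s)"
proof -
  have "(LINT \<tau>:{0..t}|lborel. (\<integral>y'. hk (fst x - y') ((t - \<tau>) / \<epsilon>) * dhk1 (snd x) ((t - \<tau>) / \<epsilon>) * \<psi> y' \<partial>lborel))
    = (LINT \<tau>:{0..t}|lborel. (- 1 / 2) * (hit (snd x) ((t - \<tau>) / \<epsilon>) * heat \<psi> (fst x) ((t - \<tau>) / \<epsilon>)))"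
    unfolding heat_def dhk1_eq_hit integral_mult_right_zero[symmetric]
    by (intro set_lebesgue_integral_cong allI impI Bochner_Integration.integral_cong refl) auto
  also have "\<dots> = (- 1 / 2) * (\<epsilon> * (LINT s:{0..t / \<epsilon>}|lborel. hit (snd x) s * heat \<psi> (fst x) s))"
    unfolding set_integral_mult_right
    by (subst set_integral_reverse_time[OF assms, where f = "\<lambda>_ s. hit (snd x) s * heat \<psi> (fst x) s"]) simp
  finally show ?thesis
    using assms by (simp add: wD_def)
qed

text \<open>Subordination writes the Poisson extension of \<open>Psi\<close> as a superposition of
  its heat flows, and the semigroup law merges the time \<open>s\<close> with the time
  \<open>t / \<theta>\<close> inside \<open>Psi\<close>.\<close>

lemma V_sol_eq:
  fixes \<psi> :: "real^'n::finite \<Rightarrow> real"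
  assumes \<psi>: "\<psi> \<in> borel_measurable borel" "AE y in lborel. \<bar>\<psi> y\<bar> \<le> M" "0 \<le> M"
    and "snd x > 0" "t > 0" "\<theta> > 0"
  shows "V_sol \<theta> \<psi> x t = (LINT s:{0..}|lborel. hit (snd x) s * heat \<psi> (fst x) (s + t / \<theta>))"
proof -
  define \<Psi> where "\<Psi> y = heat \<psi> y (t / \<theta>)" for y
  have Psi: "Psi \<theta> \<psi> y t = \<Psi> y" for y
    by (simp add: Psi_def \<Psi>_def heat_def)
  have \<Psi>: "\<Psi> \<in> borel_measurable borel" "AE y in lborel. \<bar>\<Psi> y\<bar> \<le> M"
    using assms abs_heat_le[OF \<psi>, of "t / \<theta>"] unfolding \<Psi>_def by auto
  have "Pker (fst x - y', snd x) = (LINT s:{0..}|lborel. hk (fst x - y') s * hit (snd x) s)" for y'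
    using set_integral_hit_Poisson[of "snd x" "fst x - y'"] assms by (simp add: mult.commute)
  then have "V_sol \<theta> \<psi> x t = (\<integral>y'. (LINT s:{0..}|lborel. hk (fst x - y') s * hit (snd x) s) * \<Psi> y' \<partial>lborel)"
    by (simp add: V_sol_def Psi)
  also have "\<dots> = (LINT s:{0..}|lborel. hit (snd x) s * heat \<Psi> (fst x) s)"
    using assms integrable_hk_mult[OF \<Psi> \<psi>(3)] integral_hk_mult_abs_le[OF \<Psi> \<psi>(3)]
    by (intro integral_set_integral_hk_mult[OF \<Psi>(1)]) (auto intro!: set_integrable_hit)
  also have "\<dots> = (LINT s:{0..}|lborel. hit (snd x) s * heat \<psi> (fst x) (s + t / \<theta>))"
  proof (intro set_lebesgue_integral_cong allI impI)
    fix s :: real assume "s \<in> {0..}"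
    \<comment> \<open>At \<open>s = 0\<close> the semigroup law fails for the default value of
      \<open>heat\<close>, but the factor \<open>hit\<close> is 0 there.\<close>
    then show "hit (snd x) s * heat \<Psi> (fst x) s = hit (snd x) s * heat \<psi> (fst x) (s + t / \<theta>)"
      using heat_semigroup[OF \<psi>, of s "t / \<theta>" "fst x"] assms
      by (cases "s = 0") (auto simp: \<Psi>_def[abs_def])
  qed simp
  finally show ?thesis .
qed

lemma
  fixes f :: "'a \<Rightarrow> real"
  assumes [measurable]: "f \<in> borel_measurable M" and b: "(\<integral>\<^sup>+x. ennreal \<bar>f x\<bar> \<partial>M) \<le> ennreal c" and "0 \<le> c"
  shows integrable_of_nn_integral_abs_le: "integrable M f"
    and abs_integral_le_of_nn_integral: "\<bar>\<integral>x. f x \<partial>M\<bar> \<le> c"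
proof -
  show "integrable M f"
    using b by (auto simp: integrable_iff_bounded top_unique less_top intro: le_less_trans)
  then have "ennreal (norm (\<integral>x. f x \<partial>M)) \<le> (\<integral>\<^sup>+x. ennreal (norm (f x)) \<partial>M)"
    by (rule integral_norm_bound_ennreal)
  also have "\<dots> \<le> ennreal c"
    using b by simp
  finally show "\<bar>\<integral>x. f x \<partial>M\<bar> \<le> c"
    using \<open>0 \<le> c\<close> by simp
qed

lemma abs_set_integral_diff_le:
  fixes f g h :: "'a \<Rightarrow> real"
  assumes "set_integrable M A f" "set_integrable M A g" "set_integrable M A h"
    and "\<And>x. x \<in> A \<Longrightarrow> \<bar>f x - g x\<bar> \<le> h x"
  shows "\<bar>(LINT x:A|M. f x) - (LINT x:A|M. g x)\<bar> \<le> (LINT x:A|M. h x)"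
proof -
  note d = set_integral_diff[OF assms(1,2)]
  have "\<bar>LINT x:A|M. f x - g x\<bar> \<le> (LINT x:A|M. \<bar>f x - g x\<bar>)"
    using set_integral_norm_bound[OF d(1)] by simp
  also have "\<dots> \<le> (LINT x:A|M. h x)"
    using assms d(1) by (intro set_integral_mono set_integrable_abs) auto
  finally show ?thesis
    using d(2) by simp
qed

lemma
  fixes c S :: real
  assumes "0 \<le> S"
  shows set_integrable_const_Icc: "set_integrable lborel {0..S} (\<lambda>_. c)"
    and set_integral_const_Icc: "(LINT s:{0..S}|lborel. c) = c * S"
  using assms by (auto simp: set_integrable_def set_lebesgue_integral_def)

lemma
  fixes \<psi> :: "real^'n::finite \<Rightarrow> real"
  assumes \<psi>: "\<psi> \<in> borel_measurable borel" "AE y in lborel. \<bar>\<psi> y\<bar> \<le> M" "0 \<le> M"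
    and A: "A \<in> sets borel" "set_integrable lborel A \<kappa>" "\<kappa> \<in> borel_measurable borel"
    and \<rho>: "\<rho> \<in> borel_measurable borel" "\<And>s. s \<in> A \<Longrightarrow> 0 \<le> \<rho> s"
  shows set_integrable_mult_heat_bounded: "set_integrable lborel A (\<lambda>s. \<kappa> s * heat \<psi> x (\<rho> s))"
    and integral_set_integral_hk_mult_bounded:
      "(\<integral>y. (LINT s:A|lborel. hk (x - y) (\<rho> s) * \<kappa> s) * \<psi> y \<partial>lborel)
        = (LINT s:A|lborel. \<kappa> s * heat \<psi> x (\<rho> s))"
  using integrable_hk_mult[OF \<psi> \<rho>(2)] integral_hk_mult_abs_le[OF \<psi> \<rho>(2)] assms
  by (intro set_integrable_mult_heat[where B = M] integral_set_integral_hk_mult[where B = M]; simp)+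

lemma w_sol_minus_zD_bounded:
  fixes \<psi> :: "real^'n::finite \<Rightarrow> real"
  assumes \<psi>: "\<psi> \<in> borel_measurable borel" "AE y in lborel. \<bar>\<psi> y\<bar> \<le> M" "0 \<le> M"
    and "\<epsilon> > 0" "\<theta> > 0" "t > 0" "snd x \<ge> 0"
  shows "w_sol \<epsilon> \<theta> \<phi> \<psi> x t - zD \<epsilon> \<phi> x t
    = (LINT s:{0..t / \<epsilon>}|lborel. hit (snd x) s * heat \<psi> (fst x) (s + (t - \<epsilon> * s) / \<theta>))"
proof (rule w_sol_minus_zD[where B = M])
  fix s assume "s \<in> {0..t / \<epsilon>}"
  then have "0 \<le> s + (t - \<epsilon> * s) / \<theta>"
    using pos_time_change(2)[of \<epsilon> \<theta> t s] assms by simp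
  then show "integrable lborel (\<lambda>y. hk (fst x - y) (s + (t - \<epsilon> * s) / \<theta>) * \<psi> y)"
      "(\<integral>y. hk (fst x - y) (s + (t - \<epsilon> * s) / \<theta>) * \<bar>\<psi> y\<bar> \<partial>lborel) \<le> M"
    using integrable_hk_mult[OF \<psi>] integral_hk_mult_abs_le[OF \<psi>] by auto
qed (use assms in auto)

subsection \<open>The Dirichlet kernel\<close>

lemma Linf_bdE:
  assumes "Linf_bd \<psi>"
  obtains M where "0 \<le> M" "\<psi> \<in> borel_measurable borel" "AE y in lborel. \<bar>\<psi> y\<bar> \<le> M"
proof -
  obtain C where C: "AE y in lborel. \<bar>\<psi> y\<bar> \<le> C" and m: "\<psi> \<in> borel_measurable borel"
    using assms by (auto simp: Linf_bd_def)
  have "AE y in lborel. \<bar>\<psi> y\<bar> \<le> max C 0"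
    using C by eventually_elim auto
  then show thesis
    using m by (intro that[of "max C 0"]) auto
qed

lemma open_half_space: "open (half_space :: ('n::finite) pt set)"
  unfolding half_space_def by (intro open_Collect_less continuous_intros)

lemma half_space_borel [measurable]: "(half_space :: ('n::finite) pt set) \<in> sets borel"
  by (rule borel_open[OF open_half_space])

lemma Linf_halfE:
  fixes \<phi> :: "('n::finite) pt \<Rightarrow> real"
  assumes "Linf_half \<phi>"
  obtains M where "0 \<le> M" "(\<lambda>y. indicator half_space y * \<phi> y) \<in> borel_measurable borel"
    "AE y in lborel. \<bar>indicator half_space y * \<phi> y\<bar> \<le> M"
proof -
  obtain C where C: "AE y in lborel. y \<in> half_space \<longrightarrow> \<bar>\<phi> y\<bar> \<le> C"
    and m: "(\<lambda>y. indicator half_space y * \<phi> y) \<in> borel_measurable borel"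
    using assms by (auto simp: Linf_half_def set_borel_measurable_def)
  have "AE y in lborel. \<bar>indicator half_space y * \<phi> y\<bar> \<le> max C 0"
    using C by eventually_elim (auto simp: indicator_def)
  then show thesis
    using m by (intro that[of "max C 0"]) auto
qed

lemma zD_eq: "zD \<epsilon> \<phi> x t = (\<integral>y. G0 x y (t / \<epsilon>) * (indicator half_space y * \<phi> y) \<partial>lborel)"
  by (simp add: zD_def set_lebesgue_integral_def mult_ac)

lemma borel_measurable_fst_snd [measurable]:
  fixes f :: "'c \<Rightarrow> 'a::topological_space \<times> 'b::topological_space"
  assumes f: "f \<in> borel_measurable M"
  shows "(\<lambda>x. fst (f x)) \<in> borel_measurable M" "(\<lambda>x. snd (f x)) \<in> borel_measurable M"
  by (auto intro!: measurable_compose[OF f] borel_measurable_continuous_onI continuous_intros)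

lemma borel_measurable_refl_pt [measurable]: "refl_pt \<in> borel_measurable borel"
proof -
  have "continuous_on UNIV (refl_pt :: 'n::finite pt \<Rightarrow> 'n pt)"
    unfolding refl_pt_def by (intro continuous_intros)
  then show ?thesis
    by (rule borel_measurable_continuous_onI)
qed

text \<open>The tangential Gaussian integrates to one, so only the normal variable is left. Working
  with nonnegative integrals avoids an integrability hypothesis on \<open>f\<close>.\<close>

lemma nn_integral_pt_hk:
  fixes x' :: "real^'n::finite"
  assumes [measurable]: "f \<in> borel_measurable borel" and "r > 0"
  shows "(\<integral>\<^sup>+y. ennreal (hk (x' - fst y) r) * f (snd y) \<partial>(lborel :: ('n pt) measure)) = (\<integral>\<^sup>+z. f z \<partial>lborel)"
proof -
  have m: "(\<lambda>y. ennreal (hk (x' - fst y) r) * f (snd y)) \<in> borel_measurable (lborel \<Otimes>\<^sub>M lborel)"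
    by measurable
  have "(\<integral>\<^sup>+y. ennreal (hk (x' - fst y) r) * f (snd y) \<partial>(lborel :: ('n pt) measure))
      = (\<integral>\<^sup>+y. ennreal (hk (x' - fst y) r) * f (snd y) \<partial>(lborel \<Otimes>\<^sub>M lborel))"
    by (simp add: lborel_prod)
  also have "\<dots> = (\<integral>\<^sup>+a. (\<integral>\<^sup>+z. ennreal (hk (x' - a) r) * f z \<partial>lborel) \<partial>lborel)"
    using lborel.nn_integral_fst[OF m] by simp
  also have "\<dots> = (\<integral>\<^sup>+a. ennreal (hk (x' - a) r) * (\<integral>\<^sup>+z. f z \<partial>lborel) \<partial>lborel)"
    by (simp add: nn_integral_cmult)
  also have "\<dots> = (\<integral>\<^sup>+z. f z \<partial>lborel)"
    using assms by (simp add: nn_integral_multc nn_integral_hk_diff)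
  finally show ?thesis .
qed

lemma hk_mono_norm:
  fixes a b :: "'a::euclidean_space"
  shows "norm a \<le> norm b \<Longrightarrow> t \<ge> 0 \<Longrightarrow> hk b t \<le> hk a t"
  by (cases "t = 0") (auto simp: hk_def power_mono intro!: mult_left_mono divide_right_mono)

lemma powr_half_le:
  assumes "s > 0"
  shows "2 * (4 * pi * s) powr (- 1 / 2) \<le> s powr (- 1 / 2)"
proof -
  have "(4 * pi * s) powr (- 1 / 2) = s powr (- 1 / 2) / sqrt (4 * pi)"
    by (rule powr_minus_half_4_pi[OF assms])
  also have "\<dots> \<le> s powr (- 1 / 2) / 2"
    using two_le_sqrt_4_pi by (intro divide_left_mono) auto
  finally show ?thesis
    by simp
qed

text \<open>After reflection, the two Gaussians differ only by the mass of \<open>hk\<close> on \<open>{- \<xi>..\<xi>}\<close>.\<close>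
lemma nn_integral_hk_reflection:
  fixes \<xi> S :: real
  assumes "0 \<le> \<xi>" "0 < S"
  shows "(\<integral>\<^sup>+y. ennreal (indicator {0<..} y * (hk (\<xi> - y) S - hk (\<xi> + y) S)) \<partial>lborel) \<le> ennreal (\<xi> * S powr (- 1 / 2))"
proof -
  have i: "integrable lborel (\<lambda>z::real. hk z S)"
    using integrable_hk_diff[of S "0::real"] assms by (simp add: hk_def)
  have i': "integrable lborel (\<lambda>z::real. indicator A z * hk z S)" if "A \<in> sets borel" for A
    using integrable_mult_indicator[OF _ i, of A] that by simp
  \<comment> \<open>The substitutions \<open>z = \<xi> - y\<close> and
    \<open>z = - \<xi> - y\<close> turn both integrals into integrals of the same Gaussian, over
    \<open>{..<\<xi>}\<close> and \<open>{..<- \<xi>}\<close>.\<close>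
  have 1: "(\<lambda>y. indicator {..<\<xi>} (\<xi> + (- 1) * y) * hk (\<xi> + (- 1) * y) S) = (\<lambda>y. indicator {0<..} y * hk (\<xi> - y) S)"
    by (auto simp: indicator_def)
  have 2: "(\<lambda>y. indicator {..<- \<xi>} (- \<xi> + (- 1) * y) * hk (- \<xi> + (- 1) * y) S) = (\<lambda>y. indicator {0<..} y * hk (\<xi> + y) S)"
  proof
    fix y
    have "hk (- \<xi> - y) S = hk (\<xi> + y) S"
      using hk_minus_commute[of "- \<xi>" y S] by (simp add: add.commute)
    then show "indicator {..<- \<xi>} (- \<xi> + (- 1) * y) * hk (- \<xi> + (- 1) * y) S = indicator {0<..} y * hk (\<xi> + y) S"
      by (auto simp: indicator_def)
  qed
  have i1: "integrable lborel (\<lambda>y. indicator {0<..} y * hk (\<xi> - y) S)"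
    using lborel_integrable_real_affine[OF i'[of "{..<\<xi>}"], of "- 1" \<xi>] unfolding 1 by simp
  have i2: "integrable lborel (\<lambda>y. indicator {0<..} y * hk (\<xi> + y) S)"
    using lborel_integrable_real_affine[OF i'[of "{..<- \<xi>}"], of "- 1" "- \<xi>"] unfolding 2 by simp
  have "(\<integral>\<^sup>+y. ennreal (indicator {0<..} y * (hk (\<xi> - y) S - hk (\<xi> + y) S)) \<partial>lborel)
     = ennreal (\<integral>y. indicator {0<..} y * (hk (\<xi> - y) S - hk (\<xi> + y) S) \<partial>lborel)"
  proof (rule nn_integral_eq_integral)
    show "AE y in lborel. 0 \<le> indicator {0<..} y * (hk (\<xi> - y) S - hk (\<xi> + y) S)"
      using assms by (auto simp: indicator_def intro!: hk_mono_norm)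
  qed (use i1 i2 in \<open>simp add: right_diff_distrib\<close>)
  also have "(\<integral>y. indicator {0<..} y * (hk (\<xi> - y) S - hk (\<xi> + y) S) \<partial>lborel)
     = (\<integral>y. indicator {0<..} y * hk (\<xi> - y) S \<partial>lborel) - (\<integral>y. indicator {0<..} y * hk (\<xi> + y) S \<partial>lborel)"
    using i1 i2 by (simp add: right_diff_distrib)
  also have "(\<integral>y. indicator {0<..} y * hk (\<xi> - y) S \<partial>lborel) = (\<integral>z. indicator {..<\<xi>} z * hk z S \<partial>lborel)"
    by (subst lborel_integral_real_affine[where c = "- 1" and t = \<xi> and f = "\<lambda>z. indicator {..<\<xi>} z * hk z S"]) (simp_all only: 1, simp_all)
  also have "(\<integral>y. indicator {0<..} y * hk (\<xi> + y) S \<partial>lborel) = (\<integral>z. indicator {..<- \<xi>} z * hk z S \<partial>lborel)"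
    by (subst lborel_integral_real_affine[where c = "- 1" and t = "- \<xi>" and f = "\<lambda>z. indicator {..<- \<xi>} z * hk z S"]) (simp_all only: 2, simp_all)
  also have "(\<integral>z. indicator {..<\<xi>} z * hk z S \<partial>lborel) - (\<integral>z. indicator {..<- \<xi>} z * hk z S \<partial>lborel)
     = (\<integral>z. indicator {..<\<xi>} z * hk z S - indicator {..<- \<xi>} z * hk z S \<partial>lborel)"
    by (rule Bochner_Integration.integral_diff[symmetric]) (auto intro: i')
  also have "\<dots> \<le> (\<integral>z. indicator {- \<xi>..\<xi>} z * (4 * pi * S) powr (- 1 / 2) \<partial>lborel)"
  proof (rule integral_mono)
    show "indicator {..<\<xi>} z * hk z S - indicator {..<- \<xi>} z * hk z S \<le> indicator {- \<xi>..\<xi>} z * (4 * pi * S) powr (- 1 / 2)" for z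
      using hk_le[of S z] assms by (auto simp: indicator_def)
  qed (use assms in \<open>auto intro!: i' Bochner_Integration.integrable_diff\<close>)
  also have "\<dots> = \<xi> * (2 * (4 * pi * S) powr (- 1 / 2))"
    using assms by simp
  also have "\<dots> \<le> \<xi> * S powr (- 1 / 2)"
    using powr_half_le[of S] assms by (intro mult_left_mono)
  finally show ?thesis
    by (simp add: ennreal_leI)
qed

lemma G0_eq:
  assumes "s \<ge> 0"
  shows "G0 x y s = hk (fst x - fst y) s * (hk (snd x - snd y) s - hk (snd x + snd y) s)"
  using assms by (simp add: G0_def hk_pt refl_pt_def right_diff_distrib)

lemma borel_measurable_G0 [measurable]: "(\<lambda>y. G0 x y s) \<in> borel_measurable borel"
  unfolding G0_def by measurable

text \<open>The tangential mass is one and the normal part is the reflection estimate. At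
  \<open>s = t / \<epsilon>\<close> the factor \<open>s powr (- 1 / 2)\<close> is the rate
  \<open>sqrt \<epsilon>\<close> of part 4.\<close>

lemma
  fixes \<phi> :: "('n::finite) pt \<Rightarrow> real"
  assumes [measurable]: "(\<lambda>y. indicator half_space y * \<phi> y) \<in> borel_measurable borel"
    and M: "AE y in lborel. \<bar>indicator half_space y * \<phi> y\<bar> \<le> M" "0 \<le> M"
    and x: "0 \<le> snd x" and s: "0 < s"
  shows integrable_G0_mult: "integrable lborel (\<lambda>y. G0 x y s * (indicator half_space y * \<phi> y))"
    and abs_integral_G0_mult_le:
      "\<bar>\<integral>y. G0 x y s * (indicator half_space y * \<phi> y) \<partial>lborel\<bar> \<le> M * (snd x * s powr (- 1 / 2))"
proof -
  have "(\<integral>\<^sup>+y. ennreal \<bar>G0 x y s * (indicator half_space y * \<phi> y)\<bar> \<partial>lborel)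
     \<le> (\<integral>\<^sup>+y. ennreal M * (ennreal (hk (fst x - fst y) s)
          * ennreal (indicator {0<..} (snd y) * (hk (snd x - snd y) s - hk (snd x + snd y) s))) \<partial>lborel)"
  proof (rule nn_integral_mono_AE)
    show "AE y in lborel. ennreal \<bar>G0 x y s * (indicator half_space y * \<phi> y)\<bar>
      \<le> ennreal M * (ennreal (hk (fst x - fst y) s)
          * ennreal (indicator {0<..} (snd y) * (hk (snd x - snd y) s - hk (snd x + snd y) s)))"
      using M(1)
    proof eventually_elim
      case (elim y)
      show ?case
      proof (cases "y \<in> half_space")
        case True
        then have y: "snd y > 0"
          by (simp add: half_space_def)
        have "hk (snd x + snd y) s \<le> hk (snd x - snd y) s"
          using x y s by (intro hk_mono_norm) auto
        then have "\<bar>G0 x y s * (indicator half_space y * \<phi> y)\<bar>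
          \<le> hk (fst x - fst y) s * (hk (snd x - snd y) s - hk (snd x + snd y) s) * M"
          using elim s unfolding G0_eq[OF less_imp_le[OF s]] abs_mult by (intro mult_mono) auto
        then show ?thesis
          using y M(2) \<open>hk (snd x + snd y) s \<le> hk (snd x - snd y) s\<close>
          by (simp add: ennreal_leI mult_ac flip: ennreal_mult)
      qed simp
    qed
  qed
  also have "\<dots> = ennreal M * (\<integral>\<^sup>+z. ennreal (indicator {0<..} z * (hk (snd x - z) s - hk (snd x + z) s)) \<partial>lborel)"
    using s by (subst nn_integral_cmult) (auto simp: nn_integral_pt_hk[of "\<lambda>z. ennreal (indicator {0<..} z * (hk (snd x - z) s - hk (snd x + z) s))"])
  also have "\<dots> \<le> ennreal M * ennreal (snd x * s powr (- 1 / 2))"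
    using x s by (intro mult_left_mono nn_integral_hk_reflection) auto
  also have "\<dots> = ennreal (M * (snd x * s powr (- 1 / 2)))"
    using M(2) x by (simp add: ennreal_mult)
  finally have *: "(\<integral>\<^sup>+y. ennreal \<bar>G0 x y s * (indicator half_space y * \<phi> y)\<bar> \<partial>lborel)
    \<le> ennreal (M * (snd x * s powr (- 1 / 2)))" .
  show "integrable lborel (\<lambda>y. G0 x y s * (indicator half_space y * \<phi> y))"
    using M(2) x by (intro integrable_of_nn_integral_abs_le[OF _ *]) auto
  show "\<bar>\<integral>y. G0 x y s * (indicator half_space y * \<phi> y) \<partial>lborel\<bar> \<le> M * (snd x * s powr (- 1 / 2))"
    using M(2) x by (intro abs_integral_le_of_nn_integral[OF _ *]) auto
qed

subsection \<open>The limits in parts 3 and 4\<close>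

text \<open>The Dirichlet terms cancel, and the two times differ by at most
  \<open>T / \<theta>\<close>. Relative to \<open>s\<close> this costs
  \<open>T / (\<theta> * s)\<close>, and the singularity is compensated by the density, which is
  \<open>O(s)\<close> at heights above \<open>L\<close>.\<close>

proposition w_sol_minus_wD_bound:
  fixes \<phi> :: "('n::finite) pt \<Rightarrow> real"
  assumes "Linf_bd \<psi>" "\<epsilon> > 0" "L > 0" "T > 0"
  shows "\<exists>C. \<forall>\<theta>>0. \<forall>x t. snd x > L \<and> 0 < t \<and> t < T \<longrightarrow>
    \<bar>w_sol \<epsilon> \<theta> \<phi> \<psi> x t - wD \<epsilon> \<phi> \<psi> x t\<bar> \<le> C * (1 / \<theta>)"
proof -
  obtain M where M: "0 \<le> M" and \<psi>: "\<psi> \<in> borel_measurable borel" "AE y in lborel. \<bar>\<psi> y\<bar> \<le> M" "0 \<le> M"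
    using Linf_bdE[OF assms(1)] by metis
  \<comment> \<open>The constant of \<open>hit_le_powr\<close> for \<open>b = 2\<close>; with
    \<open>b = 1\<close> a nonintegrable \<open>1 / s\<close> would be left.\<close>
  define K :: real where "K = (2 + 1 / 2) powr (2 + 1 / 2) * (L\<^sup>2 / 4) powr (- 2)"
  define C0 where "C0 = K * (2 * real CARD('n) * M * T)"
  have nn: "0 \<le> K" "0 \<le> C0"
    using M assms by (auto simp: K_def C0_def)
  have "\<bar>w_sol \<epsilon> \<theta> \<phi> \<psi> x t - wD \<epsilon> \<phi> \<psi> x t\<bar> \<le> C0 * T / \<epsilon> * (1 / \<theta>)"
    if \<theta>: "\<theta> > 0" and x: "snd x > L" and t: "0 < t" "t < T" for \<theta> x t
  proof -
    have h: "hit (snd x) s \<le> K * s" if "s > 0" for s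
    proof -
      have "hit (snd x) s \<le> (2 + 1 / 2) powr (2 + 1 / 2) * ((snd x)\<^sup>2 / 4) powr (- 2) * s powr (2 - 1)"
        using x that assms by (intro hit_le_powr) auto
      also have "\<dots> \<le> (2 + 1 / 2) powr (2 + 1 / 2) * (L\<^sup>2 / 4) powr (- 2) * s powr (2 - 1)"
        using x assms by (intro mult_right_mono mult_left_mono powr_mono2') (auto simp: power_mono)
      finally show ?thesis
        using that by (simp add: K_def)
    qed
    have i: "set_integrable lborel {0..t / \<epsilon>} (\<lambda>s. hit (snd x) s * heat \<psi> (fst x) (\<rho> s))"
      if "\<rho> \<in> borel_measurable borel" "\<And>s. s \<in> {0..t / \<epsilon>} \<Longrightarrow> 0 \<le> \<rho> s" for \<rho>
      using that assms x by (intro set_integrable_mult_heat_bounded[OF \<psi>] set_integrable_hit_subset) auto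
    have "w_sol \<epsilon> \<theta> \<phi> \<psi> x t - wD \<epsilon> \<phi> \<psi> x t
      = (LINT s:{0..t / \<epsilon>}|lborel. hit (snd x) s * heat \<psi> (fst x) (s + (t - \<epsilon> * s) / \<theta>))
       - (LINT s:{0..t / \<epsilon>}|lborel. hit (snd x) s * heat \<psi> (fst x) s)"
      using w_sol_minus_zD_bounded[OF \<psi> \<open>\<epsilon> > 0\<close> \<theta> t(1), of x \<phi>] wD_minus_zD[OF \<open>\<epsilon> > 0\<close>, of \<phi> \<psi> x t] x assms
      by simp
    also have "\<bar>\<dots>\<bar> \<le> (LINT s:{0..t / \<epsilon>}|lborel. C0 * (1 / \<theta>))"
    proof (rule abs_set_integral_diff_le)
      show "set_integrable lborel {0..t / \<epsilon>} (\<lambda>s. hit (snd x) s * heat \<psi> (fst x) (s + (t - \<epsilon> * s) / \<theta>))"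
        using pos_time_change(2)[OF \<open>\<epsilon> > 0\<close> \<theta> t(1)] by (intro i) (auto simp: less_imp_le)
      show "set_integrable lborel {0..t / \<epsilon>} (\<lambda>s. hit (snd x) s * heat \<psi> (fst x) s)"
        by (intro i) auto
      show "set_integrable lborel {0..t / \<epsilon>} (\<lambda>s. C0 * (1 / \<theta>))"
        using t assms by (intro set_integrable_const_Icc) auto
      fix s assume s: "s \<in> {0..t / \<epsilon>}"
      show "\<bar>hit (snd x) s * heat \<psi> (fst x) (s + (t - \<epsilon> * s) / \<theta>) - hit (snd x) s * heat \<psi> (fst x) s\<bar> \<le> C0 * (1 / \<theta>)"
      proof (cases "s = 0")
        case False
        then have s0: "s > 0" using s by simp
        note p = pos_time_change[OF \<open>\<epsilon> > 0\<close> \<theta> t(1) s]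
        have "\<bar>heat \<psi> (fst x) (s + (t - \<epsilon> * s) / \<theta>) - heat \<psi> (fst x) s\<bar>
          \<le> 2 * DIM(real^'n) * M * (\<bar>s + (t - \<epsilon> * s) / \<theta> - s\<bar> / s)"
          using p s0 by (intro abs_heat_diff_le[OF \<psi>]) auto
        also have "\<dots> \<le> 2 * real CARD('n) * M * (T / \<theta> / s)"
          using p s0 \<theta> t M mult_pos_pos[OF \<open>\<epsilon> > 0\<close> s0] by (auto intro!: mult_left_mono divide_right_mono)
        finally have "hit (snd x) s * \<bar>heat \<psi> (fst x) (s + (t - \<epsilon> * s) / \<theta>) - heat \<psi> (fst x) s\<bar>
          \<le> (K * s) * (2 * real CARD('n) * M * (T / \<theta> / s))"
          using h[OF s0] nn s0 by (intro mult_mono) auto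
        also have "\<dots> = C0 * (1 / \<theta>)"
          using s0 by (simp add: C0_def)
        finally show ?thesis
          using hit_nonneg[of "snd x" s] s0 x assms by (simp add: abs_mult flip: right_diff_distrib)
      qed (use nn \<theta> in simp)
    qed
    also have "\<dots> = C0 * (1 / \<theta>) * (t / \<epsilon>)"
      using t assms by (subst set_integral_const_Icc) auto
    also have "\<dots> \<le> C0 * (1 / \<theta>) * (T / \<epsilon>)"
      using t nn \<theta> assms by (intro mult_left_mono divide_right_mono) auto
    finally show ?thesis
      by (simp add: mult_ac)
  qed
  then show ?thesis
    by blast
qed

text \<open>On \<open>{0..S}\<close> the times differ by \<open>\<epsilon> * s / \<theta>\<close>
  and both are at least \<open>s\<close>, so the relative error is
  \<open>\<epsilon> / \<theta>\<close> for every \<open>s\<close> and the mass bound of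
  \<open>hit\<close> suffices. The part of \<open>V_sol\<close> beyond \<open>S\<close> and the term
  \<open>zD\<close> are both of size \<open>snd x / sqrt S\<close>.\<close>

proposition w_sol_minus_V_sol_bound:
  fixes \<phi> :: "('n::finite) pt \<Rightarrow> real"
  assumes "Linf_half \<phi>" "Linf_bd \<psi>" "\<theta> > 0" "L > 0" "T > 0"
  shows "\<exists>C. \<forall>\<epsilon>. 0 < \<epsilon> \<and> \<epsilon> \<le> 1 \<longrightarrow> (\<forall>x t. x \<in> half_space_cl \<and> snd x \<le> L \<and> T < t \<longrightarrow>
    \<bar>w_sol \<epsilon> \<theta> \<phi> \<psi> x t - V_sol \<theta> \<psi> x t\<bar> \<le> C * sqrt \<epsilon>)"
proof -
  obtain M where M: "0 \<le> M" and \<psi>: "\<psi> \<in> borel_measurable borel" "AE y in lborel. \<bar>\<psi> y\<bar> \<le> M" "0 \<le> M"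
    using Linf_bdE[OF assms(2)] by metis
  obtain M1 where M1: "0 \<le> M1" and \<phi>: "(\<lambda>y. indicator half_space y * \<phi> y) \<in> borel_measurable borel"
    "AE y in lborel. \<bar>indicator half_space y * \<phi> y\<bar> \<le> M1"
    using Linf_halfE[OF assms(1)] by metis
  \<comment> \<open>In this order: comparison of times on \<open>{0..S}\<close>, tail of the Poisson
    superposition beyond \<open>S\<close>, contribution of \<open>\<phi>\<close>.\<close>
  define C where "C = 2 * real CARD('n) * M / \<theta> + M * L / sqrt T + M1 * L / sqrt T"
  have "\<bar>w_sol \<epsilon> \<theta> \<phi> \<psi> x t - V_sol \<theta> \<psi> x t\<bar> \<le> C * sqrt \<epsilon>"
    if \<epsilon>: "0 < \<epsilon>" "\<epsilon> \<le> 1" and x: "x \<in> half_space_cl" "snd x \<le> L" and t: "T < t" for \<epsilon> x t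
  proof -
    define S where "S = t / \<epsilon>"
    have t0: "t > 0" and S: "S > 0" and x0: "snd x \<ge> 0"
      using t \<epsilon> x assms by (auto simp: S_def half_space_cl_def)
    have Sle: "S powr (- 1 / 2) \<le> sqrt \<epsilon> / sqrt T"
    proof -
      have "S powr (- 1 / 2) = 1 / sqrt S"
        using S powr_minus_divide[of S "1 / 2"] by (simp add: powr_half_sqrt)
      also have "\<dots> = sqrt \<epsilon> / sqrt t"
        by (simp add: S_def real_sqrt_divide)
      also have "\<dots> \<le> sqrt \<epsilon> / sqrt T"
        using t assms \<epsilon> by (intro divide_left_mono) auto
      finally show ?thesis .
    qed
    have xS: "snd x * S powr (- 1 / 2) \<le> L * (sqrt \<epsilon> / sqrt T)"
      using Sle x x0 by (intro mult_mono) auto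
    have z: "\<bar>zD \<epsilon> \<phi> x t\<bar> \<le> M1 * L / sqrt T * sqrt \<epsilon>"
    proof -
      have "\<bar>zD \<epsilon> \<phi> x t\<bar> \<le> M1 * (snd x * S powr (- 1 / 2))"
        unfolding zD_eq S_def[symmetric] by (rule abs_integral_G0_mult_le[OF \<phi> M1 x0 S])
      also have "\<dots> \<le> M1 * (L * (sqrt \<epsilon> / sqrt T))"
        using xS M1 by (rule mult_left_mono)
      finally show ?thesis by simp
    qed
    have w: "\<bar>w_sol \<epsilon> \<theta> \<phi> \<psi> x t - zD \<epsilon> \<phi> x t - V_sol \<theta> \<psi> x t\<bar> \<le> (2 * real CARD('n) * M / \<theta> + M * L / sqrt T) * sqrt \<epsilon>"
    proof (cases "snd x = 0")
      case True
      then have "w_sol \<epsilon> \<theta> \<phi> \<psi> x t - zD \<epsilon> \<phi> x t = 0"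
        using w_sol_minus_zD_bounded[OF \<psi> \<epsilon>(1) \<open>\<theta> > 0\<close> t0, of x \<phi>] by (simp add: set_lebesgue_integral_def)
      moreover have "V_sol \<theta> \<psi> x t = 0"
        using True by (simp add: V_sol_def Pker_def)
      ultimately show ?thesis
        using M assms \<epsilon> by simp
    next
      case False
      then have xp: "snd x > 0" using x0 by simp
      define f where "f s = hit (snd x) s * heat \<psi> (fst x) (s + t / \<theta>)" for s
      define g where "g s = hit (snd x) s * heat \<psi> (fst x) (s + (t - \<epsilon> * s) / \<theta>)" for s
      have "set_integrable lborel {0..} f"
        unfolding f_def using assms t0 xp
        by (intro set_integrable_mult_heat_bounded[OF \<psi>] set_integrable_hit) auto
      then have fi: "set_integrable lborel A f" if "A \<subseteq> {0..}" "A \<in> sets borel" for A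
        using that by (auto intro: set_integrable_subset)
      have gi: "set_integrable lborel {0..S} g"
        unfolding g_def S_def using pos_time_change(2)[OF \<epsilon>(1) \<open>\<theta> > 0\<close> t0] x0
        by (intro set_integrable_mult_heat_bounded[OF \<psi>] set_integrable_hit_subset) (auto simp: less_imp_le)
      have "V_sol \<theta> \<psi> x t = (LINT s:{0..}|lborel. f s)"
        unfolding f_def by (rule V_sol_eq[OF \<psi> xp t0 \<open>\<theta> > 0\<close>])
      also have "{0..} = {0..S} \<union> {S<..}"
        using S by auto
      also have "(LINT s:{0..S} \<union> {S<..}|lborel. f s) = (LINT s:{0..S}|lborel. f s) + (LINT s:{S<..}|lborel. f s)"
        using S by (intro set_integral_Un fi) auto
      finally have "w_sol \<epsilon> \<theta> \<phi> \<psi> x t - zD \<epsilon> \<phi> x t - V_sol \<theta> \<psi> x t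
        = ((LINT s:{0..S}|lborel. g s) - (LINT s:{0..S}|lborel. f s)) - (LINT s:{S<..}|lborel. f s)"
        using w_sol_minus_zD_bounded[OF \<psi> \<epsilon>(1) \<open>\<theta> > 0\<close> t0 x0, of \<phi>] by (simp add: g_def S_def)
      moreover have "\<bar>(LINT s:{0..S}|lborel. g s) - (LINT s:{0..S}|lborel. f s)\<bar> \<le> 2 * real CARD('n) * M * (\<epsilon> / \<theta>)"
      proof -
        have "\<bar>(LINT s:{0..S}|lborel. g s) - (LINT s:{0..S}|lborel. f s)\<bar>
          \<le> (LINT s:{0..S}|lborel. 2 * real CARD('n) * M * (\<epsilon> / \<theta>) * hit (snd x) s)"
        proof (rule abs_set_integral_diff_le[OF gi fi])
          show "set_integrable lborel {0..S} (\<lambda>s. 2 * real CARD('n) * M * (\<epsilon> / \<theta>) * hit (snd x) s)"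
            using x0 by (intro set_integrable_mult_right set_integrable_hit_subset) auto
          fix s assume s: "s \<in> {0..S}"
          show "\<bar>g s - f s\<bar> \<le> 2 * real CARD('n) * M * (\<epsilon> / \<theta>) * hit (snd x) s"
          proof (cases "s = 0")
            case False
            then have s0: "s > 0" using s by simp
            note p = pos_time_change[OF \<epsilon>(1) \<open>\<theta> > 0\<close> t0 s[unfolded S_def]]
            have "\<bar>heat \<psi> (fst x) (s + (t - \<epsilon> * s) / \<theta>) - heat \<psi> (fst x) (s + t / \<theta>)\<bar>
              \<le> 2 * DIM(real^'n) * M * (\<bar>(s + (t - \<epsilon> * s) / \<theta>) - (s + t / \<theta>)\<bar> / s)"
              using p s0 t0 assms
              by (intro abs_heat_diff_le[OF \<psi>]) (auto intro!: add_pos_pos simp: le_max_iff_disj)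
            also have "(s + (t - \<epsilon> * s) / \<theta>) - (s + t / \<theta>) = - (\<epsilon> * s / \<theta>)"
              by (simp add: diff_divide_distrib)
            also have "\<bar>- (\<epsilon> * s / \<theta>)\<bar> / s = \<epsilon> / \<theta>"
              using s0 \<epsilon> assms by simp
            finally have "hit (snd x) s * \<bar>heat \<psi> (fst x) (s + (t - \<epsilon> * s) / \<theta>) - heat \<psi> (fst x) (s + t / \<theta>)\<bar>
              \<le> hit (snd x) s * (2 * real CARD('n) * M * (\<epsilon> / \<theta>))"
              using hit_nonneg[of "snd x" s] s0 x0 by (intro mult_left_mono) auto
            then show ?thesis
              using hit_nonneg[of "snd x" s] s0 x0
              by (simp add: f_def g_def abs_mult mult.commute[of "hit _ _"] flip: left_diff_distrib)
          qed (simp add: f_def g_def)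
        qed auto
        also have "\<dots> = 2 * real CARD('n) * M * (\<epsilon> / \<theta>) * (LINT s:{0..S}|lborel. hit (snd x) s)"
          by (rule set_integral_mult_right)
        also have "\<dots> \<le> 2 * real CARD('n) * M * (\<epsilon> / \<theta>) * 1"
          using M \<epsilon> assms x0 by (intro mult_left_mono set_integral_hit_le_1) auto
        finally show ?thesis by simp
      qed
      moreover have "\<bar>LINT s:{S<..}|lborel. f s\<bar> \<le> M * (L * (sqrt \<epsilon> / sqrt T))"
      proof -
        have pi: "set_integrable lborel {S..} (\<lambda>s. M * (snd x / 2) * s powr (- 3 / 2))"
          using S by (intro set_integrable_mult_right set_integrable_powr_to_inf) auto
        have "\<bar>LINT s:{S<..}|lborel. f s\<bar> \<le> (LINT s:{S<..}|lborel. M * (snd x / 2) * s powr (- 3 / 2))"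
        proof (rule abs_set_integral_le)
          show "f \<in> borel_measurable lborel"
            unfolding f_def using \<psi>(1) by measurable
          show "set_integrable lborel {S<..} (\<lambda>s. M * (snd x / 2) * s powr (- 3 / 2))"
            by (rule set_integrable_subset[OF pi]) auto
          fix s assume "s \<in> {S<..}"
          then have s: "s > 0" using S by simp
          have "\<bar>heat \<psi> (fst x) (s + t / \<theta>)\<bar> \<le> M"
            using s t0 assms by (intro abs_heat_le[OF \<psi>]) auto
          then have "hit (snd x) s * \<bar>heat \<psi> (fst x) (s + t / \<theta>)\<bar> \<le> (snd x / 2 * s powr (- 3 / 2)) * M"
            using s x0 hit_le[of "snd x" s] by (intro mult_mono) auto
          then show "\<bar>f s\<bar> \<le> M * (snd x / 2) * s powr (- 3 / 2)"
            using hit_nonneg[of "snd x" s] s x0 by (simp add: f_def abs_mult mult_ac)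
        qed auto
        also have "\<dots> \<le> (LINT s:{S..}|lborel. M * (snd x / 2) * s powr (- 3 / 2))"
          using M x0 by (intro set_integral_mono_set[OF pi]) auto
        also have "\<dots> = M * (snd x * S powr (- 1 / 2))"
          using S by (subst set_integral_mult_right, subst set_integral_powr_to_inf) auto
        also have "\<dots> \<le> M * (L * (sqrt \<epsilon> / sqrt T))"
          using xS M by (rule mult_left_mono)
        finally show ?thesis .
      qed
      \<comment> \<open>The time comparison is of order \<open>\<epsilon>\<close>; it is weakened to
        \<open>sqrt \<epsilon>\<close> by \<open>\<epsilon> \<le> 1\<close>.\<close>
      moreover have "2 * real CARD('n) * M * (\<epsilon> / \<theta>) \<le> 2 * real CARD('n) * M * (sqrt \<epsilon> / \<theta>)"
        using \<epsilon> M assms real_le_rsqrt[of \<epsilon> \<epsilon>] mult_left_le[of \<epsilon> \<epsilon>]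
        by (intro mult_left_mono divide_right_mono) (auto simp: power2_eq_square)
      ultimately have "\<bar>w_sol \<epsilon> \<theta> \<phi> \<psi> x t - zD \<epsilon> \<phi> x t - V_sol \<theta> \<psi> x t\<bar>
          \<le> 2 * real CARD('n) * M * (sqrt \<epsilon> / \<theta>) + M * (L * (sqrt \<epsilon> / sqrt T))"
        by linarith
      then show ?thesis
        by (simp add: distrib_right)
    qed
    have "\<bar>w_sol \<epsilon> \<theta> \<phi> \<psi> x t - V_sol \<theta> \<psi> x t\<bar>
      \<le> (2 * real CARD('n) * M / \<theta> + M * L / sqrt T) * sqrt \<epsilon> + M1 * L / sqrt T * sqrt \<epsilon>"
      using z w by linarith
    then show ?thesis
      by (simp add: C_def distrib_right)
  qed
  then show ?thesis
    by blast
qed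

subsection \<open>The limit in part 5\<close>

lemma BC_halfE:
  fixes \<phi> :: "('n::finite) pt \<Rightarrow> real"
  assumes "BC_half \<phi>"
  obtains M where "0 \<le> M" "(\<lambda>y. indicator half_space y * \<phi> y) \<in> borel_measurable borel"
    "\<And>y. \<bar>indicator half_space y * \<phi> y\<bar> \<le> M"
proof -
  obtain C where C: "\<And>y. y \<in> half_space \<Longrightarrow> \<bar>\<phi> y\<bar> \<le> C"
    using assms by (auto simp: BC_half_def bounded_iff)
  have "(\<lambda>y. indicator half_space y *\<^sub>R \<phi> y) \<in> borel_measurable borel"
    using assms by (intro borel_measurable_continuous_on_indicator) (auto simp: BC_half_def)
  moreover have "\<bar>indicator half_space y * \<phi> y\<bar> \<le> max C 0" for y
    using C[of y] by (auto simp: indicator_def)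
  ultimately show thesis
    by (intro that[of "max C 0"]) auto
qed

text \<open>A Lebesgue number of the cover of \<open>K\<close> by open subsets of \<open>U\<close>
  on which \<open>\<phi>\<close> oscillates by at most \<open>e\<close>. Unlike uniform continuity
  on \<open>K\<close>, it also controls points \<open>y\<close> outside \<open>K\<close> and keeps
  them in \<open>U\<close>.\<close>

lemma compact_subset_open_uniform_modulus:
  fixes \<phi> :: "'a::metric_space \<Rightarrow> real"
  assumes K: "compact K" "K \<subseteq> U" and U: "open U" and \<phi>: "continuous_on U \<phi>" and e: "e > 0"
  obtains r where "r > 0" "\<And>x y. x \<in> K \<Longrightarrow> dist x y < r \<Longrightarrow> y \<in> U \<and> \<bar>\<phi> y - \<phi> x\<bar> \<le> e"
proof -
  define G where "G = {V. open V \<and> V \<subseteq> U \<and> (\<forall>y\<in>V. \<forall>z\<in>V. \<bar>\<phi> y - \<phi> z\<bar> \<le> e)}"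
  have "K \<subseteq> \<Union>G"
  proof
    fix x assume "x \<in> K"
    then have x: "x \<in> U" using K by blast
    define V where "V = U \<inter> \<phi> -` ball (\<phi> x) (e / 2)"
    have "open V"
      unfolding V_def using \<phi> U by (intro continuous_open_preimage) auto
    moreover have "\<bar>\<phi> y - \<phi> z\<bar> \<le> e" if "y \<in> V" "z \<in> V" for y z
      using that abs_triangle_ineq4[of "\<phi> x - \<phi> z" "\<phi> x - \<phi> y"]
      by (simp add: V_def dist_real_def)
    ultimately have "V \<in> G"
      by (auto simp: G_def V_def)
    moreover have "x \<in> V"
      using x e by (simp add: V_def)
    ultimately show "x \<in> \<Union>G" by blast
  qed
  moreover have "open V" if "V \<in> G" for V
    using that by (simp add: G_def)
  ultimately obtain r where r: "r > 0" "\<And>x. x \<in> K \<Longrightarrow> \<exists>V\<in>G. ball x r \<subseteq> V"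
    using Heine_Borel_lemma[OF K(1), of G] by metis
  show thesis
  proof (rule that[OF r(1)])
    fix x y assume "x \<in> K" and xy: "dist x y < r"
    then obtain V where "V \<in> G" "ball x r \<subseteq> V"
      using r(2) by blast
    moreover have "x \<in> ball x r" "y \<in> ball x r"
      using r(1) xy by auto
    ultimately show "y \<in> U \<and> \<bar>\<phi> y - \<phi> x\<bar> \<le> e"
      unfolding G_def by blast
  qed
qed

lemma norm_diff_refl_pt_ge:
  assumes "0 \<le> snd x" "0 \<le> snd y"
  shows "norm (x - y) \<le> norm (x - refl_pt y)"
proof -
  have "(snd x - snd y)\<^sup>2 \<le> (snd x + snd y)\<^sup>2"
    using assms by (simp flip: abs_le_square_iff)
  then show ?thesis
    by (simp add: norm_prod_def refl_pt_def)
qed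

lemma exp_minus_le_inverse:
  fixes u :: real
  assumes "u > 0"
  shows "exp (- u) \<le> 1 / u"
proof -
  have "u \<le> exp u"
    using exp_ge_add_one_self[of u] by linarith
  then show ?thesis
    using assms by (simp add: exp_minus field_simps)
qed

text \<open>Near \<open>x\<close> the modulus of continuity gives \<open>e\<close>; far from
  \<open>x\<close> the Gaussian tail is small. The ball of radius \<open>r\<close> lies in the half
  space, so the image kernel is a tail as well: the factor 3 is 2 for the direct tail plus 1 for the
  image.\<close>

lemma abs_zD_minus_le:
  fixes \<phi> :: "('n::finite) pt \<Rightarrow> real"
  assumes m: "(\<lambda>y. indicator half_space y * \<phi> y) \<in> borel_measurable borel"
    and M: "\<And>y. \<bar>indicator half_space y * \<phi> y\<bar> \<le> M"
    and r: "r > 0" "\<And>y. dist x y < r \<Longrightarrow> y \<in> half_space \<and> \<bar>\<phi> y - \<phi> x\<bar> \<le> e"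
    and s: "s > 0"
  shows "\<bar>(\<integral>y. G0 x y s * (indicator half_space y * \<phi> y) \<partial>lborel) - \<phi> x\<bar>
    \<le> e + 3 * M * (2 powr (real DIM('n pt) / 2) * (8 * s / r\<^sup>2))"
proof -
  define q where "q = 2 powr (real DIM('n pt) / 2) * exp (- r\<^sup>2 / (8 * s))"
  define \<phi>0 where "\<phi>0 y = indicator half_space y * \<phi> y" for y
  note [measurable] = m[folded \<phi>0_def]
  have M0: "0 \<le> M" and q0: "0 \<le> q" and e0: "0 \<le> e"
    using M[of x] r(2)[of x] r(1) by (auto simp: q_def)
  have x: "x \<in> half_space" "\<phi> x = \<phi>0 x" "0 \<le> snd x"
    using r(2)[of x] r(1) by (auto simp: \<phi>0_def half_space_def)
  define D where "D y = G0 x y s * \<phi>0 y - hk (x - y) s * \<phi> x" for y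
  have i1: "integrable lborel (\<lambda>y. G0 x y s * \<phi>0 y)"
    unfolding \<phi>0_def using M M0 x s by (intro integrable_G0_mult[OF m, of M]) auto
  have i2: "integrable lborel (\<lambda>y. hk (x - y) s * \<phi> x)"
    using s by (intro integrable_mult_left integrable_hk_diff)
  have b: "\<bar>D y\<bar> \<le> e * hk (x - y) s + 3 * M * q * hk (x - y) (2 * s)" for y
  proof -
    have D: "D y = hk (x - y) s * (\<phi>0 y - \<phi> x) - hk (x - refl_pt y) s * \<phi>0 y"
      by (simp add: D_def G0_def algebra_simps)
    have 1: "\<bar>hk (x - y) s * (\<phi>0 y - \<phi> x)\<bar> \<le> e * hk (x - y) s + 2 * M * q * hk (x - y) (2 * s)"
    proof (cases "dist x y < r")
      case True
      then have "\<bar>\<phi>0 y - \<phi> x\<bar> \<le> e"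
        using r(2) by (auto simp: \<phi>0_def)
      then have "\<bar>hk (x - y) s * (\<phi>0 y - \<phi> x)\<bar> \<le> e * hk (x - y) s"
        using mult_left_mono[of "\<bar>\<phi>0 y - \<phi> x\<bar>" e "hk (x - y) s"] by (simp add: abs_mult mult.commute)
      moreover have "0 \<le> 2 * M * q * hk (x - y) (2 * s)"
        using M0 q0 by simp
      ultimately show ?thesis by linarith
    next
      case False
      then have "hk (x - y) s \<le> q * hk (x - y) (2 * s)"
        using r(1) s unfolding q_def by (intro hk_tail_le) (auto simp: dist_norm)
      moreover have "\<bar>\<phi>0 y - \<phi> x\<bar> \<le> 2 * M"
        using M[of y] M[of x] x(2) unfolding \<phi>0_def[symmetric] by linarith
      ultimately have "hk (x - y) s * \<bar>\<phi>0 y - \<phi> x\<bar> \<le> (q * hk (x - y) (2 * s)) * (2 * M)"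
        using q0 by (intro mult_mono) auto
      moreover have "0 \<le> e * hk (x - y) s"
        using e0 by simp
      ultimately show ?thesis
        by (simp add: abs_mult mult_ac)
    qed
    have 2: "\<bar>hk (x - refl_pt y) s * \<phi>0 y\<bar> \<le> M * q * hk (x - y) (2 * s)"
    proof (cases "y \<in> half_space")
      case True
      then have y: "snd y > 0"
        by (simp add: half_space_def)
      then have "refl_pt y \<notin> half_space"
        by (simp add: half_space_def refl_pt_def)
      then have "r \<le> norm (x - refl_pt y)"
        using r(2)[of "refl_pt y"] by (force simp: dist_norm)
      then have "hk (x - refl_pt y) s \<le> q * hk (x - refl_pt y) (2 * s)"
        using r(1) s unfolding q_def by (intro hk_tail_le) auto
      \<comment> \<open>At time \<open>2 * s\<close> the image kernel is dominated by the direct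
        one, so that a single Gaussian of mass one bounds both tails.\<close>
      also have "\<dots> \<le> q * hk (x - y) (2 * s)"
        using x(3) y s q0 by (intro mult_left_mono hk_mono_norm norm_diff_refl_pt_ge) auto
      finally have "hk (x - refl_pt y) s * \<bar>\<phi>0 y\<bar> \<le> (q * hk (x - y) (2 * s)) * M"
        using M[of y] q0 unfolding \<phi>0_def[symmetric] by (intro mult_mono) auto
      then show ?thesis
        by (simp add: abs_mult mult_ac)
    qed (use M0 q0 in \<open>simp add: \<phi>0_def\<close>)
    show ?thesis
      using 1 2 unfolding D by linarith
  qed
  have "(\<integral>y. G0 x y s * \<phi>0 y \<partial>lborel) - \<phi> x = (\<integral>y. D y \<partial>lborel)"
    unfolding D_def using i1 i2 s by (simp add: integral_hk_diff)
  also have "\<bar>\<dots>\<bar> \<le> (\<integral>y. \<bar>D y\<bar> \<partial>lborel)"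
    by (rule integral_abs_bound)
  also have "\<dots> \<le> (\<integral>y. e * hk (x - y) s + 3 * M * q * hk (x - y) (2 * s) \<partial>lborel)"
  proof (rule integral_mono)
    show "integrable lborel (\<lambda>y. \<bar>D y\<bar>)"
      unfolding D_def using i1 i2 by auto
    show "integrable lborel (\<lambda>y. e * hk (x - y) s + 3 * M * q * hk (x - y) (2 * s))"
      using s by (intro Bochner_Integration.integrable_add integrable_mult_right integrable_hk_diff) auto
  qed (rule b)
  also have "\<dots> = e + 3 * M * q"
    using s by (subst Bochner_Integration.integral_add) (auto simp: integral_hk_diff intro!: integrable_mult_right integrable_hk_diff)
  also have "\<dots> \<le> e + 3 * M * (2 powr (real DIM('n pt) / 2) * (8 * s / r\<^sup>2))"
    using exp_minus_le_inverse[of "r\<^sup>2 / (8 * s)"] r(1) s M0 unfolding q_def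
    by (intro add_left_mono mult_left_mono) auto
  finally show ?thesis
    unfolding \<phi>0_def .
qed

text \<open>The diffusion only runs for the time \<open>t / \<epsilon> \<le> T / \<epsilon>\<close>.
  On \<open>K\<close> the deviation of \<open>zD\<close> exceeds \<open>e / 2\<close> by at most
  \<open>A / \<epsilon>\<close>, and the boundary contributes at most
  \<open>B / \<epsilon>\<close>.\<close>

proposition w_sol_tendsto_initial:
  fixes \<phi> :: "('n::finite) pt \<Rightarrow> real"
  assumes "BC_half \<phi>" "Linf_bd \<psi>" and K: "compact K" "K \<subseteq> half_space" and "T > 0" "e > 0" "\<theta> > 0"
  shows "\<forall>\<^sub>F \<epsilon> in at_top. \<forall>x\<in>K. \<forall>t. 0 < t \<and> t < T \<longrightarrow> \<bar>w_sol \<epsilon> \<theta> \<phi> \<psi> x t - \<phi> x\<bar> \<le> e"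
proof -
  obtain M where M: "0 \<le> M" and \<psi>: "\<psi> \<in> borel_measurable borel" "AE y in lborel. \<bar>\<psi> y\<bar> \<le> M" "0 \<le> M"
    using Linf_bdE[OF assms(2)] by metis
  obtain M1 where M1: "0 \<le> M1" and \<phi>: "(\<lambda>y. indicator half_space y * \<phi> y) \<in> borel_measurable borel"
    "\<And>y. \<bar>indicator half_space y * \<phi> y\<bar> \<le> M1"
    using BC_halfE[OF assms(1)] by metis
  obtain r where r: "r > 0" "\<And>x y. x \<in> K \<Longrightarrow> dist x y < r \<Longrightarrow> y \<in> half_space \<and> \<bar>\<phi> y - \<phi> x\<bar> \<le> e / 2"
    using compact_subset_open_uniform_modulus[OF K open_half_space, of \<phi> "e / 2"] assms(1) \<open>e > 0\<close>
    by (auto simp: BC_half_def)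
  define A where "A = 3 * M1 * (2 powr (real DIM('n pt) / 2) * (8 * T / r\<^sup>2))"
  \<comment> \<open>The constant of \<open>hit_le_powr\<close> for \<open>b = 1\<close>, which
    bounds \<open>hit\<close> uniformly in \<open>s\<close> at heights of at least
    \<open>r\<close>.\<close>
  define H :: real where "H = (1 + 1 / 2) powr (1 + 1 / 2) * (r\<^sup>2 / 4) powr (- 1)"
  define B where "B = M * H * T"
  have AB: "0 \<le> A" "0 \<le> B" "0 \<le> H"
    using M M1 assms by (auto simp: A_def B_def H_def)
  have "\<bar>w_sol \<epsilon> \<theta> \<phi> \<psi> x t - \<phi> x\<bar> \<le> e"
    if \<epsilon>: "\<epsilon> \<ge> 1" "\<epsilon> \<ge> 2 * (A + B) / e" and x: "x \<in> K" and t: "0 < t" "t < T" for \<epsilon> x t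
  proof -
    have \<epsilon>0: "\<epsilon> > 0" and S: "0 < t / \<epsilon>" "t / \<epsilon> \<le> T / \<epsilon>"
      using \<epsilon> t by (auto intro!: divide_right_mono)
    \<comment> \<open>The radius of the modulus also bounds the height from below: the foot
      \<open>(fst x, 0)\<close> lies outside the half space, hence at distance at least
      \<open>r\<close>.\<close>
    have xr: "r \<le> snd x"
    proof (rule ccontr)
      assume "\<not> r \<le> snd x"
      moreover have "dist x (fst x, 0) = \<bar>snd x\<bar>" "snd x > 0"
        using x K by (auto simp: dist_prod_def half_space_def dist_real_def prod_eq_iff)
      ultimately have "(fst x, 0) \<in> half_space"
        using r(2)[OF x, of "(fst x, 0)"] by auto
      then show False
        by (simp add: half_space_def)
    qed
    have "\<bar>zD \<epsilon> \<phi> x t - \<phi> x\<bar> \<le> e / 2 + 3 * M1 * (2 powr (real DIM('n pt) / 2) * (8 * (t / \<epsilon>) / r\<^sup>2))"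
      unfolding zD_eq using r x S by (intro abs_zD_minus_le[OF \<phi>]) auto
    also have "\<dots> \<le> e / 2 + 3 * M1 * (2 powr (real DIM('n pt) / 2) * (8 * (T / \<epsilon>) / r\<^sup>2))"
      using t \<epsilon>0 M1 by (intro add_left_mono mult_left_mono divide_right_mono) auto
    finally have z: "\<bar>zD \<epsilon> \<phi> x t - \<phi> x\<bar> \<le> e / 2 + A / \<epsilon>"
      by (simp add: A_def mult_ac)
    have "\<bar>w_sol \<epsilon> \<theta> \<phi> \<psi> x t - zD \<epsilon> \<phi> x t\<bar> \<le> (LINT s:{0..t / \<epsilon>}|lborel. M * H)"
      using xr r(1)
    proof (subst w_sol_minus_zD_bounded[OF \<psi> \<epsilon>0 \<open>\<theta> > 0\<close> t(1)], simp, intro abs_set_integral_le)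
      show "(\<lambda>s. hit (snd x) s * heat \<psi> (fst x) (s + (t - \<epsilon> * s) / \<theta>)) \<in> borel_measurable lborel"
        using \<psi>(1) by measurable
      show "set_integrable lborel {0..t / \<epsilon>} (\<lambda>s. M * H)"
        using S by (intro set_integrable_const_Icc) auto
      fix s assume s: "s \<in> {0..t / \<epsilon>}"
      show "\<bar>hit (snd x) s * heat \<psi> (fst x) (s + (t - \<epsilon> * s) / \<theta>)\<bar> \<le> M * H"
      proof (cases "s = 0")
        case False
        then have s0: "s > 0" using s by simp
        have "\<bar>heat \<psi> (fst x) (s + (t - \<epsilon> * s) / \<theta>)\<bar> \<le> M"
          using pos_time_change(2)[OF \<epsilon>0 \<open>\<theta> > 0\<close> t(1) s] by (intro abs_heat_le[OF \<psi>]) auto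
        moreover have "hit (snd x) s \<le> H"
        proof -
          have "hit (snd x) s \<le> (1 + 1 / 2) powr (1 + 1 / 2) * ((snd x)\<^sup>2 / 4) powr (- 1) * s powr (1 - 1)"
            using xr r(1) s0 by (intro hit_le_powr) auto
          also have "\<dots> \<le> (1 + 1 / 2) powr (1 + 1 / 2) * (r\<^sup>2 / 4) powr (- 1) * s powr (1 - 1)"
            using xr r(1) by (intro mult_right_mono mult_left_mono powr_mono2') (auto simp: power_mono)
          finally show ?thesis
            using s0 by (simp add: H_def)
        qed
        ultimately have "hit (snd x) s * \<bar>heat \<psi> (fst x) (s + (t - \<epsilon> * s) / \<theta>)\<bar> \<le> H * M"
          using AB(3) by (intro mult_mono) auto
        then show ?thesis
          using hit_nonneg[of "snd x" s] xr r(1) s0 by (simp add: abs_mult mult.commute)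
      qed (use M AB in simp)
    qed auto
    also have "\<dots> = M * H * (t / \<epsilon>)"
      using S by (subst set_integral_const_Icc) auto
    also have "\<dots> \<le> M * H * (T / \<epsilon>)"
      using S M AB by (intro mult_left_mono) auto
    finally have w: "\<bar>w_sol \<epsilon> \<theta> \<phi> \<psi> x t - zD \<epsilon> \<phi> x t\<bar> \<le> B / \<epsilon>"
      by (simp add: B_def)
    have "(A + B) / \<epsilon> \<le> e / 2"
      using \<epsilon>(2) \<epsilon>0 \<open>e > 0\<close> by (simp add: field_simps)
    then have "A / \<epsilon> + B / \<epsilon> \<le> e / 2"
      by (simp add: add_divide_distrib)
    then show ?thesis
      using z w by linarith
  qed
  then show ?thesis
    by (intro eventually_mono[OF eventually_ge_at_top[of "max 1 (2 * (A + B) / e)"]]) auto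
qed

subsection \<open>The limit in part 1\<close>

text \<open>Needs no integrability, since the integral of a nonintegrable function is 0 by
  convention.\<close>

lemma ennreal_abs_integral_le:
  fixes f :: "'a \<Rightarrow> real"
  shows "ennreal \<bar>\<integral>x. f x \<partial>M\<bar> \<le> (\<integral>\<^sup>+x. ennreal \<bar>f x\<bar> \<partial>M)"
proof (cases "integrable M f")
  case True
  then show ?thesis
    using integral_norm_bound_ennreal[OF True] by simp
qed (simp add: not_integrable_integral_eq)

text \<open>\<open>- 2 * hk\<close> is an antiderivative of \<open>hit\<close> in the height, so the
  integral over the closed half line is \<open>2 * hk c s\<close>, at most the maximum of that
  Gaussian.\<close>

lemma nn_integral_hit_shift:
  assumes "s > 0" "c \<ge> 0"
  shows "(\<integral>\<^sup>+y. ennreal (indicator {0<..} y * hit (c + y) s) \<partial>lborel) \<le> ennreal (s powr (- 1 / 2))"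
proof -
  have lim: "((\<lambda>y. - 2 * hk (c + y) s) \<longlongrightarrow> - 2 * ((4 * pi * s) powr (- real DIM(real) / 2) * 0)) at_top"
    unfolding hk_def
  proof (intro tendsto_mult tendsto_const)
    have "filterlim (\<lambda>y. (norm (c + y))\<^sup>2 / (4 * s)) at_top at_top"
    proof (rule filterlim_at_top_mono)
      show "filterlim (\<lambda>y. 1 / (4 * s) * y) at_top at_top"
        using assms by (intro filterlim_tendsto_pos_mult_at_top[OF tendsto_const] filterlim_ident) auto
      show "\<forall>\<^sub>F y in at_top. 1 / (4 * s) * y \<le> (norm (c + y))\<^sup>2 / (4 * s)"
        using eventually_ge_at_top[of 1]
      proof eventually_elim
        case (elim y)
        have "y * 1 \<le> (c + y) * (c + y)"
          using elim assms by (intro mult_mono) auto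
        then have "y \<le> (norm (c + y))\<^sup>2"
          by (simp add: power2_eq_square)
        then show ?case
          using assms by (simp add: divide_right_mono)
      qed
    qed
    then have "filterlim (\<lambda>y. - (norm (c + y))\<^sup>2 / (4 * s)) at_bot at_top"
      by (simp add: filterlim_uminus_at_top)
    then show "((\<lambda>y. exp (- (norm (c + y))\<^sup>2 / (4 * s))) \<longlongrightarrow> 0) at_top"
      by (rule filterlim_compose[OF exp_at_bot])
  qed
  have "(\<integral>\<^sup>+y. ennreal (indicator {0<..} y * hit (c + y) s) \<partial>lborel) \<le> (\<integral>\<^sup>+y. ennreal (hit (c + y) s) * indicator {0..} y \<partial>lborel)"
    by (intro nn_integral_mono) (auto simp: indicator_def)
  also have "\<dots> = ennreal (- 2 * ((4 * pi * s) powr (- real DIM(real) / 2) * 0) - (- 2 * hk (c + 0) s))"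
  proof (rule nn_integral_FTC_atLeast[OF _ _ _ lim])
    show "DERIV (\<lambda>y. - 2 * hk (c + y) s) y :> hit (c + y) s" for y
      unfolding hk_def hit_def using assms
      by (auto intro!: derivative_eq_intros simp: power2_eq_square divide_simps)
  qed (use assms in \<open>auto intro!: hit_nonneg\<close>)
  also have "\<dots> \<le> ennreal (s powr (- 1 / 2))"
    using hk_le[of s c] powr_half_le[of s] assms by (intro ennreal_leI) auto
  finally show ?thesis .
qed

lemma borel_measurable_Hker [measurable]:
  assumes "\<epsilon> > 0"
  shows "(\<lambda>y. Hker \<epsilon> \<delta> k x y t) \<in> borel_measurable borel"
  unfolding Hker_eq[OF assms] set_lebesgue_integral_def by measurable

text \<open>Integrating in the order tangential variable, height, \<open>s\<close> gives 1, then
  \<open>s powr (- 1 / 2)\<close>, then \<open>2 * sqrt S\<close>. The bound is independent of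
  \<open>\<delta>\<close> and \<open>k\<close>, so the factor \<open>1 / \<delta>\<close> in
  \<open>Gker\<close> makes this term \<open>O(1 / k)\<close>.\<close>

lemma
  fixes \<phi> :: "('n::finite) pt \<Rightarrow> real"
  assumes m [measurable]: "(\<lambda>y. indicator half_space y * \<phi> y) \<in> borel_measurable borel"
    and M: "AE y in lborel. \<bar>indicator half_space y * \<phi> y\<bar> \<le> M" "0 \<le> M"
    and x: "0 \<le> snd x" and pos: "0 < \<epsilon>" "0 < \<delta>" "0 < k" "0 < t"
  shows integrable_Hker_mult: "integrable lborel (\<lambda>y. Hker \<epsilon> \<delta> k x y t * (indicator half_space y * \<phi> y))"
    and abs_integral_Hker_mult_le:
      "\<bar>\<integral>y. Hker \<epsilon> \<delta> k x y t * (indicator half_space y * \<phi> y) \<partial>lborel\<bar> \<le> M * (2 * \<epsilon> * sqrt (t / \<epsilon>))"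
proof -
  define S where "S = t / \<epsilon>"
  have S: "S > 0"
    using pos by (simp add: S_def)
  \<comment> \<open>The general ratio \<open>\<delta> / k\<close> plays the part of
    \<open>\<theta>\<close>.\<close>
  have tp: "0 \<le> t - \<epsilon> * s" "0 < s + k / \<delta> * (t - \<epsilon> * s)" if "s \<in> {0..S}" for s
    using pos_time_change[of \<epsilon> "\<delta> / k" t s] that pos by (auto simp: S_def mult.commute)
  define g where "g y s = indicator {0..S} s * (hk (fst x - fst y) (s + k / \<delta> * (t - \<epsilon> * s))
    * (indicator {0<..} (snd y) * hit (snd x + (t - \<epsilon> * s) / \<delta> + snd y) s))" for y s
  have gm [measurable]: "(\<lambda>(y, s). ennreal (g y s)) \<in> borel_measurable (lborel \<Otimes>\<^sub>M lborel)"
    unfolding g_def by measurable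
  have gm': "(\<lambda>s. ennreal (g y s)) \<in> borel_measurable lborel" for y
    unfolding g_def by measurable
  have "(\<integral>\<^sup>+y. ennreal \<bar>Hker \<epsilon> \<delta> k x y t * (indicator half_space y * \<phi> y)\<bar> \<partial>lborel)
     \<le> (\<integral>\<^sup>+y. ennreal (M * \<epsilon>) * (\<integral>\<^sup>+s. ennreal (g y s) \<partial>lborel) \<partial>lborel)"
  proof (rule nn_integral_mono_AE)
    show "AE y in lborel. ennreal \<bar>Hker \<epsilon> \<delta> k x y t * (indicator half_space y * \<phi> y)\<bar>
      \<le> ennreal (M * \<epsilon>) * (\<integral>\<^sup>+s. ennreal (g y s) \<partial>lborel)"
      using M(1)
    proof eventually_elim
      case (elim y)
      show ?case
      proof (cases "y \<in> half_space")
        case True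
        then have y: "snd y > 0"
          by (simp add: half_space_def)
        have g0: "0 \<le> g y s" for s
          unfolding g_def using tp(1)[of s] x y pos by (auto simp: indicator_def intro!: mult_nonneg_nonneg hit_nonneg)
        have H: "Hker \<epsilon> \<delta> k x y t = \<epsilon> * (\<integral>s. g y s \<partial>lborel)"
          unfolding Hker_eq[OF pos(1)] set_lebesgue_integral_def g_def S_def[symmetric]
          using y by (simp add: add_ac)
        have "\<bar>Hker \<epsilon> \<delta> k x y t * (indicator half_space y * \<phi> y)\<bar> = \<epsilon> * \<bar>\<integral>s. g y s \<partial>lborel\<bar> * \<bar>indicator half_space y * \<phi> y\<bar>"
          unfolding H using pos by (simp add: abs_mult)
        also have "\<dots> \<le> \<epsilon> * \<bar>\<integral>s. g y s \<partial>lborel\<bar> * M"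
          using elim pos by (intro mult_left_mono) auto
        also have "\<dots> = (M * \<epsilon>) * \<bar>\<integral>s. g y s \<partial>lborel\<bar>"
          by simp
        finally have "ennreal \<bar>Hker \<epsilon> \<delta> k x y t * (indicator half_space y * \<phi> y)\<bar> \<le> ennreal (M * \<epsilon>) * ennreal \<bar>\<integral>s. g y s \<partial>lborel\<bar>"
          using M(2) pos by (subst ennreal_mult[symmetric]) (auto intro: ennreal_leI)
        also have "\<dots> \<le> ennreal (M * \<epsilon>) * (\<integral>\<^sup>+s. ennreal \<bar>g y s\<bar> \<partial>lborel)"
          by (intro mult_left_mono ennreal_abs_integral_le) auto
        finally show ?thesis
          using g0 by simp
      qed simp
    qed
  qed
  also have "\<dots> = ennreal (M * \<epsilon>) * (\<integral>\<^sup>+y. (\<integral>\<^sup>+s. ennreal (g y s) \<partial>lborel) \<partial>lborel)"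
  proof (rule nn_integral_cmult)
    show "(\<lambda>y. \<integral>\<^sup>+s. ennreal (g y s) \<partial>lborel) \<in> borel_measurable lborel"
      using gm by (rule lborel.borel_measurable_nn_integral)
  qed
  also have "(\<integral>\<^sup>+y. (\<integral>\<^sup>+s. ennreal (g y s) \<partial>lborel) \<partial>lborel) = (\<integral>\<^sup>+s. (\<integral>\<^sup>+y. ennreal (g y s) \<partial>lborel) \<partial>lborel)"
    using lborel_pair.Fubini'[OF gm] by simp
  also have "\<dots> \<le> (\<integral>\<^sup>+s. ennreal (indicator {0..S} s * s powr (- 1 / 2)) \<partial>lborel)"
  proof (rule nn_integral_mono)
    fix s :: real
    show "(\<integral>\<^sup>+y. ennreal (g y s) \<partial>lborel) \<le> ennreal (indicator {0..S} s * s powr (- 1 / 2))"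
    proof (cases "s \<in> {0<..S}")
      case True
      then have s: "s \<in> {0..S}" "s > 0" by auto
      have "(\<integral>\<^sup>+y. ennreal (g y s) \<partial>lborel)
        = (\<integral>\<^sup>+y. ennreal (hk (fst x - fst y) (s + k / \<delta> * (t - \<epsilon> * s)))
          * ennreal (indicator {0<..} (snd y) * hit (snd x + (t - \<epsilon> * s) / \<delta> + snd y) s) \<partial>lborel)"
        unfolding g_def using s(1) by (simp add: ennreal_mult')
      also have "\<dots> = (\<integral>\<^sup>+z. ennreal (indicator {0<..} z * hit (snd x + (t - \<epsilon> * s) / \<delta> + z) s) \<partial>lborel)"
        by (rule nn_integral_pt_hk[of "\<lambda>z. ennreal (indicator {0<..} z * hit (snd x + (t - \<epsilon> * s) / \<delta> + z) s)"]) (use tp(2)[OF s(1)] in auto)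
      also have "\<dots> \<le> ennreal (s powr (- 1 / 2))"
        using s x pos tp(1)[OF s(1)] by (intro nn_integral_hit_shift) auto
      finally show ?thesis
        using s by simp
    next
      case False
      then have "g y s = 0" for y
        by (cases "s = 0") (auto simp: g_def indicator_def)
      then show ?thesis by simp
    qed
  qed
  also have "(\<integral>\<^sup>+s. ennreal (indicator {0..S} s * s powr (- 1 / 2)) \<partial>lborel) = ennreal (LINT s:{0..S}|lborel. s powr (- 1 / 2))"
    unfolding set_lebesgue_integral_def
    using set_integrable_powr_from_0[of "- 1 / 2" S] S
    by (subst nn_integral_eq_integral) (auto simp: set_integrable_def)
  also have "(LINT s:{0..S}|lborel. s powr (- 1 / 2)) = 2 * sqrt S"
    using set_integral_powr_from_0[of "- 1 / 2" S] S by (simp add: powr_half_sqrt)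
  also have "ennreal (M * \<epsilon>) * ennreal (2 * sqrt S) = ennreal (M * (2 * \<epsilon> * sqrt S))"
    using M(2) pos S by (simp add: mult_ac flip: ennreal_mult)
  finally have *: "(\<integral>\<^sup>+y. ennreal \<bar>Hker \<epsilon> \<delta> k x y t * (indicator half_space y * \<phi> y)\<bar> \<partial>lborel)
     \<le> ennreal (M * (2 * \<epsilon> * sqrt S))"
    by (simp add: mult_left_mono)
  have [measurable]: "(\<lambda>y. Hker \<epsilon> \<delta> k x y t) \<in> borel_measurable borel"
    using pos by (intro borel_measurable_Hker)
  show "integrable lborel (\<lambda>y. Hker \<epsilon> \<delta> k x y t * (indicator half_space y * \<phi> y))"
    using M(2) pos S by (intro integrable_of_nn_integral_abs_le[OF _ *]) auto
  show "\<bar>\<integral>y. Hker \<epsilon> \<delta> k x y t * (indicator half_space y * \<phi> y) \<partial>lborel\<bar> \<le> M * (2 * \<epsilon> * sqrt (t / \<epsilon>))"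
    using M(2) pos S unfolding S_def[symmetric] by (intro abs_integral_le_of_nn_integral[OF _ *]) auto
qed

lemma set_integral_powr_minus_half:
  assumes "S \<ge> 0"
  shows "set_integrable lborel {0..S} (\<lambda>s. s powr (- 1 / 2))"
    and "(LINT s:{0..S}|lborel. s powr (- 1 / 2)) = 2 * sqrt S"
  using set_integrable_powr_from_0[of "- 1 / 2" S] set_integral_powr_from_0[of "- 1 / 2" S] assms
  by (auto simp: powr_half_sqrt)

lemma powr_three_halves_mult:
  fixes s :: real
  assumes "s > 0"
  shows "s powr (- 3 / 2) * s = s powr (- 1 / 2)"
  using assms powr_mult_base[of s "- 3 / 2"] by (simp add: mult.commute)

text \<open>The shifted density does not converge in \<open>L\<^sup>1\<close> uniformly as \<open>\<xi>\<close> tends to 0, so the time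
  regularity of \<open>heat \<psi>\<close> is needed: both the varying shift and the varying datum are frozen at
  \<open>s = 0\<close>, and only the total mass of the density enters the remaining term.\<close>
lemma abs_set_integral_hit_shift_le:
  fixes \<psi> :: "real^'n::finite \<Rightarrow> real"
  assumes \<psi>: "\<psi> \<in> borel_measurable borel" "AE y in lborel. \<bar>\<psi> y\<bar> \<le> M" "0 \<le> M"
    and pos: "\<xi> > 0" "\<epsilon> > 0" "\<theta> > 0" "\<delta> > 0" "t > 0"
  shows "set_integrable lborel {0..t / \<epsilon>} (\<lambda>s. hit (\<xi> + (t - \<epsilon> * s) / \<delta>) s)" (is ?int)
    and "\<bar>(LINT s:{0..t / \<epsilon>}|lborel. hit (\<xi> + (t - \<epsilon> * s) / \<delta>) s * heat \<psi> x' (s + (t - \<epsilon> * s) / \<theta>))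
      - (LINT s:{0..t / \<epsilon>}|lborel. hit \<xi> s * heat \<psi> x' (s + (t - \<epsilon> * s) / \<theta>))\<bar>
      \<le> (3 * M * \<epsilon> + 4 * real CARD('n) * M * \<bar>\<theta> - \<epsilon>\<bar>) * sqrt (t / \<epsilon>) / \<delta>" (is ?le)
proof -
  define S where "S = t / \<epsilon>"
  define a where "a = t / \<delta>"
  define F where "F s = heat \<psi> x' (s + (t - \<epsilon> * s) / \<theta>)" for s
  define \<kappa> where "\<kappa> s = hit (\<xi> + (t - \<epsilon> * s) / \<delta>) s" for s
  have S: "S > 0" and a: "a > 0"
    using pos by (auto simp: S_def a_def)
  note tp = pos_time_change[OF \<open>\<epsilon> > 0\<close> \<open>\<theta> > 0\<close> \<open>t > 0\<close>, folded S_def]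
  have \<kappa>m [measurable]: "\<kappa> \<in> borel_measurable borel"
    unfolding \<kappa>_def by measurable
  have Fm [measurable]: "F \<in> borel_measurable borel"
    unfolding F_def using \<psi>(1) by measurable
  have FM: "\<bar>F s\<bar> \<le> M" if "s \<in> {0..S}" for s
    unfolding F_def using tp(2)[OF that] by (intro abs_heat_le[OF \<psi>]) auto
  have hi: "set_integrable lborel {0..S} (hit \<eta>)" if "\<eta> \<ge> 0" for \<eta>
    using that by (intro set_integrable_hit_subset) auto
  have ph: "set_integrable lborel {0..S} (\<lambda>s. c * s powr (- 1 / 2))" for c
    using S by (intro set_integrable_mult_right set_integral_powr_minus_half) auto
  \<comment> \<open>Freezing the shift \<open>(t - \<epsilon> * s) / \<delta>\<close> at its value
    \<open>a\<close> for \<open>s = 0\<close> changes the height by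
    \<open>\<epsilon> * s / \<delta>\<close>, and the factor \<open>s\<close> makes the Lipschitz
    bound integrable.\<close>
  have d1: "\<bar>\<kappa> s - hit (\<xi> + a) s\<bar> \<le> \<epsilon> / \<delta> * s powr (- 1 / 2)" if "s \<in> {0..S}" for s
  proof (cases "s = 0")
    case False
    then have s: "s > 0" using that by simp
    have "\<bar>\<kappa> s - hit (\<xi> + a) s\<bar> \<le> s powr (- 3 / 2) * \<bar>(\<xi> + (t - \<epsilon> * s) / \<delta>) - (\<xi> + a)\<bar>"
      unfolding \<kappa>_def by (rule hit_lipschitz[OF s])
    also have "(\<xi> + (t - \<epsilon> * s) / \<delta>) - (\<xi> + a) = - (\<epsilon> / \<delta> * s)"
      by (simp add: a_def diff_divide_distrib)
    also have "s powr (- 3 / 2) * \<bar>- (\<epsilon> / \<delta> * s)\<bar> = \<epsilon> / \<delta> * (s powr (- 3 / 2) * s)"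
      using s pos by simp
    finally show ?thesis
      using powr_three_halves_mult[OF s] by simp
  qed (simp add: \<kappa>_def)
  have \<kappa>i: "set_integrable lborel {0..S} \<kappa>"
  proof (rule set_integrable_dominated)
    show "set_integrable lborel {0..S} (\<lambda>s. \<epsilon> / \<delta> * s powr (- 1 / 2) + hit (\<xi> + a) s)"
      using pos a by (intro set_integral_add(1) ph hi) auto
    show "\<bar>\<kappa> s\<bar> \<le> \<epsilon> / \<delta> * s powr (- 1 / 2) + hit (\<xi> + a) s" if "s \<in> {0..S}" for s
      using d1[OF that] hit_nonneg[of "\<xi> + a" s] that pos a by auto
  qed auto
  then show ?int
    by (simp add: \<kappa>_def[abs_def] S_def)
  have iF: "set_integrable lborel {0..S} (\<lambda>s. \<nu> s * F s)"
    if "set_integrable lborel {0..S} \<nu>" "\<nu> \<in> borel_measurable borel" for \<nu>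
    unfolding F_def using that tp(2) \<psi>
    by (intro set_integrable_mult_heat_bounded[OF \<psi>]) (auto simp: less_imp_le)
  have 1: "\<bar>(LINT s:{0..S}|lborel. \<kappa> s * F s) - (LINT s:{0..S}|lborel. hit (\<xi> + a) s * F s)\<bar>
      \<le> (LINT s:{0..S}|lborel. M * (\<epsilon> / \<delta>) * s powr (- 1 / 2))"
  proof (rule abs_set_integral_diff_le[OF iF iF ph])
    fix s assume s: "s \<in> {0..S}"
    have "\<bar>\<kappa> s - hit (\<xi> + a) s\<bar> * \<bar>F s\<bar> \<le> (\<epsilon> / \<delta> * s powr (- 1 / 2)) * M"
      using d1[OF s] FM[OF s] pos by (intro mult_mono) auto
    then show "\<bar>\<kappa> s * F s - hit (\<xi> + a) s * F s\<bar> \<le> M * (\<epsilon> / \<delta>) * s powr (- 1 / 2)"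
      unfolding left_diff_distrib[symmetric] abs_mult by (simp only: mult_ac)
  qed (use \<kappa>i hi[of "\<xi> + a"] pos a in auto)
  define G where "G s = F s - F 0" for s
  have iG: "set_integrable lborel {0..S} (\<lambda>s. hit \<eta> s * G s)" if "\<eta> \<ge> 0" for \<eta>
  proof -
    have "set_integrable lborel {0..S} (\<lambda>s. hit \<eta> s * F s)"
      by (rule iF[OF hi[OF that]]) measurable
    moreover have "set_integrable lborel {0..S} (\<lambda>s. hit \<eta> s * F 0)"
      by (rule set_integrable_mult_left) (rule hi[OF that])
    ultimately show ?thesis
      unfolding G_def right_diff_distrib by (rule set_integral_diff(1))
  qed
  have split: "(LINT s:{0..S}|lborel. hit \<eta> s * F s)
      = (LINT s:{0..S}|lborel. hit \<eta> s * G s) + (LINT s:{0..S}|lborel. hit \<eta> s) * F 0" if "\<eta> \<ge> 0" for \<eta>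
  proof -
    have "(LINT s:{0..S}|lborel. hit \<eta> s * F s) = (LINT s:{0..S}|lborel. hit \<eta> s * G s + hit \<eta> s * F 0)"
      by (simp add: G_def right_diff_distrib)
    also have "\<dots> = (LINT s:{0..S}|lborel. hit \<eta> s * G s) + (LINT s:{0..S}|lborel. hit \<eta> s * F 0)"
      by (rule set_integral_add(2)[OF iG[OF that] set_integrable_mult_left[OF hi[OF that]]])
    finally show ?thesis
      by simp
  qed
  \<comment> \<open>From \<open>\<rho>(s) - \<rho>(0) = (\<theta> - \<epsilon>) / \<theta> *
    s\<close>, taken relative to \<open>\<rho>(0) = t / \<theta>\<close>.\<close>
  define D where "D = 2 * real CARD('n) * M * (\<bar>\<theta> - \<epsilon>\<bar> / t)"
  have D0: "0 \<le> D"
    using \<psi>(3) pos by (simp add: D_def)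
  have Gb: "\<bar>G s\<bar> \<le> D * s" if s: "s \<in> {0..S}" for s
  proof -
    have "\<bar>F s - F 0\<bar> \<le> 2 * DIM(real^'n) * M
        * (\<bar>(s + (t - \<epsilon> * s) / \<theta>) - (0 + (t - \<epsilon> * 0) / \<theta>)\<bar> / (t / \<theta>))"
      unfolding F_def using tp(2)[OF s] pos by (intro abs_heat_diff_le[OF \<psi>]) auto
    also have "(s + (t - \<epsilon> * s) / \<theta>) - (0 + (t - \<epsilon> * 0) / \<theta>) = (\<theta> - \<epsilon>) / \<theta> * s"
      using pos by (simp add: field_simps)
    also have "\<bar>(\<theta> - \<epsilon>) / \<theta> * s\<bar> / (t / \<theta>) = \<bar>\<theta> - \<epsilon>\<bar> / t * s"
      using pos s by (simp add: abs_mult)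
    finally show ?thesis
      by (simp add: G_def D_def)
  qed
  have 2: "\<bar>(LINT s:{0..S}|lborel. hit (\<xi> + a) s * G s) - (LINT s:{0..S}|lborel. hit \<xi> s * G s)\<bar>
      \<le> (LINT s:{0..S}|lborel. a * D * s powr (- 1 / 2))"
  proof (rule abs_set_integral_diff_le[OF iG iG ph])
    fix s assume s: "s \<in> {0..S}"
    show "\<bar>hit (\<xi> + a) s * G s - hit \<xi> s * G s\<bar> \<le> a * D * s powr (- 1 / 2)"
    proof (cases "s = 0")
      case False
      then have s0: "s > 0" using s by simp
      have "\<bar>hit (\<xi> + a) s - hit \<xi> s\<bar> * \<bar>G s\<bar> \<le> (s powr (- 3 / 2) * a) * (D * s)"
        using hit_lipschitz[OF s0, of "\<xi> + a" \<xi>] Gb[OF s] a by (intro mult_mono) auto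
      also have "\<dots> = a * D * (s powr (- 3 / 2) * s)"
        by simp
      finally show ?thesis
        using powr_three_halves_mult[OF s0] unfolding left_diff_distrib[symmetric] abs_mult by simp
    qed simp
  qed (use pos a in auto)
  have 3: "\<bar>(LINT s:{0..S}|lborel. hit (\<xi> + a) s) * F 0 - (LINT s:{0..S}|lborel. hit \<xi> s) * F 0\<bar> \<le> a / sqrt S * M"
    unfolding left_diff_distrib[symmetric] abs_mult
    using set_integral_hit_lipschitz[of \<xi> a S] FM[of 0] pos a S by (intro mult_mono) auto
  have "\<bar>(LINT s:{0..S}|lborel. \<kappa> s * F s) - (LINT s:{0..S}|lborel. hit \<xi> s * F s)\<bar>
      \<le> M * (\<epsilon> / \<delta>) * (2 * sqrt S) + a * D * (2 * sqrt S) + a / sqrt S * M"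
  proof -
    have h: "(LINT s:{0..S}|lborel. s powr (- 1 / 2)) = 2 * sqrt S"
      using S by (intro set_integral_powr_minus_half) simp
    have "0 \<le> \<xi> + a" "0 \<le> \<xi>"
      using pos a by auto
    then show ?thesis
      using 1[unfolded set_integral_mult_right h] 2[unfolded set_integral_mult_right h] 3
        split[of "\<xi> + a"] split[of \<xi>] by linarith
  qed
  \<comment> \<open>The mass term thus has the form of the freezing term, and the two add up to the
    coefficient \<open>3 * M * \<epsilon>\<close>.\<close>
  also have "a / sqrt S * M = M * (\<epsilon> / \<delta>) * sqrt S"
  proof -
    have "a / sqrt S = \<epsilon> / \<delta> * (S / sqrt S)"
      using pos by (simp add: a_def S_def)
    then show ?thesis
      using S by (simp add: real_div_sqrt)
  qed
  also have "a * D * (2 * sqrt S) = 4 * real CARD('n) * M * \<bar>\<theta> - \<epsilon>\<bar> * sqrt S / \<delta>"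
    using pos by (simp add: a_def D_def)
  also have "M * (\<epsilon> / \<delta>) * (2 * sqrt S) + 4 * real CARD('n) * M * \<bar>\<theta> - \<epsilon>\<bar> * sqrt S / \<delta> + M * (\<epsilon> / \<delta>) * sqrt S
      = (3 * M * \<epsilon> + 4 * real CARD('n) * M * \<bar>\<theta> - \<epsilon>\<bar>) * sqrt S / \<delta>"
    by (simp add: add_divide_distrib distrib_right)
  finally show ?le
    by (simp add: \<kappa>_def F_def S_def)
qed

text \<open>The choice \<open>\<delta> = k * \<theta>\<close> makes the tangential times of
  \<open>u_sol\<close> and \<open>w_sol\<close> coincide. What differs is the shift of the height by
  \<open>(t - \<epsilon> * s) / \<delta>\<close> and the action of \<open>Hker\<close> on
  \<open>\<phi>\<close>, both of order \<open>1 / \<delta>\<close>.\<close>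

proposition u_sol_minus_w_sol_bound:
  fixes \<phi> :: "('n::finite) pt \<Rightarrow> real"
  assumes "Linf_half \<phi>" "Linf_bd \<psi>" "\<epsilon> > 0" "\<theta> > 0" "T > 0"
  shows "\<exists>C. \<forall>k>0. \<forall>x t. x \<in> half_space \<and> 0 < t \<and> t < T \<longrightarrow>
    \<bar>u_sol \<epsilon> (k * \<theta>) k \<phi> \<psi> x t - w_sol \<epsilon> \<theta> \<phi> \<psi> x t\<bar> \<le> C * (1 / k)"
proof -
  obtain M where M: "0 \<le> M" and \<psi>: "\<psi> \<in> borel_measurable borel" "AE y in lborel. \<bar>\<psi> y\<bar> \<le> M" "0 \<le> M"
    using Linf_bdE[OF assms(2)] by metis
  obtain M1 where M1: "0 \<le> M1" and \<phi>: "(\<lambda>y. indicator half_space y * \<phi> y) \<in> borel_measurable borel"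
    "AE y in lborel. \<bar>indicator half_space y * \<phi> y\<bar> \<le> M1"
    using Linf_halfE[OF assms(1)] by metis
  define A where "A = M1 * (2 * \<epsilon>) + (3 * M * \<epsilon> + 4 * real CARD('n) * M * \<bar>\<theta> - \<epsilon>\<bar>)"
  have A: "0 \<le> A"
    using M M1 assms by (simp add: A_def)
  have "\<bar>u_sol \<epsilon> (k * \<theta>) k \<phi> \<psi> x t - w_sol \<epsilon> \<theta> \<phi> \<psi> x t\<bar> \<le> A * sqrt (T / \<epsilon>) / \<theta> * (1 / k)"
    if k: "k > 0" and x: "x \<in> half_space" and t: "0 < t" "t < T" for k x t
  proof -
    define \<delta> where "\<delta> = k * \<theta>"
    have \<delta>: "\<delta> > 0" and kd: "k / \<delta> = 1 / \<theta>" and x0: "snd x > 0"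
      using k x assms by (auto simp: \<delta>_def half_space_def)
    define I where "I = (\<integral>y. Hker \<epsilon> \<delta> k x y t * (indicator half_space y * \<phi> y) \<partial>lborel)"
    define J where "J = (LINT s:{0..t / \<epsilon>}|lborel. hit (snd x + (t - \<epsilon> * s) / \<delta>) s * heat \<psi> (fst x) (s + (t - \<epsilon> * s) / \<theta>))"
    have "(\<integral>y\<in>half_space. Gker \<epsilon> \<delta> k x y t * \<phi> y \<partial>lborel)
      = (\<integral>y. G0 x y (t / \<epsilon>) * (indicator half_space y * \<phi> y) + Hker \<epsilon> \<delta> k x y t * (indicator half_space y * \<phi> y) / \<delta> \<partial>lborel)"
      by (simp add: set_lebesgue_integral_def Gker_def algebra_simps)
    also have "\<dots> = zD \<epsilon> \<phi> x t + I / \<delta>"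
      unfolding zD_eq I_def using x0 assms \<delta> k t
      by (subst Bochner_Integration.integral_add)
        (auto intro!: integrable_G0_mult[OF \<phi> M1] Bochner_Integration.integrable_divide integrable_Hker_mult[OF \<phi> M1])
    finally have u1: "(\<integral>y\<in>half_space. Gker \<epsilon> \<delta> k x y t * \<phi> y \<partial>lborel) = zD \<epsilon> \<phi> x t + I / \<delta>" .
    have "\<delta> / \<epsilon> * (\<integral>y'. Gker \<epsilon> \<delta> k x (y', 0) t * \<psi> y' \<partial>lborel)
      = (\<integral>y'. (LINT s:{0..t / \<epsilon>}|lborel. hk (fst x - y') (s + (t - \<epsilon> * s) / \<theta>) * hit (snd x + (t - \<epsilon> * s) / \<delta>) s) * \<psi> y' \<partial>lborel)"
      unfolding integral_mult_right_zero[symmetric]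
    proof (intro Bochner_Integration.integral_cong refl)
      fix y'
      \<comment> \<open>A boundary point is its own reflection, so only \<open>Hker\<close> acts on
        \<open>\<psi>\<close>; the factors \<open>\<delta> / \<epsilon>\<close> and
        \<open>1 / \<delta>\<close> combine to \<open>1 / \<epsilon>\<close>.\<close>
      have "G0 x (y', 0) (t / \<epsilon>) = 0"
        by (simp add: G0_def refl_pt_def)
      then show "\<delta> / \<epsilon> * (Gker \<epsilon> \<delta> k x (y', 0) t * \<psi> y')
        = (LINT s:{0..t / \<epsilon>}|lborel. hk (fst x - y') (s + (t - \<epsilon> * s) / \<theta>) * hit (snd x + (t - \<epsilon> * s) / \<delta>) s) * \<psi> y'"
        using assms \<delta> by (simp add: Gker_def Hker_eq kd)
    qed
    also have "\<dots> = J"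
      unfolding J_def
    proof (rule integral_set_integral_hk_mult_bounded[OF \<psi>])
      show "0 \<le> s + (t - \<epsilon> * s) / \<theta>" if "s \<in> {0..t / \<epsilon>}" for s
        using pos_time_change(2)[OF \<open>\<epsilon> > 0\<close> \<open>\<theta> > 0\<close> t(1) that] by simp
    qed (use abs_set_integral_hit_shift_le(1)[OF \<psi> x0 \<open>\<epsilon> > 0\<close> \<open>\<theta> > 0\<close> \<delta> t(1)] in auto)
    finally have u2: "\<delta> / \<epsilon> * (\<integral>y'. Gker \<epsilon> \<delta> k x (y', 0) t * \<psi> y' \<partial>lborel) = J" .
    have "u_sol \<epsilon> \<delta> k \<phi> \<psi> x t - w_sol \<epsilon> \<theta> \<phi> \<psi> x t = I / \<delta>
      + (J - (LINT s:{0..t / \<epsilon>}|lborel. hit (snd x) s * heat \<psi> (fst x) (s + (t - \<epsilon> * s) / \<theta>)))"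
      using w_sol_minus_zD_bounded[OF \<psi> \<open>\<epsilon> > 0\<close> \<open>\<theta> > 0\<close> t(1), of x \<phi>] x0
      unfolding u_sol_def u1 u2 by simp
    also have "\<bar>\<dots>\<bar> \<le> \<bar>I / \<delta>\<bar>
      + \<bar>J - (LINT s:{0..t / \<epsilon>}|lborel. hit (snd x) s * heat \<psi> (fst x) (s + (t - \<epsilon> * s) / \<theta>))\<bar>"
      by (rule abs_triangle_ineq)
    also have "\<dots> \<le> M1 * (2 * \<epsilon> * sqrt (t / \<epsilon>)) / \<delta> + (3 * M * \<epsilon> + 4 * real CARD('n) * M * \<bar>\<theta> - \<epsilon>\<bar>) * sqrt (t / \<epsilon>) / \<delta>"
    proof (rule add_mono)
      have "\<bar>I\<bar> \<le> M1 * (2 * \<epsilon> * sqrt (t / \<epsilon>))"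
        unfolding I_def using x0 assms \<delta> k t by (intro abs_integral_Hker_mult_le[OF \<phi> M1]) auto
      then show "\<bar>I / \<delta>\<bar> \<le> M1 * (2 * \<epsilon> * sqrt (t / \<epsilon>)) / \<delta>"
        using \<delta> by (simp add: divide_right_mono)
    qed (unfold J_def, rule abs_set_integral_hit_shift_le(2)[OF \<psi> x0 \<open>\<epsilon> > 0\<close> \<open>\<theta> > 0\<close> \<delta> t(1)])
    also have "\<dots> = A * sqrt (t / \<epsilon>) / \<delta>"
      unfolding A_def add_divide_distrib[symmetric] by (simp only: distrib_right mult.assoc)
    also have "\<dots> \<le> A * sqrt (T / \<epsilon>) / \<delta>"
      using A \<delta> t assms by (intro divide_right_mono mult_left_mono) (auto simp: divide_right_mono)
    finally show ?thesis
      by (simp add: \<delta>_def mult.commute)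
  qed
  then show ?thesis
    by blast
qed

subsection \<open>The limit in part 2\<close>

text \<open>The bound \<open>\<bar>\<psi>\<bar> \<le> l + l^(1-p) \<bar>\<psi>\<bar>^p\<close>, used with \<open>l = r^(-d/(2p))\<close>, stands in for Hoelder's inequality.\<close>
lemma
  fixes \<psi> :: "'a::euclidean_space \<Rightarrow> real"
  assumes [measurable]: "\<psi> \<in> borel_measurable borel" and i: "integrable lborel (\<lambda>y. \<bar>\<psi> y\<bar> powr p)"
    and p: "1 \<le> p" and r: "r > 0"
  shows integrable_hk_mult_Lp: "integrable lborel (\<lambda>y. hk (x - y) r * \<psi> y)"
    and integral_hk_mult_Lp_le: "(\<integral>y. hk (x - y) r * \<bar>\<psi> y\<bar> \<partial>lborel)
      \<le> (1 + (\<integral>y. \<bar>\<psi> y\<bar> powr p \<partial>lborel)) * r powr (- (real DIM('a) / (2 * p)))"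
proof -
  define l where "l = r powr (- (real DIM('a) / (2 * p)))"
  have l: "l > 0"
    using r by (simp add: l_def)
  \<comment> \<open>With this choice \<open>l powr p\<close> bounds the kernel pointwise, so the
    parts with small and with large \<open>\<psi>\<close> both carry the same factor
    \<open>l\<close>.\<close>
  have lp: "l powr p = r powr (- (real DIM('a) / 2))"
    using p by (simp add: l_def powr_powr)
  have hl: "hk z r \<le> l powr p" for z :: 'a
  proof -
    have "hk z r \<le> (4 * pi * r) powr (- real DIM('a) / 2)"
      by (rule hk_le[OF r])
    also have "\<dots> \<le> r powr (- real DIM('a) / 2)"
      using r pi_gt3 by (intro powr_mono2') auto
    finally show ?thesis
      by (simp add: lp)
  qed
  have b: "hk (x - y) r * \<bar>\<psi> y\<bar> \<le> l * hk (x - y) r + l * \<bar>\<psi> y\<bar> powr p" for y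
  proof (cases "\<bar>\<psi> y\<bar> \<le> l")
    case True
    then have "hk (x - y) r * \<bar>\<psi> y\<bar> \<le> hk (x - y) r * l"
      by (intro mult_left_mono) auto
    moreover have "0 \<le> l * \<bar>\<psi> y\<bar> powr p"
      using l by simp
    ultimately show ?thesis
      by (simp add: mult.commute)
  next
    case False
    then have "l powr (p - 1) \<le> \<bar>\<psi> y\<bar> powr (p - 1)"
      using l p by (intro powr_mono2) auto
    then have "l powr (p - 1) * \<bar>\<psi> y\<bar> \<le> \<bar>\<psi> y\<bar> powr (p - 1) * \<bar>\<psi> y\<bar>"
      by (intro mult_right_mono) auto
    also have "\<dots> = \<bar>\<psi> y\<bar> powr p"
      using powr_mult_base[of "\<bar>\<psi> y\<bar>" "p - 1"] by (simp add: mult.commute)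
    finally have "l * (l powr (p - 1) * \<bar>\<psi> y\<bar>) \<le> l * \<bar>\<psi> y\<bar> powr p"
      using l by (intro mult_left_mono) auto
    then have "l powr p * \<bar>\<psi> y\<bar> \<le> l * \<bar>\<psi> y\<bar> powr p"
      using powr_mult_base[of l "p - 1"] l by (simp flip: mult.assoc)
    moreover have "hk (x - y) r * \<bar>\<psi> y\<bar> \<le> l powr p * \<bar>\<psi> y\<bar>"
      using hl by (intro mult_right_mono) auto
    moreover have "0 \<le> l * hk (x - y) r"
      using l by simp
    ultimately show ?thesis
      by linarith
  qed
  have i1: "integrable lborel (\<lambda>y. l * hk (x - y) r + l * \<bar>\<psi> y\<bar> powr p)"
    using i r by (intro Bochner_Integration.integrable_add integrable_mult_right integrable_hk_diff)
  show i2: "integrable lborel (\<lambda>y. hk (x - y) r * \<psi> y)"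
    by (rule Bochner_Integration.integrable_bound[OF i1]) (use b in \<open>auto simp: abs_mult intro!: order_trans[OF b]\<close>)
  have "(\<integral>y. hk (x - y) r * \<bar>\<psi> y\<bar> \<partial>lborel) \<le> (\<integral>y. l * hk (x - y) r + l * \<bar>\<psi> y\<bar> powr p \<partial>lborel)"
    using b i1 integrable_abs[OF i2] by (intro integral_mono) (auto simp: abs_mult)
  also have "\<dots> = l * 1 + l * (\<integral>y. \<bar>\<psi> y\<bar> powr p \<partial>lborel)"
    using i r by (subst Bochner_Integration.integral_add) (auto simp: integral_hk_diff integrable_hk_diff)
  finally show "(\<integral>y. hk (x - y) r * \<bar>\<psi> y\<bar> \<partial>lborel)
      \<le> (1 + (\<integral>y. \<bar>\<psi> y\<bar> powr p \<partial>lborel)) * r powr (- (real DIM('a) / (2 * p)))"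
    by (simp add: l_def algebra_simps)
qed

text \<open>Away from the corner either \<open>S \<ge> R / (2 * \<epsilon>)\<close>, where
  \<open>S powr a\<close> is bounded below and the mass bound and \<open>1 / s\<close> suffice, or
  \<open>\<xi> \<ge> R / 2\<close>, where \<open>hit_le_powr\<close> with \<open>b = a\<close>
  applies. The power \<open>S powr a\<close> is the one that cancels the decay of the heat flow of
  \<open>L^p\<close> data.\<close>

lemma hit_bounds_away_from_corner:
  fixes a \<epsilon> R :: real
  assumes a: "a > 0" and pos: "\<epsilon> > 0" "R > 0"
  shows "\<exists>C\<ge>0. \<forall>\<xi>>0. \<forall>S>0. \<xi> + \<epsilon> * S > R \<longrightarrow>
    (LINT s:{0..S}|lborel. hit \<xi> s) \<le> C * S powr a \<and> (\<forall>s\<in>{S / 2..S}. hit \<xi> s \<le> C * S powr (a - 1))"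
proof -
  define S0 where "S0 = R / (2 * \<epsilon>)"
  define K where "K = (a + 1 / 2) powr (a + 1 / 2) * ((R / 2)\<^sup>2 / 4) powr (- a)"
  \<comment> \<open>\<open>K / a\<close> is the integral of \<open>K * s powr (a - 1)\<close>
    relative to \<open>S powr a\<close>; the factors 2 come from \<open>s \<ge> S / 2\<close> in the
    pointwise bounds.\<close>
  define C where "C = 2 * S0 powr (- a) + K / a + 2 * K"
  have S0: "S0 > 0" and K: "K \<ge> 0"
    using pos by (auto simp: S0_def K_def)
  have C: "0 \<le> C" "S0 powr (- a) \<le> C" "2 * S0 powr (- a) \<le> C" "K / a \<le> C" "2 * K \<le> C"
    using K a by (auto simp: C_def)
  have "(LINT s:{0..S}|lborel. hit \<xi> s) \<le> C * S powr a \<and> (\<forall>s\<in>{S / 2..S}. hit \<xi> s \<le> C * S powr (a - 1))"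
    if \<xi>: "\<xi> > 0" and S: "S > 0" and R: "\<xi> + \<epsilon> * S > R" for \<xi> S
  proof (cases "S \<ge> S0")
    case True
    have SS: "1 \<le> S0 powr (- a) * S powr a"
      using True S0 S a by (simp add: powr_minus field_simps powr_mono2)
    have "(LINT s:{0..S}|lborel. hit \<xi> s) \<le> 1"
      using \<xi> by (intro set_integral_hit_le_1) auto
    also have "1 \<le> S0 powr (- a) * S powr a"
      by (rule SS)
    also have "\<dots> \<le> C * S powr a"
      using C by (intro mult_right_mono) auto
    moreover have "hit \<xi> s \<le> C * S powr (a - 1)" if "s \<in> {S / 2..S}" for s
    proof -
      have "hit \<xi> s \<le> 1 / s"
        using \<xi> that S by (intro hit_le_inverse) auto
      also have "\<dots> \<le> 1 / (S / 2)"
        using that S by (intro divide_left_mono) auto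
      also have "\<dots> = 2 * 1 / S"
        by simp
      also have "\<dots> \<le> 2 * (S0 powr (- a) * S powr a) / S"
        using SS S by (intro divide_right_mono mult_left_mono) auto
      also have "\<dots> = 2 * S0 powr (- a) * S powr (a - 1)"
        using S by (simp add: powr_diff)
      also have "\<dots> \<le> C * S powr (a - 1)"
        using C by (intro mult_right_mono) auto
      finally show ?thesis .
    qed
    ultimately show ?thesis by auto
  next
    case False
    then have "\<epsilon> * S < R / 2"
      using pos by (simp add: S0_def field_simps)
    then have \<xi>R: "R / 2 \<le> \<xi>"
      using R by linarith
    have h: "hit \<xi> s \<le> K * s powr (a - 1)" if "s \<ge> 0" for s
    proof (cases "s = 0")
      case False
      then have s: "s > 0" using that by simp
      have "hit \<xi> s \<le> (a + 1 / 2) powr (a + 1 / 2) * (\<xi>\<^sup>2 / 4) powr (- a) * s powr (a - 1)"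
        using \<xi> a s by (intro hit_le_powr) auto
      also have "\<dots> \<le> K * s powr (a - 1)"
        unfolding K_def using \<xi>R pos a
        by (intro mult_right_mono mult_left_mono powr_mono2' divide_right_mono power_mono) auto
      finally show ?thesis .
    qed (use K in simp)
    have pi: "set_integrable lborel {0..S} (\<lambda>s. K * s powr (a - 1))"
      using a S by (intro set_integrable_mult_right set_integrable_powr_from_0) auto
    have "(LINT s:{0..S}|lborel. hit \<xi> s) \<le> (LINT s:{0..S}|lborel. K * s powr (a - 1))"
      using \<xi> h by (intro set_integral_mono pi set_integrable_hit_subset) auto
    also have "\<dots> = K / a * S powr a"
      using set_integral_powr_from_0[of "a - 1" S] a S by simp
    also have "\<dots> \<le> C * S powr a"
      using C by (intro mult_right_mono) auto
    moreover have "hit \<xi> s \<le> C * S powr (a - 1)" if s: "s \<in> {S / 2..S}" for s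
    proof -
      have s0: "s > 0" using s S by simp
      have "s powr (a - 1) = s powr a * (1 / s)"
        using s0 by (simp add: powr_diff)
      also have "\<dots> \<le> S powr a * (1 / (S / 2))"
        using s s0 S a by (intro mult_mono powr_mono2 divide_left_mono) auto
      also have "\<dots> = 2 * S powr (a - 1)"
        using S by (simp add: powr_diff)
      finally have "K * s powr (a - 1) \<le> K * (2 * S powr (a - 1))"
        using K by (intro mult_left_mono)
      also have "\<dots> \<le> C * S powr (a - 1)"
        using mult_right_mono[OF C(5), of "S powr (a - 1)"] by (simp add: mult_ac)
      finally show ?thesis
        using h[of s] s0 by simp
    qed
    ultimately show ?thesis by auto
  qed
  then show ?thesis
    using C(1) by blast
qed

text \<open>The size in \<open>l\<close> of the integral of
  \<open>(S / 2 + l * (S - s)) powr (- a)\<close> over \<open>{S / 2..S}\<close>, once its power of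
  \<open>S\<close> is removed. For \<open>a = 1\<close> the integral is exactly
  \<open>ln (1 + l) / l\<close>.\<close>

definition decay_rate :: "real \<Rightarrow> real \<Rightarrow> real" where
  "decay_rate a l = (if a < 1 then l powr (- a) else if a = 1 then ln (1 + l) / l else 1 / l)"

text \<open>The base \<open>q\<close> falls from \<open>(1 + l) * (S / 2)\<close> to
  \<open>S / 2\<close>, and the antiderivative is explicit. For \<open>a < 1\<close> the end
  \<open>s = S / 2\<close> dominates, for \<open>a > 1\<close> the end \<open>s = S\<close>; for
  \<open>a = 1\<close> the logarithm of the ratio \<open>1 + l\<close> remains.\<close>

lemma set_integral_affine_powr_le:
  fixes a l S :: real
  assumes a: "a > 0" and l: "l \<ge> 1" and S: "S > 0"
  shows "(LINT s:{S / 2..S}|lborel. (S / 2 + l * (S - s)) powr (- a))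
    \<le> (if a = 1 then 1 else 2 powr a / \<bar>1 - a\<bar>) * decay_rate a l * S powr (1 - a)"
proof -
  define q where "q s = S / 2 + l * (S - s)" for s
  have q: "q s > 0" if "s \<le> S" for s
    using that l S by (auto simp: q_def intro!: add_pos_nonneg)
  have qe: "q S = S / 2" "q (S / 2) = (1 + l) * (S / 2)"
    by (simp_all add: q_def algebra_simps)
  have dq: "(q has_real_derivative - l) (at s within A)" for s A
    unfolding q_def by (auto intro!: derivative_eq_intros)
  have m: "(\<lambda>s. q s powr (- a)) \<in> borel_measurable borel"
    unfolding q_def by measurable
  have I: "(LINT s:{S / 2..S}|lborel. q s powr (- a)) = F S - F (S / 2)"
    if "\<And>s. s \<le> S \<Longrightarrow> (F has_real_derivative q s powr (- a)) (at s within {S / 2..S})" for F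
  proof (rule set_integral_of_has_integral[OF m])
    show "((\<lambda>s. q s powr (- a)) has_integral (F S - F (S / 2))) {S / 2..S}"
      using S that by (intro fundamental_theorem_of_calculus)
        (auto simp flip: has_real_derivative_iff_has_vector_derivative)
  qed auto
  show ?thesis
  proof (cases "a = 1")
    case True
    have "(LINT s:{S / 2..S}|lborel. q s powr (- a)) = - ln (q S) / l - - ln (q (S / 2)) / l"
    proof (rule I)
      fix s assume "s \<le> S"
      then show "((\<lambda>s. - ln (q s) / l) has_real_derivative q s powr (- a)) (at s within {S / 2..S})"
        using q[of s] l True by (auto intro!: derivative_eq_intros dq simp: powr_minus_divide)
    qed
    also have "\<dots> = ln (1 + l) / l"
    proof -
      have "ln ((1 + l) * (S / 2)) = ln (1 + l) + ln (S / 2)"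
        using S l by (intro ln_mult_pos) auto
      then show ?thesis
        unfolding qe by (simp only: add_divide_distrib) (simp add: diff_divide_distrib add_divide_distrib)
    qed
    finally show ?thesis
      using True S by (simp add: q_def decay_rate_def)
  next
    case False
    have "(LINT s:{S / 2..S}|lborel. q s powr (- a))
      = - (q S powr (1 - a)) / (l * (1 - a)) - - (q (S / 2) powr (1 - a)) / (l * (1 - a))"
    proof (rule I)
      fix s assume "s \<le> S"
      then show "((\<lambda>s. - (q s powr (1 - a)) / (l * (1 - a))) has_real_derivative q s powr (- a)) (at s within {S / 2..S})"
      proof -
        have "((\<lambda>s. q s powr (1 - a)) has_real_derivative (1 - a) * q s powr (1 - a - 1) * (- l)) (at s within {S / 2..S})"
          using q[OF \<open>s \<le> S\<close>] by (intro DERIV_chain2[OF has_real_derivative_powr dq])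
        from DERIV_cdivide[OF DERIV_minus[OF this], of "l * (1 - a)"] show ?thesis
          using l False by simp
      qed
    qed
    also have "\<dots> = (((1 + l) * (S / 2)) powr (1 - a) - (S / 2) powr (1 - a)) / (l * (1 - a))"
      unfolding qe by (simp add: diff_divide_distrib)
    also have "\<dots> \<le> 2 powr a / \<bar>1 - a\<bar> * decay_rate a l * S powr (1 - a)"
    proof (cases "a < 1")
      case True
      have "((1 + l) * (S / 2)) powr (1 - a) - (S / 2) powr (1 - a) \<le> (l * S) powr (1 - a)"
      proof -
        \<comment> \<open>Uses \<open>1 + l \<le> 2 * l\<close>.\<close>
        have "((1 + l) * (S / 2)) powr (1 - a) \<le> (l * S) powr (1 - a)"
          using True l S by (intro powr_mono2) auto
        then show ?thesis
          using powr_ge_zero[of "S / 2" "1 - a"] by linarith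
      qed
      then have "(((1 + l) * (S / 2)) powr (1 - a) - (S / 2) powr (1 - a)) / (l * (1 - a)) \<le> (l * S) powr (1 - a) / (l * (1 - a))"
        using True l by (intro divide_right_mono) auto
      also have "\<dots> = 1 / (1 - a) * (l powr (- a) * S powr (1 - a))"
        using l S True by (simp add: powr_mult powr_diff powr_minus_divide)
      also have "\<dots> \<le> 2 powr a / (1 - a) * (l powr (- a) * S powr (1 - a))"
        using True a by (intro mult_right_mono divide_right_mono ge_one_powr_ge_zero) auto
      finally show ?thesis
        using True by (simp add: decay_rate_def mult.assoc)
    next
      case False
      with \<open>a \<noteq> 1\<close> have a1: "a > 1" by simp
      have "(((1 + l) * (S / 2)) powr (1 - a) - (S / 2) powr (1 - a)) / (l * (1 - a))
        = ((S / 2) powr (1 - a) - ((1 + l) * (S / 2)) powr (1 - a)) / (l * (a - 1))"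
      proof -
        have "(X - Y) / (l * (1 - a)) = (Y - X) / (l * (a - 1))" for X Y
          using a1 l by (simp add: divide_simps) (simp add: algebra_simps)
        then show ?thesis .
      qed
      also have "\<dots> \<le> (S / 2) powr (1 - a) / (l * (a - 1))"
        using a1 l by (intro divide_right_mono) auto
      also have "(S / 2) powr (1 - a) / (l * (a - 1)) = 2 powr (a - 1) * S powr (1 - a) / (l * (a - 1))"
        using powr_divide[of S 2 "1 - a"] powr_minus_divide[of 2 "1 - a"] by simp
      also have "2 powr (a - 1) * S powr (1 - a) / (l * (a - 1)) \<le> 2 powr a * S powr (1 - a) / (l * (a - 1))"
        using a1 l by (intro divide_right_mono mult_right_mono) auto
      finally show ?thesis
        using a1 by (simp add: decay_rate_def mult.commute)
    qed
    finally show ?thesis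
      using False by (simp add: q_def)
  qed
qed

text \<open>\<open>l \<ge> 3\<close> makes \<open>1 + l\<close> exceed Euler's number, so that the
  logarithm in the borderline case is at least 1. This is the origin of the condition
  \<open>\<theta> \<le> \<epsilon> / 3\<close> below.\<close>

lemma powr_minus_le_decay_rate:
  assumes "a > 0" "l \<ge> 3"
  shows "l powr (- a) \<le> decay_rate a l"
proof -
  have "1 \<le> ln (1 + l)"
    using assms exp_le by (subst ln_ge_iff) auto
  then have "1 / l \<le> ln (1 + l) / l"
    using assms by (intro divide_right_mono) auto
  moreover have "l powr (- a) \<le> l powr (- 1)" if "a \<ge> 1"
    using that assms by (intro powr_mono) auto
  ultimately show ?thesis
    using assms by (auto simp: decay_rate_def powr_minus_divide)
qed

lemma decay_rate_nonneg: "l \<ge> 1 \<Longrightarrow> 0 \<le> decay_rate a l"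
  by (simp add: decay_rate_def)

text \<open>The time integral is split at \<open>S / 2\<close>. Before it \<open>\<rho>\<close> is
  at least \<open>l * S / 2\<close> and only the mass of \<open>hit\<close> enters; after it
  \<open>\<rho>\<close> may drop to \<open>S\<close>, so the pointwise bound on \<open>hit\<close>
  is integrated against the affine power. In both halves the powers of \<open>S\<close> cancel,
  which makes the bound uniform on \<open>Q(R)\<close>.\<close>

proposition w_sol_minus_zD_bound:
  fixes \<phi> :: "('n::finite) pt \<Rightarrow> real" and p :: real
  assumes p: "1 \<le> p" and \<psi>: "Lp_bd p \<psi>" and pos: "\<epsilon> > 0" "R > 0"
  defines "a \<equiv> real CARD('n) / (2 * p)"
  shows "\<exists>C\<ge>0. \<forall>\<theta>. 0 < \<theta> \<and> \<theta> \<le> \<epsilon> / 3 \<longrightarrow> (\<forall>x t. x \<in> half_space_cl \<and> 0 < t \<and> snd x + t > R \<longrightarrow>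
    \<bar>w_sol \<epsilon> \<theta> \<phi> \<psi> x t - zD \<epsilon> \<phi> x t\<bar> \<le> C * decay_rate a (\<epsilon> / \<theta>))"
proof -
  have m [measurable]: "\<psi> \<in> borel_measurable borel" and i: "integrable lborel (\<lambda>y. \<bar>\<psi> y\<bar> powr p)"
    using \<psi> by (auto simp: Lp_bd_def)
  define A where "A = 1 + (\<integral>y. \<bar>\<psi> y\<bar> powr p \<partial>lborel)"
  have A: "0 \<le> A"
    by (simp add: A_def)
  have a: "a > 0"
    using p by (simp add: a_def)
  obtain C where C: "C \<ge> 0" "\<And>\<xi> S. \<xi> > 0 \<Longrightarrow> S > 0 \<Longrightarrow> \<xi> + \<epsilon> * S > R \<Longrightarrow>
    (LINT s:{0..S}|lborel. hit \<xi> s) \<le> C * S powr a \<and> (\<forall>s\<in>{S / 2..S}. hit \<xi> s \<le> C * S powr (a - 1))"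
    using hit_bounds_away_from_corner[OF a pos] by blast
  define c where "c = (if a = 1 then 1 else 2 powr a / \<bar>1 - a\<bar>)"
  have c: "0 \<le> c"
    by (simp add: c_def)
  have heat_le: "\<bar>heat \<psi> x' r\<bar> \<le> A * r powr (- a)" if "r > 0" for x' r
  proof -
    have "\<bar>heat \<psi> x' r\<bar> \<le> (\<integral>y. \<bar>hk (x' - y) r * \<psi> y\<bar> \<partial>lborel)"
      unfolding heat_def by (rule integral_abs_bound)
    then show ?thesis
      using integral_hk_mult_Lp_le[OF m i p that, of x'] by (simp add: abs_mult A_def a_def)
  qed
  have "\<bar>w_sol \<epsilon> \<theta> \<phi> \<psi> x t - zD \<epsilon> \<phi> x t\<bar> \<le> A * C * (2 powr a + c) * decay_rate a (\<epsilon> / \<theta>)"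
    if \<theta>: "0 < \<theta>" "\<theta> \<le> \<epsilon> / 3" and x: "x \<in> half_space_cl" and t: "0 < t" and R: "snd x + t > R" for \<theta> x t
  proof -
    define S where "S = t / \<epsilon>"
    define l where "l = \<epsilon> / \<theta>"
    define \<rho> where "\<rho> s = s + (t - \<epsilon> * s) / \<theta>" for s
    have S: "S > 0" and l: "l \<ge> 3" and x0: "snd x \<ge> 0"
      using t \<theta> pos x by (auto simp: S_def l_def half_space_cl_def field_simps)
    have \<rho>: "\<rho> s = s + l * (S - s)" for s
      using pos \<theta> by (simp add: \<rho>_def l_def S_def field_simps)
    \<comment> \<open>Since \<open>l \<ge> 1\<close>, the time \<open>\<rho>\<close> decreases to
      its final value \<open>S\<close>; this provides the uniform bound that Fubini
      requires.\<close>
    have \<rho>S: "S \<le> \<rho> s" if "s \<in> {0..S}" for s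
    proof -
      have "1 * (S - s) \<le> l * (S - s)"
        using that l by (intro mult_right_mono) auto
      then show ?thesis
        by (simp add: \<rho>)
    qed
    have d0: "0 \<le> decay_rate a l"
      using l by (intro decay_rate_nonneg) auto
    have w: "w_sol \<epsilon> \<theta> \<phi> \<psi> x t - zD \<epsilon> \<phi> x t = (LINT s:{0..S}|lborel. hit (snd x) s * heat \<psi> (fst x) (\<rho> s))"
      unfolding S_def \<rho>_def
    proof (rule w_sol_minus_zD[OF pos(1) x0 m, where B = "A * S powr (- a)"])
      fix s assume "s \<in> {0..t / \<epsilon>}"
      then have s: "S \<le> \<rho> s"
        using \<rho>S by (simp add: S_def)
      then have r: "s + (t - \<epsilon> * s) / \<theta> > 0"
        using S by (simp add: \<rho>_def)
      show "integrable lborel (\<lambda>y. hk (fst x - y) (s + (t - \<epsilon> * s) / \<theta>) * \<psi> y)"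
        by (rule integrable_hk_mult_Lp[OF m i p r])
      have "(\<integral>y. hk (fst x - y) (s + (t - \<epsilon> * s) / \<theta>) * \<bar>\<psi> y\<bar> \<partial>lborel) \<le> A * \<rho> s powr (- a)"
        using integral_hk_mult_Lp_le[OF m i p r, of "fst x"] by (simp add: A_def a_def \<rho>_def)
      also have "\<dots> \<le> A * S powr (- a)"
        using s S a A by (intro mult_left_mono powr_mono2') auto
      finally show "(\<integral>y. hk (fst x - y) (s + (t - \<epsilon> * s) / \<theta>) * \<bar>\<psi> y\<bar> \<partial>lborel) \<le> A * S powr (- a)" .
    qed
    show ?thesis
    proof (cases "snd x = 0")
      case True
      then show ?thesis
        using w A C(1) c d0 by (simp add: set_lebesgue_integral_def l_def)
    next
      case False
      then have xp: "snd x > 0" using x0 by simp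
      have xS: "snd x + \<epsilon> * S > R"
        using R pos by (simp add: S_def)
      note CS = C(2)[OF xp S xS]
      define f where "f s = hit (snd x) s * heat \<psi> (fst x) (\<rho> s)" for s
      have fm [measurable]: "f \<in> borel_measurable borel"
        unfolding f_def \<rho>_def by measurable
      have fb: "\<bar>f s\<bar> \<le> hit (snd x) s * (A * \<rho> s powr (- a))" if "s \<in> {0..S}" for s
        using heat_le[of "\<rho> s" "fst x"] \<rho>S[OF that] S that x0 hit_nonneg[of "snd x" s]
        by (simp add: f_def abs_mult mult_left_mono)
      have b1: "\<bar>f s\<bar> \<le> A * (l * S / 2) powr (- a) * hit (snd x) s" if s: "s \<in> {0..S / 2}" for s
      proof -
        have "l * (S / 2) \<le> l * (S - s)"
          using s l by (intro mult_left_mono) auto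
        moreover have "l * (S / 2) = l * S / 2" "0 \<le> s"
          using s by auto
        ultimately have "l * S / 2 \<le> \<rho> s"
          unfolding \<rho> by linarith
        then have "\<rho> s powr (- a) \<le> (l * S / 2) powr (- a)"
          using l S a by (intro powr_mono2') auto
        then have "hit (snd x) s * (A * \<rho> s powr (- a)) \<le> hit (snd x) s * (A * (l * S / 2) powr (- a))"
          by (intro mult_left_mono A hit_nonneg x0 \<open>0 \<le> s\<close>)
        moreover have "s \<in> {0..S}"
          using s S by auto
        ultimately show ?thesis
          using fb[of s] by (simp add: mult_ac)
      qed
      have b2: "\<bar>f s\<bar> \<le> A * C * S powr (a - 1) * (S / 2 + l * (S - s)) powr (- a)" if s: "s \<in> {S / 2<..S}" for s
      proof -
        have s': "s \<in> {0..S}" "s \<in> {S / 2..S}"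
          using s S by auto
        have "0 \<le> l * (S - s)"
          using s l by auto
        then have "\<rho> s powr (- a) \<le> (S / 2 + l * (S - s)) powr (- a)"
          using s S a by (intro powr_mono2') (auto simp: \<rho>)
        then have "hit (snd x) s * (A * \<rho> s powr (- a)) \<le> (C * S powr (a - 1)) * (A * (S / 2 + l * (S - s)) powr (- a))"
          using CS s'(2) A C(1) by (intro mult_mono) auto
        then show ?thesis
          using fb[OF s'(1)] by (simp add: mult_ac)
      qed
      have i1: "set_integrable lborel {0..S / 2} (\<lambda>s. A * (l * S / 2) powr (- a) * hit (snd x) s)"
        using x0 by (intro set_integrable_mult_right set_integrable_hit_subset) auto
      have "continuous_on {S / 2..S} (\<lambda>s. (S / 2 + l * (S - s)) powr (- a))"
      proof (intro continuous_intros ballI)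
        fix s assume "s \<in> {S / 2..S}"
        then have "0 \<le> l * (S - s)"
          using l by auto
        then show "S / 2 + l * (S - s) \<noteq> 0"
          using S by linarith
      qed
      then have i2: "set_integrable lborel {S / 2..S} (\<lambda>s. A * C * S powr (a - 1) * (S / 2 + l * (S - s)) powr (- a))"
        by (intro set_integrable_mult_right borel_integrable_atLeastAtMost')
      then have i2': "set_integrable lborel {S / 2<..S} (\<lambda>s. A * C * S powr (a - 1) * (S / 2 + l * (S - s)) powr (- a))"
        by (rule set_integrable_subset) auto
      have "\<bar>LINT s:{0..S / 2}|lborel. f s\<bar> \<le> (LINT s:{0..S / 2}|lborel. A * (l * S / 2) powr (- a) * hit (snd x) s)"
        by (rule abs_set_integral_le[OF _ _ i1 b1]) auto
      also have "\<dots> \<le> A * (l * S / 2) powr (- a) * (C * S powr a)"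
      proof -
        have "(LINT s:{0..S / 2}|lborel. hit (snd x) s) \<le> (LINT s:{0..S}|lborel. hit (snd x) s)"
          using x0 S by (intro set_integral_mono_set set_integrable_hit_subset) (auto intro: hit_nonneg)
        then have "(LINT s:{0..S / 2}|lborel. hit (snd x) s) \<le> C * S powr a"
          using CS by simp
        then show ?thesis
          unfolding set_integral_mult_right using A by (intro mult_left_mono) auto
      qed
      also have "\<dots> = A * C * 2 powr a * l powr (- a)"
        using S l by (simp add: powr_mult powr_divide powr_minus field_simps)
      also have "\<dots> \<le> A * C * 2 powr a * decay_rate a l"
        using A C(1) powr_minus_le_decay_rate[OF a l] by (intro mult_left_mono) auto
      finally have I1: "\<bar>LINT s:{0..S / 2}|lborel. f s\<bar> \<le> A * C * 2 powr a * decay_rate a l" .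
      have "\<bar>LINT s:{S / 2<..S}|lborel. f s\<bar> \<le> (LINT s:{S / 2<..S}|lborel. A * C * S powr (a - 1) * (S / 2 + l * (S - s)) powr (- a))"
        by (rule abs_set_integral_le[OF _ _ i2' b2]) auto
      also have "\<dots> \<le> (LINT s:{S / 2..S}|lborel. A * C * S powr (a - 1) * (S / 2 + l * (S - s)) powr (- a))"
        using A C(1) by (intro set_integral_mono_set[OF i2]) auto
      also have "\<dots> \<le> A * C * S powr (a - 1) * (c * decay_rate a l * S powr (1 - a))"
        unfolding set_integral_mult_right c_def
        using set_integral_affine_powr_le[OF a, of l S] l S A C(1) by (intro mult_left_mono) auto
      also have "\<dots> = A * C * c * decay_rate a l * (S powr (a - 1) * S powr (1 - a))"
        by simp
      also have "S powr (a - 1) * S powr (1 - a) = 1"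
        using S by (simp flip: powr_add)
      finally have I2: "\<bar>LINT s:{S / 2<..S}|lborel. f s\<bar> \<le> A * C * c * decay_rate a l"
        by simp
      have "{0..S} = {0..S / 2} \<union> {S / 2<..S}" "{0..S / 2} \<inter> {S / 2<..S} = {}"
        using S by auto
      then have "(LINT s:{0..S}|lborel. f s) = (LINT s:{0..S / 2}|lborel. f s) + (LINT s:{S / 2<..S}|lborel. f s)"
        using set_integrable_dominated[OF _ _ i1 b1] set_integrable_dominated[OF _ _ i2' b2]
        by (simp add: set_integral_Un)
      then have "\<bar>w_sol \<epsilon> \<theta> \<phi> \<psi> x t - zD \<epsilon> \<phi> x t\<bar>
        \<le> A * C * 2 powr a * decay_rate a l + A * C * c * decay_rate a l"
        using I1 I2 unfolding w f_def by linarith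
      then show ?thesis
        by (simp add: l_def algebra_simps)
    qed
  qed
  moreover have "0 \<le> A * C * (2 powr a + c)"
    using A C(1) c by simp
  ultimately show ?thesis
    by blast
qed

text \<open>The comparison of \<open>a\<close> with 1 is that of \<open>p_N\<close> with
  \<open>p\<close>. Passing from \<open>l = \<epsilon> / \<theta>\<close> to
  \<open>1 / \<theta>\<close> costs a constant depending on \<open>\<epsilon>\<close>.\<close>

lemma decay_rate_le_fp:
  assumes "p \<ge> 1" "\<epsilon> > 0" "N \<ge> 2"
  shows "\<exists>C\<ge>0. \<forall>\<theta>. 0 < \<theta> \<and> \<theta> \<le> 1 / (1 + \<epsilon>) \<longrightarrow>
    decay_rate ((real N - 1) / (2 * p)) (\<epsilon> / \<theta>) \<le> C * fp N p (1 / \<theta>)"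
proof -
  define a where "a = (real N - 1) / (2 * p)"
  consider "a < 1" "(real N - 1) / 2 < p" | "a = 1" "p = (real N - 1) / 2" | "a > 1" "p < (real N - 1) / 2"
    unfolding a_def using assms(1) by (fastforce simp: field_simps)
  then show ?thesis
  proof cases
    case 1
    have "decay_rate a (\<epsilon> / \<theta>) \<le> \<epsilon> powr (- a) * fp N p (1 / \<theta>)" if "0 < \<theta>" for \<theta>
    proof -
      have "fp N p (1 / \<theta>) = (1 / \<theta>) powr (- (real N - 1) / (2 * p))"
        using 1(2) by (simp add: fp_def)
      also have "- (real N - 1) / (2 * p) = - a"
        by (simp only: a_def minus_divide_left)
      finally have fp: "fp N p (1 / \<theta>) = (1 / \<theta>) powr (- a)" .
      have "decay_rate a (\<epsilon> / \<theta>) = (\<epsilon> * (1 / \<theta>)) powr (- a)"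
        using 1(1) by (simp add: decay_rate_def)
      also have "\<dots> = \<epsilon> powr (- a) * (1 / \<theta>) powr (- a)"
        by (rule powr_mult)
      finally show ?thesis
        unfolding fp by (rule eq_refl)
    qed
    then show ?thesis
      unfolding a_def[symmetric] by (intro exI[of _ "\<epsilon> powr (- a)"]) auto
  next
    case 2
    have "decay_rate a (\<epsilon> / \<theta>) \<le> 2 / \<epsilon> * fp N p (1 / \<theta>)" if \<theta>: "0 < \<theta>" "\<theta> \<le> 1 / (1 + \<epsilon>)" for \<theta>
    proof -
      have r: "1 + \<epsilon> \<le> 1 / \<theta>"
        using \<theta> assms by (simp add: field_simps)
      \<comment> \<open>For \<open>\<theta> \<le> 1 / (1 + \<epsilon>)\<close> the argument
        \<open>1 + \<epsilon> / \<theta>\<close> is at most the square of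
        \<open>1 / \<theta>\<close>, which turns \<open>ln (1 + l)\<close> into
        \<open>2 * ln (1 / \<theta>)\<close>.\<close>
      have "1 + \<epsilon> / \<theta> \<le> (1 + \<epsilon>) / \<theta>"
        using r assms by (simp add: add_divide_distrib)
      also have "\<dots> \<le> 1 / \<theta> * (1 / \<theta>)"
        using mult_right_mono[OF r, of "1 / \<theta>"] \<theta> by simp
      finally have "ln (1 + \<epsilon> / \<theta>) \<le> ln (1 / \<theta> * (1 / \<theta>))"
        using \<theta> assms by (subst ln_le_cancel_iff) (auto intro: add_pos_pos)
      also have "\<dots> = 2 * ln (1 / \<theta>)"
        using \<theta> by (subst ln_mult_pos) auto
      finally have "ln (1 + \<epsilon> / \<theta>) / (\<epsilon> / \<theta>) \<le> 2 * ln (1 / \<theta>) / (\<epsilon> / \<theta>)"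
        using \<theta> assms by (intro divide_right_mono) auto
      also have "\<dots> = 2 / \<epsilon> * fp N p (1 / \<theta>)"
        using 2 by (simp add: fp_def)
      finally show ?thesis
        using 2(1) by (simp add: decay_rate_def)
    qed
    then show ?thesis
      using assms unfolding a_def[symmetric] by (intro exI[of _ "2 / \<epsilon>"]) auto
  next
    case 3
    have "decay_rate a (\<epsilon> / \<theta>) \<le> 1 / \<epsilon> * fp N p (1 / \<theta>)" for \<theta>
      using 3 by (simp add: fp_def decay_rate_def)
    then show ?thesis
      using assms unfolding a_def[symmetric] by (intro exI[of _ "1 / \<epsilon>"]) auto
  qed
qed

lemma w_sol_minus_zD_eventually_le:
  fixes \<phi> :: "('n::finite) pt \<Rightarrow> real" and p :: real
  assumes p: "1 \<le> p" and \<psi>: "Lp_bd p \<psi>" and pos: "\<epsilon> > 0" "R > 0"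
  shows "\<exists>C. \<forall>\<^sub>F \<theta> in at_right 0. \<forall>x t. x \<in> half_space_cl \<and> 0 < t \<and> snd x + t > R \<longrightarrow>
    \<bar>w_sol \<epsilon> \<theta> \<phi> \<psi> x t - zD \<epsilon> \<phi> x t\<bar> \<le> C * fp (Nd TYPE('n)) p (1 / \<theta>)"
proof -
  define a where "a = real CARD('n) / (2 * p)"
  obtain C where C: "C \<ge> 0" "\<And>\<theta> x t. 0 < \<theta> \<Longrightarrow> \<theta> \<le> \<epsilon> / 3 \<Longrightarrow> x \<in> half_space_cl \<Longrightarrow> 0 < t \<Longrightarrow> snd x + t > R \<Longrightarrow>
    \<bar>w_sol \<epsilon> \<theta> \<phi> \<psi> x t - zD \<epsilon> \<phi> x t\<bar> \<le> C * decay_rate a (\<epsilon> / \<theta>)"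
    using w_sol_minus_zD_bound[OF p \<psi> pos, of \<phi>] unfolding a_def by blast
  have "Nd TYPE('n) \<ge> 2" "a = (real (Nd TYPE('n)) - 1) / (2 * p)"
    by (auto simp: Nd_def a_def Suc_le_eq)
  then obtain C' where C': "\<And>\<theta>. 0 < \<theta> \<Longrightarrow> \<theta> \<le> 1 / (1 + \<epsilon>) \<Longrightarrow>
    decay_rate a (\<epsilon> / \<theta>) \<le> C' * fp (Nd TYPE('n)) p (1 / \<theta>)"
    using decay_rate_le_fp[OF p pos(1)] by metis
  have "\<bar>w_sol \<epsilon> \<theta> \<phi> \<psi> x t - zD \<epsilon> \<phi> x t\<bar> \<le> C * C' * fp (Nd TYPE('n)) p (1 / \<theta>)"
    if \<theta>: "\<theta> \<in> {0<..<min (\<epsilon> / 3) (1 / (1 + \<epsilon>))}" and x: "x \<in> half_space_cl" "0 < t" "snd x + t > R" for \<theta> x t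
  proof -
    have "\<bar>w_sol \<epsilon> \<theta> \<phi> \<psi> x t - zD \<epsilon> \<phi> x t\<bar> \<le> C * decay_rate a (\<epsilon> / \<theta>)"
      using \<theta> x by (intro C(2)) auto
    also have "\<dots> \<le> C * (C' * fp (Nd TYPE('n)) p (1 / \<theta>))"
      using \<theta> C(1) by (intro mult_left_mono C') auto
    finally show ?thesis
      by simp
  qed
  moreover have "\<forall>\<^sub>F \<theta> in at_right 0. \<theta> \<in> {0<..<min (\<epsilon> / 3) (1 / (1 + \<epsilon>))}"
    using pos by (intro eventually_at_right_real) auto
  ultimately show ?thesis
    by (intro exI[of _ "C * C'"]) (auto elim!: eventually_mono)
qed

theorem theorem5p5:
  fixes \<theta> :: real
  assumes "\<theta> > 0"
  shows
   "(\<forall>(\<phi>::('n::finite) pt \<Rightarrow> real) (\<psi>::real^'n \<Rightarrow> real) \<epsilon>.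
       Linf_half \<phi> \<and> Linf_bd \<psi> \<and> \<epsilon> > 0 \<longrightarrow>
       (\<forall>T>0. \<exists>C. \<forall>\<^sub>F k in at_top. \<forall>x t. x \<in> half_space \<and> 0 < t \<and> t < T \<longrightarrow>
          \<bar>u_sol \<epsilon> (k * \<theta>) k \<phi> \<psi> x t - w_sol \<epsilon> \<theta> \<phi> \<psi> x t\<bar> \<le> C * (1 / k)))
    \<and>
    (\<forall>p (\<phi>::'n pt \<Rightarrow> real) (\<psi>::real^'n \<Rightarrow> real) \<epsilon>.
       1 \<le> p \<and> Lp_half p \<phi> \<and> Lp_bd p \<psi> \<and> \<epsilon> > 0 \<longrightarrow>
       (\<forall>R>0. \<exists>C. \<forall>\<^sub>F th in at_right 0. \<forall>x t.
          x \<in> half_space_cl \<and> 0 < t \<and> snd x + t > R \<longrightarrow>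
          \<bar>w_sol \<epsilon> th \<phi> \<psi> x t - zD \<epsilon> \<phi> x t\<bar> \<le> C * fp (Nd TYPE('n)) p (1 / th)))
    \<and>
    (\<forall>(\<phi>::'n pt \<Rightarrow> real) (\<psi>::real^'n \<Rightarrow> real) \<epsilon>.
       Linf_half \<phi> \<and> Linf_bd \<psi> \<and> \<epsilon> > 0 \<longrightarrow>
       (\<forall>L>0. \<forall>T>0. \<exists>C. \<forall>\<^sub>F th in at_top. \<forall>x t.
          x \<in> half_space_cl \<and> snd x > L \<and> 0 < t \<and> t < T \<longrightarrow>
          \<bar>w_sol \<epsilon> th \<phi> \<psi> x t - wD \<epsilon> \<phi> \<psi> x t\<bar> \<le> C * (1 / th)))
    \<and>
    (\<forall>(\<phi>::'n pt \<Rightarrow> real) (\<psi>::real^'n \<Rightarrow> real).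
       Linf_half \<phi> \<and> Linf_bd \<psi> \<longrightarrow>
       (\<forall>L>0. \<forall>T>0. \<exists>C. \<forall>\<^sub>F \<epsilon> in at_right 0. \<forall>x t.
          x \<in> half_space_cl \<and> snd x \<le> L \<and> T < t \<longrightarrow>
          \<bar>w_sol \<epsilon> \<theta> \<phi> \<psi> x t - V_sol \<theta> \<psi> x t\<bar> \<le> C * sqrt \<epsilon>))
    \<and>
    (\<forall>(\<phi>::'n pt \<Rightarrow> real) (\<psi>::real^'n \<Rightarrow> real).
       BC_half \<phi> \<and> Linf_bd \<psi> \<longrightarrow>
       (\<forall>K T. compact K \<and> K \<subseteq> half_space \<and> T > 0 \<longrightarrow>
          (\<forall>e>0. \<forall>\<^sub>F \<epsilon> in at_top. \<forall>x\<in>K. \<forall>t. 0 < t \<and> t < T \<longrightarrow>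
             \<bar>w_sol \<epsilon> \<theta> \<phi> \<psi> x t - \<phi> x\<bar> \<le> e)))"
proof (intro conjI allI impI; (elim conjE)?)
  fix \<phi> :: "'n pt \<Rightarrow> real" and \<psi> :: "real^'n \<Rightarrow> real" and \<epsilon> T :: real
  assume "Linf_half \<phi>" "Linf_bd \<psi>" "\<epsilon> > 0" "T > 0"
  from u_sol_minus_w_sol_bound[OF this(1-3) \<open>\<theta> > 0\<close> this(4)]
  obtain C where C: "\<forall>k>0. \<forall>x t. x \<in> half_space \<and> 0 < t \<and> t < T \<longrightarrow>
      \<bar>u_sol \<epsilon> (k * \<theta>) k \<phi> \<psi> x t - w_sol \<epsilon> \<theta> \<phi> \<psi> x t\<bar> \<le> C * (1 / k)"
    by (rule exE)
  show "\<exists>C. \<forall>\<^sub>F k in at_top. \<forall>x t. x \<in> half_space \<and> 0 < t \<and> t < T \<longrightarrow>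
      \<bar>u_sol \<epsilon> (k * \<theta>) k \<phi> \<psi> x t - w_sol \<epsilon> \<theta> \<phi> \<psi> x t\<bar> \<le> C * (1 / k)"
    by (intro exI[of _ C], rule eventually_mono[OF eventually_gt_at_top[of 0]], erule C[THEN spec, THEN mp])
next
  fix p :: real and \<phi> :: "'n pt \<Rightarrow> real" and \<psi> :: "real^'n \<Rightarrow> real" and \<epsilon> R :: real
  assume "1 \<le> p" "Lp_bd p \<psi>" "\<epsilon> > 0" "R > 0"
  then show "\<exists>C. \<forall>\<^sub>F th in at_right 0. \<forall>x t. x \<in> half_space_cl \<and> 0 < t \<and> snd x + t > R \<longrightarrow>
      \<bar>w_sol \<epsilon> th \<phi> \<psi> x t - zD \<epsilon> \<phi> x t\<bar> \<le> C * fp (Nd TYPE('n)) p (1 / th)"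
    by (rule w_sol_minus_zD_eventually_le)
next
  fix \<phi> :: "'n pt \<Rightarrow> real" and \<psi> :: "real^'n \<Rightarrow> real" and \<epsilon> L T :: real
  assume "Linf_bd \<psi>" "\<epsilon> > 0" "L > 0" "T > 0"
  from w_sol_minus_wD_bound[OF this, of \<phi>]
  obtain C where C: "\<forall>\<theta>>0. \<forall>x t. snd x > L \<and> 0 < t \<and> t < T \<longrightarrow>
      \<bar>w_sol \<epsilon> \<theta> \<phi> \<psi> x t - wD \<epsilon> \<phi> \<psi> x t\<bar> \<le> C * (1 / \<theta>)"
    by (rule exE)
  have "\<forall>\<^sub>F th in at_top. \<forall>x t. x \<in> half_space_cl \<and> snd x > L \<and> 0 < t \<and> t < T \<longrightarrow>
      \<bar>w_sol \<epsilon> th \<phi> \<psi> x t - wD \<epsilon> \<phi> \<psi> x t\<bar> \<le> C * (1 / th)"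
    using eventually_gt_at_top[of 0] by eventually_elim (use C in auto)
  then show "\<exists>C. \<forall>\<^sub>F th in at_top. \<forall>x t. x \<in> half_space_cl \<and> snd x > L \<and> 0 < t \<and> t < T \<longrightarrow>
      \<bar>w_sol \<epsilon> th \<phi> \<psi> x t - wD \<epsilon> \<phi> \<psi> x t\<bar> \<le> C * (1 / th)"
    by (rule exI[of _ C])
next
  fix \<phi> :: "'n pt \<Rightarrow> real" and \<psi> :: "real^'n \<Rightarrow> real" and L T :: real
  assume "Linf_half \<phi>" "Linf_bd \<psi>" "L > 0" "T > 0"
  from w_sol_minus_V_sol_bound[OF this(1,2) \<open>\<theta> > 0\<close> this(3,4)]
  obtain C where C: "\<forall>\<epsilon>. 0 < \<epsilon> \<and> \<epsilon> \<le> 1 \<longrightarrow> (\<forall>x t. x \<in> half_space_cl \<and> snd x \<le> L \<and> T < t \<longrightarrow>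
      \<bar>w_sol \<epsilon> \<theta> \<phi> \<psi> x t - V_sol \<theta> \<psi> x t\<bar> \<le> C * sqrt \<epsilon>)"
    by (rule exE)
  have "\<forall>\<^sub>F \<epsilon> :: real in at_right 0. \<epsilon> \<in> {0<..<1}"
    by (intro eventually_at_right_real) auto
  then have "\<forall>\<^sub>F \<epsilon> in at_right 0. \<forall>x t. x \<in> half_space_cl \<and> snd x \<le> L \<and> T < t \<longrightarrow>
      \<bar>w_sol \<epsilon> \<theta> \<phi> \<psi> x t - V_sol \<theta> \<psi> x t\<bar> \<le> C * sqrt \<epsilon>"
    by eventually_elim (use C in auto)
  then show "\<exists>C. \<forall>\<^sub>F \<epsilon> in at_right 0. \<forall>x t. x \<in> half_space_cl \<and> snd x \<le> L \<and> T < t \<longrightarrow>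
      \<bar>w_sol \<epsilon> \<theta> \<phi> \<psi> x t - V_sol \<theta> \<psi> x t\<bar> \<le> C * sqrt \<epsilon>"
    by (rule exI[of _ C])
next
  fix \<phi> :: "'n pt \<Rightarrow> real" and \<psi> :: "real^'n \<Rightarrow> real" and K :: "'n pt set" and T e :: real
  assume "BC_half \<phi>" "Linf_bd \<psi>" "compact K" "K \<subseteq> half_space" "T > 0" "e > 0"
  then show "\<forall>\<^sub>F \<epsilon> in at_top. \<forall>x\<in>K. \<forall>t. 0 < t \<and> t < T \<longrightarrow> \<bar>w_sol \<epsilon> \<theta> \<phi> \<psi> x t - \<phi> x\<bar> \<le> e"
    using assms by (intro w_sol_tendsto_initial)
qed

end
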